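(* Let $k\ge 0$ be an integer. (1) Let $X,Y\in \mathrm{CW}_B^B$. Then there are split exact sequences of monoids $$0\to\mathfrak{A}^{k,X}_{\#,Y}(X\times_B Y)\to\mathfrak{A}^k_{\#,Y}(X\times_B Y)\xrightarrow{\ \phi_X\ }\mathfrak{A}^k_{\#}(X)\to 0,$$ $$0\to\mathfrak{A}^{k,Y}_{\#,X}(X\times_B Y)\to\mathfrak{A}^k_{\#,X}(X\times_B Y)\xrightarrow{\ \phi_Y\ }\mathfrak{A}^k_{\#}(Y)\to 0,$$ where the first maps are the inclusions, $\phi_X(f_X,p_Y)=f_X\circ\iota_X$ and $\phi_Y(p_X,f_Y)=f_Y\circ\iota_Y$. (2) Moreover, if each $f=(f_X,f_Y)\in \mathfrak{A}^k_{\#}(X\times_B Y)$ is $k$-reducible and satisfies $f_Y\simeq^B_B f_Y\circ\iota_Y\circ p_Y$, then $$\mathfrak{A}^k_{\#}(X\times_B Y)=\mathfrak{A}^k_{\#,X}(X\times_B Y)\cdot\mathfrak{A}^k_{\#,Y}(X\times_B Y).$$ (3) The analogous results hold for higher fibred products. Let $X_1,\dots,X_n\in \mathrm{CW}_B^B$ and $\mathbf{X}=X_1\times_B\cdots\times_B X_n$. For each $i\in\{1,\dots,n\}$ the assignment $\phi_{X_i}(p_{X_1},\dots,f_{X_i},\dots,p_{X_n})=f_{X_i}\circ\iota_{X_i}$ defines a monoid homomorphism $\phi_{X_i}:\mathfrak{A}^k_{\#,\prod_{\hat i}}(\mathbf{X})\to\mathfrak{A}^k_\#(X_i)$, and there is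 a split exact sequence of monoids $$0\to \mathfrak{A}^{k,X_i}_{\#,\prod_{\hat i}}(\mathbf{X})\to \mathfrak{A}^k_{\#,\prod_{\hat i}}(\mathbf{X})\xrightarrow{\ \phi_{X_i}\ }\mathfrak{A}^k_{\#}(X_i)\to 0.$$ If each $f=(f_{X_1},\dots,f_{X_n})\in\mathfrak{A}^k_\#(\mathbf{X})$ is $k$-reducible and satisfies $f_{X_i}\simeq^B_B f_{X_i}\circ\iota_{X_i}\circ p_{X_i}$ for all $2\le i\le n$, then $$\mathfrak{A}^k_{\#}(\mathbf{X})=\mathfrak{A}^k_{\#,\prod_{\hat n}}(\mathbf{X})\cdots\mathfrak{A}^k_{\#,\prod_{\hat 1}}(\mathbf{X}).$$
   Context: Let $B$ be a connected pointed CW-complex. A fibrewise pointed space over $B$ is a triple $(X,p,s)$ with maps $B\xrightarrow{s}X\xrightarrow{p}B$, $p\circ s=\mathrm{Id}_B$. A fibrewise pointed map $f:(X,p,s)\to(Y,q,t)$ is a map with $q\circ f=p$ and $f\circ s=t$; these form the set $\mathrm{map}^B_B(X,Y)$. Two such maps are fibrewise pointed homotopic, $f\simeq^B_B g$, if they are joined by a homotopy through fibrewise pointed maps; $[X,Y]^B_B$ is the set of homotopy classes. A map and its class in $[X,Y]^B_B$ are not distinguished, so equalities between elements of the monoids below are equalities of homotopy classes. $\mathrm{CW}_B^B$ is the full subcategory of fibrewise pointed spaces $(X,p,s)$ such that $p$ is a fibration and both $X$ and the fibre of $p$ have the homotopy type of connected CW-complexes. The base point of $X$ is the image under $s$ of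 the base point of $B$. For $X\in\mathrm{CW}_B^B$ and an integer $k\ge0$, $\mathfrak{A}^k_\#(X)=\{f\in[X,X]^B_B:\ \pi_i(f):\pi_i(X)\to\pi_i(X)\text{ is an isomorphism for }0\le i\le k\}$, a monoid under composition. For $(X,p,s),(Y,q,t)\in\mathrm{CW}_B^B$ the fibred product is $X\times_BY=\{(x,y):p(x)=q(y)\}$, with projection $(x,y)\mapsto p(x)=q(y)$ to $B$ and section $b\mapsto(s(b),t(b))$. Let $p_X,p_Y$ be the projections of $X\times_BY$ to $X,Y$, and $\iota_X(x)=(x,tp(x))$, $\iota_Y(y)=(sq(y),y)$. A fibrewise pointed self-map $f$ of $X\times_BY$ is written $f=(f_X,f_Y)$ with $f_X=p_X\circ f$, $f_Y=p_Y\circ f$. An element $f=(f_X,f_Y)\in\mathfrak{A}^k_\#(X\times_BY)$ is $k$-reducible if $(p_X,f_Y)$ and $(f_X,p_Y)$ belong to $\mathfrak{A}^k_\#(X\times_BY)$. Define the submonoids $\mathfrak{A}^k_{\#,X}(X\times_BY)=\{f\in\mathfrak{A}^k_\#(X\times_BY):p_X\circ f=p_X\}$ (elements of the form $(p_X,f_Y)$), $\mathfrak{A}^k_{\#,Y}(X\times_BY)=\{f\in\mathfrak{A}^k_\#(X\times_BY):p_Y\circ f=p_Y\}$ (elements of the form $(f_X,p_Y)$), $\mathfrak{A}^{k,X}_{\#,Y}(X\times_BY)=\{(f_X,p_Y)\in\mathfrak{A}^k_{\#,Y}(X\times_BY):(f_X,p_Y)\circ\iota_X=\iota_X\}$, $\mathfrak{A}^{k,Y}_{\#,X}(X\times_BY)=\{(p_X,f_Y)\in\mathfrak{A}^k_{\#,X}(X\times_BY):(p_X,f_Y)\circ\iota_Y=\iota_Y\}$.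 For $(X_i,p_i,s_i)\in\mathrm{CW}_B^B$, $1\le i\le n$, $\mathbf{X}=X_1\times_B\cdots\times_BX_n=\{(x_1,\dots,x_n):p_i(x_i)=p_j(x_j)\ \forall i,j\}$, an object of $\mathrm{CW}_B^B$ with projection $(x_1,\dots,x_n)\mapsto p_i(x_i)$ and section $b\mapsto(s_1(b),\dots,s_n(b))$. $p_{X_i}:\mathbf{X}\to X_i$ is the projection and $\iota_{X_i}:X_i\to\mathbf{X}$ sends $x$ to the tuple with $i$-th entry $x$ and $j$-th entry $s_jp_i(x)$ for $j\ne i$. A self-map is written $f=(f_{X_1},\dots,f_{X_n})$, $f_{X_i}=p_{X_i}\circ f$; $f\in\mathfrak{A}^k_\#(\mathbf{X})$ is $k$-reducible if for every $i$ the map $(p_{X_1},\dots,f_{X_i},\dots,p_{X_n})$ (with $f_{X_i}$ in the $i$-th place and $p_{X_j}$ in every other place) lies in $\mathfrak{A}^k_\#(\mathbf{X})$. Further, $\mathfrak{A}^k_{\#,\prod_{\hat i}}(\mathbf{X})=\{f\in\mathfrak{A}^k_\#(\mathbf{X}):p_{X_j}\circ f=p_{X_j}\text{ for all }j\ne i\}$ (elements of the form $(p_{X_1},\dots,f_{X_i},\dots,p_{X_n})$), and $\mathfrak{A}^{k,X_i}_{\#,\prod_{\hat i}}(\mathbf{X})=\{f\in\mathfrak{A}^k_{\#,\prod_{\hat i}}(\mathbf{X}):f\circ\iota_{X_i}=\iota_{X_i}\}$. For submonoids $M_1,\dots,M_r$ of a monoid, $M_1\cdots M_r$ is the set of products (composites)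 $m_1\cdots m_r$ with $m_i\in M_i$. A split exact sequence $0\to K\to M\xrightarrow{\phi}N\to0$ of monoids is defined as for groups, forgetting inverses: $K\to M$ is an injective homomorphism with image $\phi^{-1}(1)$, $\phi$ is a surjective homomorphism, and there is a monoid homomorphism $\psi:N\to M$ with $\phi\circ\psi=\mathrm{Id}_N$. *)

theory Defs
  imports "HOL-Analysis.Analysis" "HOL-Algebra.Coset"
begin

section \<open>CW-complexes\<close>

definition disc :: "nat \<Rightarrow> (nat \<Rightarrow> real) topology" where
  "disc n = subtopology (Euclidean_space n) {x. (\<Sum>i<n. (x i)\<^sup>2) \<le> 1}"

definition disc_interior :: "nat \<Rightarrow> (nat \<Rightarrow> real) set" where
  "disc_interior n = {x \<in> topspace (disc n). (\<Sum>i<n. (x i)\<^sup>2) < 1}"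

definition disc_boundary :: "nat \<Rightarrow> (nat \<Rightarrow> real) set" where
  "disc_boundary n = {x \<in> topspace (disc n). (\<Sum>i<n. (x i)\<^sup>2) = 1}"

text \<open>
  Whitehead's description of a CW-complex. A cell is a pair of its dimension \<open>n\<close> and its
  characteristic map \<open>\<Phi>\<close>; the open cell is the image of the interior of the disc, the closed cell
  is the image of the disc.
\<close>

definition open_cell :: "nat \<times> ((nat \<Rightarrow> real) \<Rightarrow> 'a) \<Rightarrow> 'a set" where
  "open_cell e = snd e ` disc_interior (fst e)"

definition closed_cell :: "nat \<times> ((nat \<Rightarrow> real) \<Rightarrow> 'a) \<Rightarrow> 'a set" where
  "closed_cell e = snd e ` topspace (disc (fst e))"

definition CW_structure :: "'a topology \<Rightarrow> (nat \<times> ((nat \<Rightarrow> real) \<Rightarrow> 'a)) set \<Rightarrow> bool" where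
  "CW_structure X C \<longleftrightarrow>
     Hausdorff_space X \<and>
     (\<forall>(n, \<Phi>) \<in> C. continuous_map (disc n) X \<Phi> \<and>
        embedding_map (subtopology (disc n) (disc_interior n)) X \<Phi>) \<and>
     (\<forall>x \<in> topspace X. \<exists>!e. e \<in> C \<and> x \<in> open_cell e) \<and>
     (\<forall>(n, \<Phi>) \<in> C. \<exists>F. F \<subseteq> C \<and> finite F \<and> (\<forall>e \<in> F. fst e < n) \<and>
        \<Phi> ` disc_boundary n \<subseteq> (\<Union>e \<in> F. open_cell e)) \<and>
     (\<forall>A. A \<subseteq> topspace X \<longrightarrow> (\<forall>e \<in> C. closedin X (A \<inter> closed_cell e)) \<longrightarrow> closedin X A)"

definition CW_complex :: "'a topology \<Rightarrow> bool" where
  "CW_complex X \<longleftrightarrow> (\<exists>C. CW_structure X C)"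

text \<open>
  The type argument is the type carrying the points of the CW-complex. HOL cannot quantify over
  types inside a formula; a theorem that uses this predicate only as a hypothesis, with a type
  variable as argument, covers CW-complexes on every type.
\<close>

definition connected_CW_homotopy_type :: "'k itself \<Rightarrow> 'a topology \<Rightarrow> bool" where
  "connected_CW_homotopy_type T X \<longleftrightarrow>
     (\<exists>K :: 'k topology. CW_complex K \<and> connected_space K \<and> X homotopy_equivalent_space K)"


section \<open>Hurewicz fibrations\<close>

definition homotopy_lifting ::
  "'z topology \<Rightarrow> 'e topology \<Rightarrow> 'b topology \<Rightarrow> ('e \<Rightarrow> 'b) \<Rightarrow> bool" where
  "homotopy_lifting Z E B p \<longleftrightarrow>
     (\<forall>f H. continuous_map Z E f \<and>
        continuous_map (prod_topology (top_of_set {0..1::real}) Z) B H \<and>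
        (\<forall>z \<in> topspace Z. H (0, z) = p (f z)) \<longrightarrow>
        (\<exists>G. continuous_map (prod_topology (top_of_set {0..1::real}) Z) E G \<and>
           (\<forall>z \<in> topspace Z. G (0, z) = f z) \<and>
           (\<forall>t \<in> {0..1}. \<forall>z \<in> topspace Z. p (G (t, z)) = H (t, z))))"

text \<open>
  The test spaces range over all topologies on one type which is large enough to carry the path
  space \<open>{(e, \<omega>). \<omega> 0 = p e}\<close>. By \<open>fibration_homotopy_lifting\<close> below, lifting then
  holds for test spaces on arbitrary types.
\<close>

definition fibration :: "'e topology \<Rightarrow> 'b topology \<Rightarrow> ('e \<Rightarrow> 'b) \<Rightarrow> bool" where
  "fibration E B p \<longleftrightarrow> continuous_map E B p \<and>
     (\<forall>Z :: ('e \<times> (real \<Rightarrow> 'b)) topology. homotopy_lifting Z E B p)"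

lemma quotient_topology_exists:
  obtains Y where "quotient_map X Y q" "topspace Y = q ` topspace X"
proof -
  define P where "P U \<longleftrightarrow> U \<subseteq> q ` topspace X \<and> openin X {x \<in> topspace X. q x \<in> U}" for U
  have "istopology P"
    unfolding istopology_def
  proof (intro conjI allI impI)
    fix S T assume "P S" "P T"
    moreover have "{x \<in> topspace X. q x \<in> S \<inter> T} =
      {x \<in> topspace X. q x \<in> S} \<inter> {x \<in> topspace X. q x \<in> T}" by auto
    ultimately show "P (S \<inter> T)" unfolding P_def by auto
  next
    fix K assume K: "\<forall>U\<in>K. P U"
    have "{x \<in> topspace X. q x \<in> \<Union>K} = (\<Union>U\<in>K. {x \<in> topspace X. q x \<in> U})" by auto
    then show "P (\<Union>K)" using K unfolding P_def by auto
  qed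
  then have op: "openin (topology P) = P" by (simp add: topology_inverse')
  have "P (q ` topspace X)"
  proof -
    have "{x \<in> topspace X. q x \<in> q ` topspace X} = topspace X" by auto
    then show ?thesis unfolding P_def by simp
  qed
  moreover have "U \<subseteq> q ` topspace X" if "P U" for U
    using that unfolding P_def by simp
  ultimately have ts: "topspace (topology P) = q ` topspace X"
    unfolding topspace_def[of "topology P"] op by blast
  have "quotient_map X (topology P) q"
    unfolding quotient_map_def ts op by (auto simp: P_def)
  with ts that show ?thesis by blast
qed

lemma fibration_homotopy_lifting:
  fixes E :: "'e topology" and B :: "'b topology" and Z :: "'z topology"
  assumes "fibration E B p"
  shows "homotopy_lifting Z E B p"
  unfolding homotopy_lifting_def
proof (intro allI impI, elim conjE)
  let ?I = "top_of_set {0..1::real}"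
  fix f H
  assume f: "continuous_map Z E f" and H: "continuous_map (prod_topology ?I Z) B H"
    and H0: "\<forall>z \<in> topspace Z. H (0, z) = p (f z)"
  define q where "q z = (f z, \<lambda>t. H (t, z))" for z
  obtain Y where q: "quotient_map Z Y q" and Y: "topspace Y = q ` topspace Z"
    by (rule quotient_topology_exists)
  have lc: "locally_compact_space ?I"
    by (rule compact_imp_locally_compact_space)
      (simp add: compact_space_subtopology)
  have hs: "Hausdorff_space ?I"
    by (rule Hausdorff_space_subtopology) (rule Hausdorff_space_euclidean)
  have Q: "quotient_map (prod_topology ?I Z) (prod_topology ?I Y) (\<lambda>(t, z). (t, q z))"
    by (rule quotient_map_prod_right[OF lc disjI1[OF hs] q])
  have "fst \<circ> q = f" by (simp add: fun_eq_iff q_def)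
  with f have f': "continuous_map Y E fst"
    by (intro continuous_compose_quotient_map[OF q]) simp
  have "(\<lambda>(t, w). snd w t) \<circ> (\<lambda>(t, z). (t, q z)) = H" by (simp add: fun_eq_iff q_def)
  with H have H': "continuous_map (prod_topology ?I Y) B (\<lambda>(t, w). snd w t)"
    by (intro continuous_compose_quotient_map[OF Q]) simp
  have lift: "homotopy_lifting Y E B p" using assms unfolding fibration_def by blast
  have H0': "\<forall>w \<in> topspace Y. (\<lambda>(t, w). snd w t) (0, w) = p (fst w)"
    using H0 by (auto simp: Y q_def)
  have "\<exists>G. continuous_map (prod_topology ?I Y) E G \<and>
      (\<forall>w \<in> topspace Y. G (0, w) = fst w) \<and>
      (\<forall>t \<in> {0..1}. \<forall>w \<in> topspace Y. p (G (t, w)) = (\<lambda>(t, w). snd w t) (t, w))"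
    by (rule lift[unfolded homotopy_lifting_def, rule_format]) (intro conjI f' H' H0')
  then obtain G where G: "continuous_map (prod_topology ?I Y) E G"
    and G0: "\<forall>w \<in> topspace Y. G (0, w) = fst w"
    and G1: "\<forall>t \<in> {0..1}. \<forall>w \<in> topspace Y. p (G (t, w)) = snd w t"
    by auto
  have "continuous_map (prod_topology ?I Z) E (G \<circ> (\<lambda>(t, z). (t, q z)))"
    using continuous_map_compose[OF quotient_imp_continuous_map[OF Q] G] .
  moreover have "\<forall>z \<in> topspace Z. (G \<circ> (\<lambda>(t, z). (t, q z))) (0, z) = f z"
    using G0 by (auto simp: Y q_def)
  moreover have "\<forall>t \<in> {0..1}. \<forall>z \<in> topspace Z. p ((G \<circ> (\<lambda>(t, z). (t, q z))) (t, z)) = H (t, z)"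
    using G1 by (auto simp: Y q_def)
  ultimately show "\<exists>G. continuous_map (prod_topology ?I Z) E G \<and>
      (\<forall>z \<in> topspace Z. G (0, z) = f z) \<and>
      (\<forall>t \<in> {0..1}. \<forall>z \<in> topspace Z. p (G (t, z)) = H (t, z))"
    by (intro exI[of _ "G \<circ> (\<lambda>(t, z). (t, q z))"] conjI)
qed


section \<open>Homotopy groups\<close>

definition cube :: "nat \<Rightarrow> (nat \<Rightarrow> real) topology" where
  "cube n = product_topology (\<lambda>_. top_of_set {0..1}) {..<n}"

definition cube_boundary :: "nat \<Rightarrow> (nat \<Rightarrow> real) set" where
  "cube_boundary n = {u \<in> topspace (cube n). \<exists>i<n. u i = 0 \<or> u i = 1}"

definition spheroid :: "nat \<Rightarrow> 'a topology \<Rightarrow> 'a \<Rightarrow> ((nat \<Rightarrow> real) \<Rightarrow> 'a) \<Rightarrow> bool" where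
  "spheroid n X x0 \<alpha> \<longleftrightarrow> continuous_map (cube n) X \<alpha> \<and> (\<forall>u \<in> cube_boundary n. \<alpha> u = x0)"

definition spheroid_homotopic ::
  "nat \<Rightarrow> 'a topology \<Rightarrow> 'a \<Rightarrow> ((nat \<Rightarrow> real) \<Rightarrow> 'a) \<Rightarrow> ((nat \<Rightarrow> real) \<Rightarrow> 'a) \<Rightarrow> bool" where
  "spheroid_homotopic n X x0 \<alpha> \<beta> \<longleftrightarrow> homotopic_with (spheroid n X x0) (cube n) X \<alpha> \<beta>"

definition homotopy_classes :: "nat \<Rightarrow> 'a topology \<Rightarrow> 'a \<Rightarrow> ((nat \<Rightarrow> real) \<Rightarrow> 'a) set set" where
  "homotopy_classes n X x0 =
     {\<alpha>. spheroid n X x0 \<alpha>} // {(\<alpha>, \<beta>). spheroid_homotopic n X x0 \<alpha> \<beta>}"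

definition spheroid_concat ::
  "((nat \<Rightarrow> real) \<Rightarrow> 'a) \<Rightarrow> ((nat \<Rightarrow> real) \<Rightarrow> 'a) \<Rightarrow> (nat \<Rightarrow> real) \<Rightarrow> 'a" where
  "spheroid_concat \<alpha> \<beta> u =
     (if u 0 \<le> 1/2 then \<alpha> (u(0 := 2 * u 0)) else \<beta> (u(0 := 2 * u 0 - 1)))"

text \<open>The group structure is meaningful for \<open>n \<ge> 1\<close> only.\<close>

definition homotopy_group ::
  "nat \<Rightarrow> 'a topology \<Rightarrow> 'a \<Rightarrow> ((nat \<Rightarrow> real) \<Rightarrow> 'a) set monoid" where
  "homotopy_group n X x0 =
     \<lparr>carrier = homotopy_classes n X x0,
      monoid.mult = (\<lambda>c d. {\<gamma>. \<exists>\<alpha> \<in> c. \<exists>\<beta> \<in> d. spheroid_homotopic n X x0 (spheroid_concat \<alpha> \<beta>) \<gamma>}),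
      one = {\<gamma>. spheroid_homotopic n X x0 (\<lambda>_. x0) \<gamma>}\<rparr>"

definition induced_map ::
  "nat \<Rightarrow> 'y topology \<Rightarrow> 'y \<Rightarrow> ('x \<Rightarrow> 'y) \<Rightarrow>
     ((nat \<Rightarrow> real) \<Rightarrow> 'x) set \<Rightarrow> ((nat \<Rightarrow> real) \<Rightarrow> 'y) set" where
  "induced_map n Y y0 f c = {\<beta>. \<exists>\<alpha> \<in> c. spheroid_homotopic n Y y0 (f \<circ> \<alpha>) \<beta>}"

definition induces_iso ::
  "nat \<Rightarrow> 'x topology \<Rightarrow> 'x \<Rightarrow> 'y topology \<Rightarrow> 'y \<Rightarrow> ('x \<Rightarrow> 'y) \<Rightarrow> bool" where
  "induces_iso n X x0 Y y0 f \<longleftrightarrow>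
     (if n = 0
      then bij_betw (induced_map 0 Y y0 f) (homotopy_classes 0 X x0) (homotopy_classes 0 Y y0)
      else induced_map n Y y0 f \<in> iso (homotopy_group n X x0) (homotopy_group n Y y0))"


section \<open>Fibrewise pointed spaces\<close>

record ('b, 'x) fw_space =
  total :: "'x topology"
  proj :: "'x \<Rightarrow> 'b"
  sect :: "'b \<Rightarrow> 'x"

definition fw_pointed_space :: "'b topology \<Rightarrow> ('b, 'x) fw_space \<Rightarrow> bool" where
  "fw_pointed_space B X \<longleftrightarrow>
     continuous_map (total X) B (proj X) \<and> continuous_map B (total X) (sect X) \<and>
     (\<forall>b \<in> topspace B. proj X (sect X b) = b)"

definition fw_map ::
  "'b topology \<Rightarrow> ('b, 'x) fw_space \<Rightarrow> ('b, 'y) fw_space \<Rightarrow> ('x \<Rightarrow> 'y) \<Rightarrow> bool" where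
  "fw_map B X Y f \<longleftrightarrow> continuous_map (total X) (total Y) f \<and>
     (\<forall>x \<in> topspace (total X). proj Y (f x) = proj X x) \<and>
     (\<forall>b \<in> topspace B. f (sect X b) = sect Y b)"

definition fw_homotopic ::
  "'b topology \<Rightarrow> ('b, 'x) fw_space \<Rightarrow> ('b, 'y) fw_space \<Rightarrow> ('x \<Rightarrow> 'y) \<Rightarrow> ('x \<Rightarrow> 'y) \<Rightarrow> bool" where
  "fw_homotopic B X Y f g \<longleftrightarrow> homotopic_with (fw_map B X Y) (total X) (total Y) f g"

definition fw_class ::
  "'b topology \<Rightarrow> ('b, 'x) fw_space \<Rightarrow> ('b, 'y) fw_space \<Rightarrow> ('x \<Rightarrow> 'y) \<Rightarrow> ('x \<Rightarrow> 'y) set" where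
  "fw_class B X Y f = {g. fw_homotopic B X Y f g}"

definition fw_classes ::
  "'b topology \<Rightarrow> ('b, 'x) fw_space \<Rightarrow> ('b, 'y) fw_space \<Rightarrow> ('x \<Rightarrow> 'y) set set" where
  "fw_classes B X Y = {f. fw_map B X Y f} // {(f, g). fw_homotopic B X Y f g}"

text \<open>
  Composite \<open>c \<circ> d\<close> of homotopy classes of maps into and out of an intermediate space; \<open>X\<close> is the
  source of \<open>d\<close> and \<open>Z\<close> the target of \<open>c\<close>.
\<close>

definition fw_comp ::
  "'b topology \<Rightarrow> ('b, 'x) fw_space \<Rightarrow> ('b, 'z) fw_space \<Rightarrow>
     ('y \<Rightarrow> 'z) set \<Rightarrow> ('x \<Rightarrow> 'y) set \<Rightarrow> ('x \<Rightarrow> 'z) set" where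
  "fw_comp B X Z c d = {h. \<exists>g \<in> c. \<exists>f \<in> d. fw_homotopic B X Z (g \<circ> f) h}"

lemma fw_map_comp:
  assumes f: "fw_map B X Y f" and g: "fw_map B Y Z g"
  shows "fw_map B X Z (g \<circ> f)"
proof -
  have "f x \<in> topspace (total Y)" if "x \<in> topspace (total X)" for x
    using f that continuous_map_funspace unfolding fw_map_def by fastforce
  with f g show ?thesis
    unfolding fw_map_def by (auto intro: continuous_map_compose)
qed

lemma fw_comp_class:
  assumes f: "fw_map B X Y f" and g: "fw_map B Y Z g"
  shows "fw_comp B X Z (fw_class B Y Z g) (fw_class B X Y f) = fw_class B X Z (g \<circ> f)"
proof -
  have cont: "continuous_map (total X) (total Y) f" if "fw_map B X Y f" for f
    using that by (simp add: fw_map_def)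
  have contg: "continuous_map (total Y) (total Z) g"
    using g by (simp add: fw_map_def)
  have refl: "fw_homotopic B X Y f f" "fw_homotopic B Y Z g g"
    unfolding fw_homotopic_def homotopic_with_refl using f g cont[OF f] contg by blast+
  have comp: "fw_homotopic B X Z (g \<circ> f) (g' \<circ> f')"
    if g': "fw_homotopic B Y Z g g'" and f': "fw_homotopic B X Y f f'" for g' f'
  proof -
    have mf': "fw_map B X Y f'"
      using f' homotopic_with_imp_property unfolding fw_homotopic_def by blast
    have "homotopic_with (fw_map B X Z) (total X) (total Z) (g \<circ> f) (g \<circ> f')"
      by (rule homotopic_with_compose_continuous_map_left[OF f'[unfolded fw_homotopic_def] contg])
        (rule fw_map_comp[OF _ g])
    moreover have "homotopic_with (fw_map B X Z) (total X) (total Z) (g \<circ> f') (g' \<circ> f')"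
      by (rule homotopic_with_compose_continuous_map_right
            [OF g'[unfolded fw_homotopic_def] cont[OF mf']])
        (rule fw_map_comp[OF mf'])
    ultimately show ?thesis
      unfolding fw_homotopic_def by (rule homotopic_with_trans)
  qed
  have trans: "fw_homotopic B X Z u w" if "fw_homotopic B X Z u v" "fw_homotopic B X Z v w" for u v w
    using that homotopic_with_trans unfolding fw_homotopic_def by blast
  show ?thesis
    unfolding fw_comp_def fw_class_def using refl comp trans by blast
qed

definition CW_fw_space ::
  "'k itself \<Rightarrow> 'b topology \<Rightarrow> 'b \<Rightarrow> ('b, 'x) fw_space \<Rightarrow> bool" where
  "CW_fw_space T B b0 X \<longleftrightarrow>
     fw_pointed_space B X \<and> fibration (total X) B (proj X) \<and>
     connected_CW_homotopy_type T (total X) \<and>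
     connected_CW_homotopy_type T
       (subtopology (total X) {x \<in> topspace (total X). proj X x = b0})"


section \<open>The monoids of self-maps\<close>

definition self_classes ::
  "'b topology \<Rightarrow> 'b \<Rightarrow> nat \<Rightarrow> ('b, 'x) fw_space \<Rightarrow> ('x \<Rightarrow> 'x) set set" where
  "self_classes B b0 k X = {c \<in> fw_classes B X X. \<forall>f \<in> c. \<forall>i \<le> k.
     induces_iso i (total X) (sect X b0) (total X) (sect X b0) f}"

definition self_monoid ::
  "'b topology \<Rightarrow> 'b \<Rightarrow> nat \<Rightarrow> ('b, 'x) fw_space \<Rightarrow> ('x \<Rightarrow> 'x) set monoid" where
  "self_monoid B b0 k X =
     \<lparr>carrier = self_classes B b0 k X, monoid.mult = fw_comp B X X, one = fw_class B X X id\<rparr>"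

definition monoid_homs :: "('a, 'm) monoid_scheme \<Rightarrow> ('c, 'n) monoid_scheme \<Rightarrow> ('a \<Rightarrow> 'c) set" where
  "monoid_homs G H = {h \<in> hom G H. h \<one>\<^bsub>G\<^esub> = \<one>\<^bsub>H\<^esub>}"

definition split_exact ::
  "('a, 'm) monoid_scheme \<Rightarrow> ('a \<Rightarrow> 'c) \<Rightarrow> ('c, 'n) monoid_scheme \<Rightarrow> ('c \<Rightarrow> 'd) \<Rightarrow>
     ('d, 'o) monoid_scheme \<Rightarrow> bool" where
  "split_exact K j M \<phi> N \<longleftrightarrow>
     monoid K \<and> monoid M \<and> monoid N \<and>
     j \<in> monoid_homs K M \<and> inj_on j (carrier K) \<and>
     j ` carrier K = {m \<in> carrier M. \<phi> m = \<one>\<^bsub>N\<^esub>} \<and>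
     \<phi> \<in> monoid_homs M N \<and> \<phi> ` carrier M = carrier N \<and>
     (\<exists>\<psi> \<in> monoid_homs N M. \<forall>a \<in> carrier N. \<phi> (\<psi> a) = a)"

definition set_product :: "('a, 'm) monoid_scheme \<Rightarrow> 'a set list \<Rightarrow> 'a set" where
  "set_product G Ms = foldr (\<lambda>M N. M <#>\<^bsub>G\<^esub> N) Ms {\<one>\<^bsub>G\<^esub>}"


section \<open>Binary fibred products\<close>

definition fprod :: "('b, 'x) fw_space \<Rightarrow> ('b, 'y) fw_space \<Rightarrow> ('b, 'x \<times> 'y) fw_space" where
  "fprod X Y =
     \<lparr>total = subtopology (prod_topology (total X) (total Y)) {(x, y). proj X x = proj Y y},
      proj = (\<lambda>(x, y). proj X x), sect = (\<lambda>b. (sect X b, sect Y b))\<rparr>"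

definition prX :: "'b topology \<Rightarrow> ('b, 'x) fw_space \<Rightarrow> ('b, 'y) fw_space \<Rightarrow> ('x \<times> 'y \<Rightarrow> 'x) set" where
  "prX B X Y = fw_class B (fprod X Y) X fst"

definition prY :: "'b topology \<Rightarrow> ('b, 'x) fw_space \<Rightarrow> ('b, 'y) fw_space \<Rightarrow> ('x \<times> 'y \<Rightarrow> 'y) set" where
  "prY B X Y = fw_class B (fprod X Y) Y snd"

definition inX :: "'b topology \<Rightarrow> ('b, 'x) fw_space \<Rightarrow> ('b, 'y) fw_space \<Rightarrow> ('x \<Rightarrow> 'x \<times> 'y) set" where
  "inX B X Y = fw_class B X (fprod X Y) (\<lambda>x. (x, sect Y (proj X x)))"

definition inY :: "'b topology \<Rightarrow> ('b, 'x) fw_space \<Rightarrow> ('b, 'y) fw_space \<Rightarrow> ('y \<Rightarrow> 'x \<times> 'y) set" where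
  "inY B X Y = fw_class B Y (fprod X Y) (\<lambda>y. (sect X (proj Y y), y))"

definition compX ::
  "'b topology \<Rightarrow> ('b, 'x) fw_space \<Rightarrow> ('b, 'y) fw_space \<Rightarrow>
     ('x \<times> 'y \<Rightarrow> 'x \<times> 'y) set \<Rightarrow> ('x \<times> 'y \<Rightarrow> 'x) set" where
  "compX B X Y f = fw_comp B (fprod X Y) X (prX B X Y) f"

definition compY ::
  "'b topology \<Rightarrow> ('b, 'x) fw_space \<Rightarrow> ('b, 'y) fw_space \<Rightarrow>
     ('x \<times> 'y \<Rightarrow> 'x \<times> 'y) set \<Rightarrow> ('x \<times> 'y \<Rightarrow> 'y) set" where
  "compY B X Y f = fw_comp B (fprod X Y) Y (prY B X Y) f"

definition fw_pair ::
  "'b topology \<Rightarrow> ('b, 'x) fw_space \<Rightarrow> ('b, 'y) fw_space \<Rightarrow>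
     ('x \<times> 'y \<Rightarrow> 'x) set \<Rightarrow> ('x \<times> 'y \<Rightarrow> 'y) set \<Rightarrow> ('x \<times> 'y \<Rightarrow> 'x \<times> 'y) set" where
  "fw_pair B X Y c d =
     {h. \<exists>f \<in> c. \<exists>g \<in> d. fw_homotopic B (fprod X Y) (fprod X Y) (\<lambda>z. (f z, g z)) h}"

definition k_reducible ::
  "'b topology \<Rightarrow> 'b \<Rightarrow> nat \<Rightarrow> ('b, 'x) fw_space \<Rightarrow> ('b, 'y) fw_space \<Rightarrow>
     ('x \<times> 'y \<Rightarrow> 'x \<times> 'y) set \<Rightarrow> bool" where
  "k_reducible B b0 k X Y f \<longleftrightarrow>
     fw_pair B X Y (prX B X Y) (compY B X Y f) \<in> self_classes B b0 k (fprod X Y) \<and>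
     fw_pair B X Y (compX B X Y f) (prY B X Y) \<in> self_classes B b0 k (fprod X Y)"

text \<open>
  A class with \<open>p\<^sub>X \<circ> f = p\<^sub>X\<close> (an equality of homotopy classes) contains a map of the form
  \<open>(p\<^sub>X, f\<^sub>Y)\<close>: a fibrewise homotopy of the first coordinate does not affect the second.
\<close>

definition self_over_X ::
  "'b topology \<Rightarrow> 'b \<Rightarrow> nat \<Rightarrow> ('b, 'x) fw_space \<Rightarrow> ('b, 'y) fw_space \<Rightarrow>
     ('x \<times> 'y \<Rightarrow> 'x \<times> 'y) set set" where
  "self_over_X B b0 k X Y =
     {f \<in> self_classes B b0 k (fprod X Y). compX B X Y f = prX B X Y}"

definition self_over_Y ::
  "'b topology \<Rightarrow> 'b \<Rightarrow> nat \<Rightarrow> ('b, 'x) fw_space \<Rightarrow> ('b, 'y) fw_space \<Rightarrow>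
     ('x \<times> 'y \<Rightarrow> 'x \<times> 'y) set set" where
  "self_over_Y B b0 k X Y =
     {f \<in> self_classes B b0 k (fprod X Y). compY B X Y f = prY B X Y}"

definition self_over_Y_under_X ::
  "'b topology \<Rightarrow> 'b \<Rightarrow> nat \<Rightarrow> ('b, 'x) fw_space \<Rightarrow> ('b, 'y) fw_space \<Rightarrow>
     ('x \<times> 'y \<Rightarrow> 'x \<times> 'y) set set" where
  "self_over_Y_under_X B b0 k X Y =
     {f \<in> self_over_Y B b0 k X Y. fw_comp B X (fprod X Y) f (inX B X Y) = inX B X Y}"

definition self_over_X_under_Y ::
  "'b topology \<Rightarrow> 'b \<Rightarrow> nat \<Rightarrow> ('b, 'x) fw_space \<Rightarrow> ('b, 'y) fw_space \<Rightarrow>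
     ('x \<times> 'y \<Rightarrow> 'x \<times> 'y) set set" where
  "self_over_X_under_Y B b0 k X Y =
     {f \<in> self_over_X B b0 k X Y. fw_comp B Y (fprod X Y) f (inY B X Y) = inY B X Y}"

definition phiX ::
  "'b topology \<Rightarrow> ('b, 'x) fw_space \<Rightarrow> ('b, 'y) fw_space \<Rightarrow>
     ('x \<times> 'y \<Rightarrow> 'x \<times> 'y) set \<Rightarrow> ('x \<Rightarrow> 'x) set" where
  "phiX B X Y f = fw_comp B X X (compX B X Y f) (inX B X Y)"

definition phiY ::
  "'b topology \<Rightarrow> ('b, 'x) fw_space \<Rightarrow> ('b, 'y) fw_space \<Rightarrow>
     ('x \<times> 'y \<Rightarrow> 'x \<times> 'y) set \<Rightarrow> ('y \<Rightarrow> 'y) set" where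
  "phiY B X Y f = fw_comp B Y Y (compY B X Y f) (inY B X Y)"


section \<open>Fibred products of finite families\<close>

text \<open>The factors are \<open>X 1, \<dots>, X n\<close> with \<open>n \<ge> 1\<close>; points are extensional functions on \<open>{1..n}\<close>.\<close>

definition fprods :: "nat \<Rightarrow> (nat \<Rightarrow> ('b, 'x) fw_space) \<Rightarrow> ('b, nat \<Rightarrow> 'x) fw_space" where
  "fprods n X =
     \<lparr>total = subtopology (product_topology (\<lambda>i. total (X i)) {1..n})
        {x. \<forall>i \<in> {1..n}. \<forall>j \<in> {1..n}. proj (X i) (x i) = proj (X j) (x j)},
      proj = (\<lambda>x. proj (X 1) (x 1)), sect = (\<lambda>b. \<lambda>i\<in>{1..n}. sect (X i) b)\<rparr>"

definition pr ::
  "'b topology \<Rightarrow> nat \<Rightarrow> (nat \<Rightarrow> ('b, 'x) fw_space) \<Rightarrow> nat \<Rightarrow> ((nat \<Rightarrow> 'x) \<Rightarrow> 'x) set" where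
  "pr B n X i = fw_class B (fprods n X) (X i) (\<lambda>x. x i)"

definition incl ::
  "'b topology \<Rightarrow> nat \<Rightarrow> (nat \<Rightarrow> ('b, 'x) fw_space) \<Rightarrow> nat \<Rightarrow> ('x \<Rightarrow> nat \<Rightarrow> 'x) set" where
  "incl B n X i = fw_class B (X i) (fprods n X)
     (\<lambda>x. \<lambda>j\<in>{1..n}. if j = i then x else sect (X j) (proj (X i) x))"

definition comp_at ::
  "'b topology \<Rightarrow> nat \<Rightarrow> (nat \<Rightarrow> ('b, 'x) fw_space) \<Rightarrow> nat \<Rightarrow>
     ((nat \<Rightarrow> 'x) \<Rightarrow> nat \<Rightarrow> 'x) set \<Rightarrow> ((nat \<Rightarrow> 'x) \<Rightarrow> 'x) set" where
  "comp_at B n X i f = fw_comp B (fprods n X) (X i) (pr B n X i) f"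

definition fw_tuple ::
  "'b topology \<Rightarrow> nat \<Rightarrow> (nat \<Rightarrow> ('b, 'x) fw_space) \<Rightarrow>
     (nat \<Rightarrow> ((nat \<Rightarrow> 'x) \<Rightarrow> 'x) set) \<Rightarrow> ((nat \<Rightarrow> 'x) \<Rightarrow> nat \<Rightarrow> 'x) set" where
  "fw_tuple B n X c =
     {h. \<exists>f. (\<forall>i \<in> {1..n}. f i \<in> c i) \<and>
        fw_homotopic B (fprods n X) (fprods n X) (\<lambda>z. \<lambda>i\<in>{1..n}. f i z) h}"

definition k_reducibles ::
  "'b topology \<Rightarrow> 'b \<Rightarrow> nat \<Rightarrow> nat \<Rightarrow> (nat \<Rightarrow> ('b, 'x) fw_space) \<Rightarrow>
     ((nat \<Rightarrow> 'x) \<Rightarrow> nat \<Rightarrow> 'x) set \<Rightarrow> bool" where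
  "k_reducibles B b0 k n X f \<longleftrightarrow>
     (\<forall>i \<in> {1..n}. fw_tuple B n X ((pr B n X)(i := comp_at B n X i f))
        \<in> self_classes B b0 k (fprods n X))"

definition self_at ::
  "'b topology \<Rightarrow> 'b \<Rightarrow> nat \<Rightarrow> nat \<Rightarrow> (nat \<Rightarrow> ('b, 'x) fw_space) \<Rightarrow> nat \<Rightarrow>
     ((nat \<Rightarrow> 'x) \<Rightarrow> nat \<Rightarrow> 'x) set set" where
  "self_at B b0 k n X i =
     {f \<in> self_classes B b0 k (fprods n X).
        \<forall>j \<in> {1..n} - {i}. comp_at B n X j f = pr B n X j}"

definition self_at_under ::
  "'b topology \<Rightarrow> 'b \<Rightarrow> nat \<Rightarrow> nat \<Rightarrow> (nat \<Rightarrow> ('b, 'x) fw_space) \<Rightarrow> nat \<Rightarrow>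
     ((nat \<Rightarrow> 'x) \<Rightarrow> nat \<Rightarrow> 'x) set set" where
  "self_at_under B b0 k n X i =
     {f \<in> self_at B b0 k n X i.
        fw_comp B (X i) (fprods n X) f (incl B n X i) = incl B n X i}"

definition phi_at ::
  "'b topology \<Rightarrow> nat \<Rightarrow> (nat \<Rightarrow> ('b, 'x) fw_space) \<Rightarrow> nat \<Rightarrow>
     ((nat \<Rightarrow> 'x) \<Rightarrow> nat \<Rightarrow> 'x) set \<Rightarrow> ('x \<Rightarrow> 'x) set" where
  "phi_at B n X i f = fw_comp B (X i) (X i) (comp_at B n X i f) (incl B n X i)"

end

theory Submission
  imports Defs
begin

text \<open>
  Write \<open>P = X \<times>\<^sub>B Y\<close> and let \<open>f = (f\<^sub>X, p\<^sub>Y)\<close> be a self-map of \<open>P\<close> over \<open>Y\<close> with restriction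
  \<open>g = f\<^sub>X \<circ> \<iota>\<^sub>X\<close>. Then \<open>f \<circ> \<iota>\<^sub>X = \<iota>\<^sub>X \<circ> g\<close>, so \<open>g\<close> is injective on homotopy groups if \<open>f\<close> is. If
  \<open>f \<circ> \<gamma>\<close> is homotopic to \<open>\<iota>\<^sub>X \<circ> \<alpha>\<close>, then \<open>p\<^sub>Y \<circ> \<gamma>\<close> is homotopic to \<open>p\<^sub>Y \<circ> \<iota>\<^sub>X \<circ> \<alpha>\<close>; lifting the
  image in \<open>B\<close> of this homotopy to \<open>X\<close> moves \<open>\<gamma>\<close> into the image of \<open>\<iota>\<^sub>X\<close>, which gives surjectivity.
  Conversely let \<open>g\<close> be an isomorphism on homotopy groups and \<open>f = (g \<circ> p\<^sub>X, p\<^sub>Y)\<close>. If \<open>f \<circ> \<gamma>\<close> is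
  null homotopic, so is \<open>p\<^sub>X \<circ> \<gamma>\<close>; lifting to \<open>Y\<close> makes \<open>p\<^sub>X \<circ> \<gamma>\<close> constant, and such spheroids are
  fixed by \<open>f\<close>. Hence the kernel is trivial. Surjectivity is again a lifting argument. Only in
  degree \<open>0\<close> is path connectedness of the total space and of the fibre needed. The statement on
  products follows by comparing coordinates: under the hypotheses, with \<open>v\<^sub>i\<close> the map that
  replaces the \<open>i\<close>-th coordinate of the identity by that of \<open>f\<close>, \<open>v\<^sub>n \<circ> \<dots> \<circ> v\<^sub>1\<close> is homotopic to \<open>f\<close>.
\<close>


section \<open>Path connectedness of connected CW-complexes\<close>

text \<open>The lifting property is absolute, whereas a homotopy of spheroids must fix the boundary
  of the cube. Lifts are therefore corrected in a collar, at the price of the reparametrisation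
  \<open>cube_clamp\<close>, which is homotopic to the identity and accompanies every lifted
  spheroid. The passage from kernels to injectivity is made with spheroids rather than with the
  group laws: \<alpha> is homotopic to \<beta> once the concatenation of \<alpha> with the reverse
  of \<beta> is null homotopic. In degree 0 there is no concatenation, so injectivity has to come
  from path connectedness. The two directions use different fibrations: restricting a self-map of
  the product to X lifts homotopies to X, extending a self-map of X lifts them to Y. Finally, the
  equations that define the submonoids hold between homotopy classes only. Each class over Y is
  replaced by a representative that commutes with the projection to Y at every point; restriction,
  kernel and multiplicativity can then be computed pointwise.\<close>

lemma topspace_disc: "topspace (disc n) = {x. (\<forall>i\<ge>n. x i = 0) \<and> (\<Sum>i<n. (x i)\<^sup>2) \<le> 1}"
  by (auto simp: disc_def topspace_Euclidean_space)

text \<open>The disc is star-shaped: multiplying a point by t multiplies its sum of squares by the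
  square of t, so the segment to the origin stays inside.\<close>

lemma path_connected_space_disc: "path_connected_space (disc n)"
proof -
  have *: "path_component_of (disc n) (\<lambda>_. 0) x" if x: "x \<in> topspace (disc n)" for x
    unfolding path_component_of_def pathin_def
  proof (intro exI conjI)
    have "continuous_map (top_of_set {0..1}) (Euclidean_space n) (\<lambda>t i. t * x i)"
      using x unfolding Euclidean_space_def continuous_map_in_subtopology continuous_map_componentwise_UNIV
      by (auto simp: topspace_disc intro!: continuous_intros)
    moreover have "(\<Sum>i<n. (t * x i)\<^sup>2) \<le> 1" if "t \<in> {0..1}" for t
    proof -
      have "(\<Sum>i<n. (t * x i)\<^sup>2) = t\<^sup>2 * (\<Sum>i<n. (x i)\<^sup>2)"
        by (simp add: power_mult_distrib sum_distrib_left)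
      also have "\<dots> \<le> 1 * 1"
        using that x by (intro mult_mono) (auto simp: topspace_disc power_le_one sum_nonneg)
      finally show ?thesis by simp
    qed
    ultimately show "continuous_map (top_of_set {0..1}) (disc n) (\<lambda>t i. t * x i)"
      by (auto simp: disc_def continuous_map_in_subtopology)
  qed auto
  show ?thesis
    unfolding path_connected_space_iff_path_component
    using * path_component_of_sym path_component_of_trans by fast
qed

text \<open>\<open>Euclidean_space n\<close> sits in a product of infinitely many lines, so
  compactness comes from Tychonoff: the disc is a closed part of the product of the intervals from
  -1 to 1 in the first n coordinates and of the point 0 in all others.\<close>

lemma compact_space_disc: "compact_space (disc n)"
proof -
  define T where "T = powertop_real (UNIV :: nat set)"
  define C :: "nat \<Rightarrow> real set" where "C i = (if i < n then {-1..1} else {0})" for i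
  have "compactin T (PiE UNIV C)"
    unfolding T_def compactin_PiE by (auto simp: C_def)
  moreover have "closedin T {x \<in> topspace T. (\<Sum>i<n. (x i)\<^sup>2) \<in> {..1}}"
    by (rule closedin_continuous_map_preimage[where Y = euclideanreal])
      (auto simp: T_def intro!: continuous_intros)
  ultimately have "compactin T (PiE UNIV C \<inter> {x \<in> topspace T. (\<Sum>i<n. (x i)\<^sup>2) \<in> {..1}})"
    by (rule compact_Int_closedin)
  also have "PiE UNIV C \<inter> {x \<in> topspace T. (\<Sum>i<n. (x i)\<^sup>2) \<in> {..1}} = topspace (disc n)"
  proof -
    have "\<bar>x j\<bar> \<le> 1" if "(\<Sum>i<n. (x i)\<^sup>2) \<le> 1" "j < n" for x :: "nat \<Rightarrow> real" and j
    proof -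
      have "(x j)\<^sup>2 \<le> (\<Sum>i<n. (x i)\<^sup>2)" using that by (intro member_le_sum) auto
      with that have "(x j)\<^sup>2 \<le> 1" by simp
      then show ?thesis by (simp add: abs_square_le_1)
    qed
    then have "x \<in> PiE UNIV C" if "x \<in> topspace (disc n)" for x
      using that by (auto simp: topspace_disc C_def abs_le_iff minus_le_iff)
    moreover have "x \<in> topspace (disc n)" if "x \<in> PiE UNIV C" "(\<Sum>i<n. (x i)\<^sup>2) \<le> 1" for x
    proof -
      have "x i = 0" if "i \<ge> n" for i
        using PiE_mem[OF \<open>x \<in> PiE UNIV C\<close>, of i] that by (simp add: C_def)
      with that show ?thesis by (simp add: topspace_disc)
    qed
    ultimately show ?thesis
      by (auto simp: T_def topspace_disc)
  qed
  finally have "compactin T (topspace (disc n))" .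
  moreover have "disc n = subtopology T (topspace (disc n))"
  proof -
    have "disc n = subtopology T ({x. \<forall>i\<ge>n. x i = 0} \<inter> {x. (\<Sum>i<n. (x i)\<^sup>2) \<le> 1})"
      by (simp add: disc_def Euclidean_space_def T_def subtopology_subtopology)
    then show ?thesis
      unfolding topspace_disc by (simp only: Collect_conj_eq)
  qed
  ultimately show ?thesis by (metis compact_space_subtopology)
qed

text \<open>The weak topology makes each path component clopen. Closed cells are path connected and,
  being compact in a Hausdorff space, closed.\<close>

lemma path_connected_space_CW_complex:
  assumes "CW_complex K" "connected_space K"
  shows "path_connected_space K"
proof -
  obtain C where C: "CW_structure K C" using assms by (auto simp: CW_complex_def)
  note cw = C[unfolded CW_structure_def]
  have haus: "Hausdorff_space K" using cw by (rule conjunct1)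
  have cont: "continuous_map (disc (fst e)) K (snd e)" if "e \<in> C" for e
    using cw[THEN conjunct2, THEN conjunct1] that by (simp add: case_prod_unfold)
  have weak: "closedin K A" if "A \<subseteq> topspace K" "\<And>e. e \<in> C \<Longrightarrow> closedin K (A \<inter> closed_cell e)" for A
    using cw[THEN conjunct2, THEN conjunct2, THEN conjunct2, THEN conjunct2] that by blast
  have cell: "closedin K (closed_cell e)" "path_connectedin K (closed_cell e)" if "e \<in> C" for e
  proof -
    show "closedin K (closed_cell e)"
      unfolding closed_cell_def
      by (intro compactin_imp_closedin[OF haus] image_compactin[OF _ cont[OF that]])
        (rule compact_space_disc[unfolded compact_space_def])
    show "path_connectedin K (closed_cell e)"
      unfolding closed_cell_def
      by (intro path_connectedin_continuous_map_image[OF cont[OF that]])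
        (simp add: path_connected_space_disc path_connectedin_topspace)
  qed
  \<comment> \<open>A union of path components contains a closed cell or misses it, so all its
    traces on closed cells are closed. This applies to a component and to its complement
    alike.\<close>
  have sat: "closedin K S"
    if S: "S \<subseteq> topspace K" and sat: "\<And>x y. x \<in> S \<Longrightarrow> path_component_of K x y \<Longrightarrow> y \<in> S" for S
  proof (rule weak[OF S])
    fix e assume e: "e \<in> C"
    have "closed_cell e \<subseteq> S" if x: "x \<in> S" "x \<in> closed_cell e" for x
      using path_component_of_maximal[OF cell(2)[OF e] x(2)] sat[OF x(1)] by blast
    then have "S \<inter> closed_cell e = {} \<or> S \<inter> closed_cell e = closed_cell e" by blast
    then show "closedin K (S \<inter> closed_cell e)" using cell(1)[OF e] by auto
  qed
  show ?thesis
    unfolding path_connected_space_iff_path_component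
  proof (intro ballI)
    fix x y assume x: "x \<in> topspace K" and y: "y \<in> topspace K"
    define A where "A = Collect (path_component_of K x)"
    have sub: "A \<subseteq> topspace K" unfolding A_def by (rule path_component_of_subset_topspace)
    have "closedin K A"
      by (rule sat[OF sub]) (use path_component_of_trans in \<open>fastforce simp: A_def\<close>)
    moreover have "closedin K (topspace K - A)"
    proof (rule sat)
      fix u v assume u: "u \<in> topspace K - A" and uv: "path_component_of K u v"
      have "v \<in> topspace K" using path_component_in_topspace[OF uv] by (rule conjunct2)
      moreover have "v \<notin> A"
      proof
        assume "v \<in> A"
        then have "path_component_of K x u"
          unfolding A_def using uv path_component_of_sym path_component_of_trans by (metis mem_Collect_eq)
        with u show False by (simp add: A_def)
      qed
      ultimately show "v \<in> topspace K - A" by blast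
    qed blast
    then have "openin K A" using sub by (simp add: openin_closedin_eq)
    ultimately have "A = {} \<or> A = topspace K"
      using assms(2) unfolding connected_space_clopen_in by blast
    moreover have "x \<in> A" using x by (simp add: A_def path_component_of_refl)
    ultimately show "path_component_of K x y" using y by (auto simp: A_def)
  qed
qed

text \<open>A path in \<open>K\<close> between the images of two points is carried back by
  \<open>g\<close>; its ends are joined to the original points by their tracks under the homotopy
  from \<open>g \<circ> f\<close> to the identity.\<close>

lemma path_connected_space_homotopy_equivalent:
  assumes "X homotopy_equivalent_space K" "path_connected_space K"
  shows "path_connected_space X"
proof -
  obtain f g where f: "continuous_map X K f" and g: "continuous_map K X g"
    and gf: "homotopic_with (\<lambda>x. True) X X (g \<circ> f) id"
    using assms(1) unfolding homotopy_equivalent_space_def by blast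
  obtain h where h: "continuous_map (prod_topology (top_of_set {0..1::real}) X) X h"
    and h0: "\<And>x. h (0, x) = g (f x)" and h1: "\<And>x. h (1, x) = x"
    using gf unfolding homotopic_with_def by auto
  have *: "path_component_of X (g (f x)) x" if "x \<in> topspace X" for x
    unfolding path_component_of_def pathin_def
  proof (intro exI[of _ "\<lambda>t. h (t, x)"] conjI)
    have "continuous_map (top_of_set {0..1::real}) (prod_topology (top_of_set {0..1}) X) (\<lambda>t. (t, x))"
      using that by (simp add: continuous_map_pairwise o_def)
    from continuous_map_compose[OF this h]
    show "continuous_map (top_of_set {0..1}) X (\<lambda>t. h (t, x))" by (simp add: o_def)
  qed (auto simp: h0 h1)
  show ?thesis
    unfolding path_connected_space_iff_path_component
  proof (intro ballI)
    fix x y assume x: "x \<in> topspace X" and y: "y \<in> topspace X"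
    have "f x \<in> topspace K" "f y \<in> topspace K"
      using x y continuous_map_image_subset_topspace[OF f] by auto
    then have "path_component_of K (f x) (f y)"
      using assms(2) by (simp add: path_connected_space_iff_path_component)
    then have "path_component_of X (g (f x)) (g (f y))"
      using path_component_of_continuous_image[OF g] by blast
    then show "path_component_of X x y"
      using *[OF x] *[OF y] by (meson path_component_of_sym path_component_of_trans)
  qed
qed

lemma path_connected_space_CW_homotopy_type:
  "connected_CW_homotopy_type T X \<Longrightarrow> path_connected_space X"
  unfolding connected_CW_homotopy_type_def
  using path_connected_space_CW_complex path_connected_space_homotopy_equivalent by blast


section \<open>Spheroids\<close>

abbreviation cube_cylinder :: "nat \<Rightarrow> (real \<times> (nat \<Rightarrow> real)) topology" where
  "cube_cylinder n \<equiv> prod_topology (top_of_set {0..1}) (cube n)"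

lemma topspace_cube: "topspace (cube n) = {u \<in> extensional {..<n}. \<forall>j<n. 0 \<le> u j \<and> u j \<le> 1}"
  by (auto simp: cube_def PiE_def)

lemma cube_boundary_subset: "u \<in> cube_boundary n \<Longrightarrow> u \<in> topspace (cube n)"
  by (simp add: cube_boundary_def)

lemma continuous_map_cube:
  "continuous_map Z (cube n) \<phi> \<longleftrightarrow>
    (\<forall>z \<in> topspace Z. \<phi> z \<in> topspace (cube n)) \<and>
    (\<forall>j<n. continuous_map Z euclideanreal (\<lambda>z. \<phi> z j))"
  unfolding cube_def continuous_map_componentwise continuous_map_in_subtopology
  by (auto simp: PiE_def Pi_def)

lemma continuous_map_cube_coord:
  "continuous_map Z (cube n) \<phi> \<Longrightarrow> j < n \<Longrightarrow> continuous_map Z euclideanreal (\<lambda>z. \<phi> z j)"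
  by (simp add: continuous_map_cube)

lemma cube_coord_bounds: "u \<in> topspace (cube n) \<Longrightarrow> j < n \<Longrightarrow> 0 \<le> u j \<and> u j \<le> 1"
  by (simp add: topspace_cube)

lemma cube_update:
  "u \<in> topspace (cube n) \<Longrightarrow> 0 < n \<Longrightarrow> 0 \<le> r \<Longrightarrow> r \<le> 1 \<Longrightarrow> u(0 := r) \<in> topspace (cube n)"
  by (auto simp: topspace_cube extensional_def)

text \<open>Concatenation, reversal and the null homotopies below reparametrise coordinate 0 only.
  This is the common test that they respect the boundary.\<close>

lemma cube_boundary_update:
  assumes "u \<in> topspace (cube n)" "0 < n" "0 \<le> r" "r \<le> 1"
    and "r = 0 \<or> r = 1 \<or> (\<exists>j. 0 < j \<and> j < n \<and> (u j = 0 \<or> u j = 1))"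
  shows "u(0 := r) \<in> cube_boundary n"
proof -
  have "\<exists>i<n. (u(0 := r)) i = 0 \<or> (u(0 := r)) i = 1"
    using assms(2,5) by (metis fun_upd_apply less_irrefl)
  then show ?thesis using cube_update[OF assms(1-4)] by (simp add: cube_boundary_def)
qed

lemma continuous_map_cube_update:
  assumes "continuous_map Z (cube n) \<phi>" "continuous_map Z euclideanreal r"
    and "\<And>z. z \<in> topspace Z \<Longrightarrow> 0 \<le> r z \<and> r z \<le> 1" "0 < n"
  shows "continuous_map Z (cube n) (\<lambda>z. (\<phi> z)(0 := r z))"
  unfolding continuous_map_cube
proof (intro conjI ballI allI impI)
  fix z assume "z \<in> topspace Z"
  then show "(\<phi> z)(0 := r z) \<in> topspace (cube n)"
    using assms by (intro cube_update) (auto simp: continuous_map_cube)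
next
  fix j assume "j < n"
  then show "continuous_map Z euclideanreal (\<lambda>z. ((\<phi> z)(0 := r z)) j)"
    using assms by (cases "j = 0") (auto simp: continuous_map_cube)
qed

lemma continuous_map_cylinder_fst:
  "continuous_map (cube_cylinder n) euclideanreal fst"
  using continuous_map_fst[of "top_of_set {0..1::real}" "cube n"]
  by (rule continuous_map_into_fulltopology)

lemma continuous_map_cylinder_coord:
  "j < n \<Longrightarrow> continuous_map (cube_cylinder n) euclideanreal (\<lambda>z. snd z j)"
  by (rule continuous_map_cube_coord[OF continuous_map_snd])

lemma continuous_map_into_cylinder:
  assumes "continuous_map Z euclideanreal r" "\<And>z. z \<in> topspace Z \<Longrightarrow> 0 \<le> r z \<and> r z \<le> 1"
    and "continuous_map Z (cube n) \<phi>"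
  shows "continuous_map Z (cube_cylinder n) (\<lambda>z. (r z, \<phi> z))"
  using assms by (intro continuous_map_pairedI) (auto simp: continuous_map_in_subtopology)


subsection \<open>Homotopies of spheroids\<close>

text \<open>Spheroids are total functions whose values off the cube carry no meaning. This
  invariance is what allows \<open>homotopic_with\<close> to be reduced to conditions on the
  cube.\<close>

lemma spheroid_cong:
  assumes "\<And>u. u \<in> topspace (cube n) \<Longrightarrow> \<alpha> u = \<beta> u"
  shows "spheroid n X x0 \<alpha> \<longleftrightarrow> spheroid n X x0 \<beta>"
proof -
  have "continuous_map (cube n) X \<alpha> \<longleftrightarrow> continuous_map (cube n) X \<beta>"
    using assms by (metis continuous_map_eq)
  then show ?thesis using assms by (auto simp: spheroid_def cube_boundary_def)
qed

lemma spheroid_homotopicE: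
  assumes "spheroid_homotopic n X x0 \<alpha> \<beta>"
  obtains h where "continuous_map (cube_cylinder n) X h"
    "\<And>u. u \<in> topspace (cube n) \<Longrightarrow> h (0, u) = \<alpha> u"
    "\<And>u. u \<in> topspace (cube n) \<Longrightarrow> h (1, u) = \<beta> u"
    "\<And>t u. 0 \<le> t \<Longrightarrow> t \<le> 1 \<Longrightarrow> u \<in> cube_boundary n \<Longrightarrow> h (t, u) = x0"
  using assms unfolding spheroid_homotopic_def homotopic_with_def spheroid_def by auto

lemma spheroid_homotopicI:
  assumes h: "continuous_map (cube_cylinder n) X h"
    and "\<And>u. u \<in> topspace (cube n) \<Longrightarrow> h (0, u) = \<alpha> u"
    "\<And>u. u \<in> topspace (cube n) \<Longrightarrow> h (1, u) = \<beta> u"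
    and bd: "\<And>t u. 0 \<le> t \<Longrightarrow> t \<le> 1 \<Longrightarrow> u \<in> cube_boundary n \<Longrightarrow> h (t, u) = x0"
  shows "spheroid_homotopic n X x0 \<alpha> \<beta>"
proof -
  have "spheroid n X x0 (\<lambda>u. h (t, u))" if "t \<in> {0..1}" for t
    using continuous_map_o_Pair[OF h, of t] that bd by (auto simp: spheroid_def o_def)
  then show ?thesis
    unfolding spheroid_homotopic_def
    by (subst homotopic_with[OF spheroid_cong]) (use assms in auto)
qed

lemma spheroid_homotopic_refl: "spheroid n X x0 \<alpha> \<Longrightarrow> spheroid_homotopic n X x0 \<alpha> \<alpha>"
  by (simp add: spheroid_homotopic_def spheroid_def)

lemma spheroid_homotopic_sym:
  "spheroid_homotopic n X x0 \<alpha> \<beta> \<Longrightarrow> spheroid_homotopic n X x0 \<beta> \<alpha>"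
  unfolding spheroid_homotopic_def by (rule homotopic_with_symD)

lemma spheroid_homotopic_trans:
  "spheroid_homotopic n X x0 \<alpha> \<beta> \<Longrightarrow> spheroid_homotopic n X x0 \<beta> \<gamma> \<Longrightarrow> spheroid_homotopic n X x0 \<alpha> \<gamma>"
  unfolding spheroid_homotopic_def by (rule homotopic_with_trans)

lemma spheroid_homotopic_imp_spheroid:
  "spheroid_homotopic n X x0 \<alpha> \<beta> \<Longrightarrow> spheroid n X x0 \<alpha> \<and> spheroid n X x0 \<beta>"
  unfolding spheroid_homotopic_def by (drule homotopic_with_imp_property)

lemma spheroid_homotopic_eq:
  assumes "spheroid n X x0 \<alpha>" "\<And>u. u \<in> topspace (cube n) \<Longrightarrow> \<alpha> u = \<beta> u"
  shows "spheroid_homotopic n X x0 \<alpha> \<beta>"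
proof -
  have "spheroid n X x0 \<beta>" using assms spheroid_cong[of n \<alpha> \<beta> X x0] by simp
  with assms show ?thesis
    unfolding spheroid_homotopic_def by (intro homotopic_with_equal) (auto simp: spheroid_def)
qed

lemma spheroid_in_topspace:
  "spheroid n Z z0 \<alpha> \<Longrightarrow> u \<in> topspace (cube n) \<Longrightarrow> \<alpha> u \<in> topspace Z"
  using continuous_map_image_subset_topspace[of "cube n" Z \<alpha>] by (auto simp: spheroid_def)

lemma spheroid_compose:
  "spheroid n X x0 \<alpha> \<Longrightarrow> continuous_map X Y f \<Longrightarrow> f x0 = y0 \<Longrightarrow> spheroid n Y y0 (f \<circ> \<alpha>)"
  by (auto simp: spheroid_def intro: continuous_map_compose)

lemma spheroid_homotopic_compose:
  "spheroid_homotopic n X x0 \<alpha> \<beta> \<Longrightarrow> continuous_map X Y f \<Longrightarrow> f x0 = y0 \<Longrightarrow>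
    spheroid_homotopic n Y y0 (f \<circ> \<alpha>) (f \<circ> \<beta>)"
  unfolding spheroid_homotopic_def
  by (rule homotopic_with_compose_continuous_map_left[where p = "spheroid n X x0"])
    (auto intro: spheroid_compose)

lemma spheroid_const: "x0 \<in> topspace X \<Longrightarrow> spheroid n X x0 (\<lambda>_. x0)"
  by (simp add: spheroid_def)


subsection \<open>Lifting homotopies of spheroids\<close>

text \<open>In each coordinate the middle third is stretched over the whole interval and the outer
  thirds are collapsed to its ends: 3 * x - 1 is 0 at 1/3 and 1 at 2/3. The outer thirds form the
  collar in which a lift can be corrected.\<close>

definition cube_clamp :: "nat \<Rightarrow> (nat \<Rightarrow> real) \<Rightarrow> nat \<Rightarrow> real" where
  "cube_clamp n u = (\<lambda>j\<in>{..<n}. max 0 (min 1 (3 * u j - 1)))"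

lemma cube_clamp_in_cube: "cube_clamp n u \<in> topspace (cube n)"
  by (auto simp: topspace_cube cube_clamp_def)

lemma cube_clamp_boundary: "u \<in> cube_boundary n \<Longrightarrow> cube_clamp n u \<in> cube_boundary n"
  unfolding cube_boundary_def using cube_clamp_in_cube[of n u]
  by (fastforce simp: cube_clamp_def)

lemma continuous_map_cube_clamp: "continuous_map (cube n) (cube n) (cube_clamp n)"
  unfolding continuous_map_cube[of _ _ "cube_clamp n"]
proof (intro conjI allI impI)
  fix j assume j: "j < n"
  have "continuous_map (cube n) euclideanreal (\<lambda>u. max 0 (min 1 (3 * u j - 1)))"
    using continuous_map_cube_coord[OF continuous_map_id j] by (intro continuous_intros) simp
  then show "continuous_map (cube n) euclideanreal (\<lambda>u. cube_clamp n u j)"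
    using j by (simp add: cube_clamp_def)
qed (simp add: cube_clamp_in_cube)

text \<open>The cube is convex, so \<open>cube_clamp\<close> is joined to the identity by segments
  inside it.\<close>

lemma spheroid_homotopic_clamp:
  assumes "spheroid n X x0 \<alpha>"
  shows "spheroid_homotopic n X x0 (\<alpha> \<circ> cube_clamp n) \<alpha>"
proof -
  define \<phi> where "\<phi> z = (\<lambda>j\<in>{..<n}. (1 - fst z) * cube_clamp n (snd z) j + fst z * snd z j)"
    for z :: "real \<times> (nat \<Rightarrow> real)"
  have in_cube: "\<phi> z \<in> topspace (cube n)" if "z \<in> topspace (cube_cylinder n)" for z
  proof -
    have "0 \<le> \<phi> z j \<and> \<phi> z j \<le> 1" if j: "j < n" for j
    proof -
      have "\<phi> z j \<le> 1"
        unfolding \<phi>_def using \<open>z \<in> topspace (cube_cylinder n)\<close> j cube_clamp_in_cube[of n "snd z"]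
        by (auto simp: topspace_cube intro!: convex_bound_le)
      moreover have "0 \<le> \<phi> z j"
        unfolding \<phi>_def using \<open>z \<in> topspace (cube_cylinder n)\<close> j cube_clamp_in_cube[of n "snd z"]
        by (auto simp: topspace_cube)
      ultimately show ?thesis by simp
    qed
    then show ?thesis by (auto simp: topspace_cube \<phi>_def)
  qed
  have clamp: "continuous_map (cube_cylinder n) (cube n) (\<lambda>z. cube_clamp n (snd z))"
    using continuous_map_compose[OF continuous_map_snd continuous_map_cube_clamp]
    by (simp add: o_def)
  have "continuous_map (cube_cylinder n) euclideanreal (\<lambda>z. \<phi> z j)" if j: "j < n" for j
  proof -
    have "continuous_map (cube_cylinder n) euclideanreal
        (\<lambda>z. (1 - fst z) * cube_clamp n (snd z) j + fst z * snd z j)"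
      by (intro continuous_intros continuous_map_cylinder_fst continuous_map_cylinder_coord
          continuous_map_cube_coord[OF clamp] j)
    then show ?thesis using j by (simp add: \<phi>_def)
  qed
  then have \<phi>: "continuous_map (cube_cylinder n) (cube n) \<phi>"
    using in_cube by (simp add: continuous_map_cube)
  show ?thesis
  proof (rule spheroid_homotopicI)
    show "continuous_map (cube_cylinder n) X (\<alpha> \<circ> \<phi>)"
      using assms \<phi> by (auto simp: spheroid_def intro: continuous_map_compose)
  next
    fix u assume "u \<in> topspace (cube n)"
    then show "(\<alpha> \<circ> \<phi>) (0, u) = (\<alpha> \<circ> cube_clamp n) u" "(\<alpha> \<circ> \<phi>) (1, u) = \<alpha> u"
      by (auto simp: \<phi>_def topspace_cube extensional_def cube_clamp_def fun_eq_iff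
          intro!: arg_cong[where f = \<alpha>])
  next
    fix t u assume t: "0 \<le> t" "t \<le> (1::real)" and u: "u \<in> cube_boundary n"
    obtain j where j: "j < n" "u j = 0 \<or> u j = 1" using u by (auto simp: cube_boundary_def)
    \<comment> \<open>Clamping fixes the coordinate values 0 and 1, hence so does every stage of the
      segment, and no face is left.\<close>
    then have "\<phi> (t, u) j = 0 \<or> \<phi> (t, u) j = 1" by (auto simp: \<phi>_def cube_clamp_def)
    then have "\<phi> (t, u) \<in> cube_boundary n"
      using j in_cube[of "(t, u)"] t cube_boundary_subset[OF u] by (auto simp: cube_boundary_def)
    then show "(\<alpha> \<circ> \<phi>) (t, u) = x0" using assms by (simp add: spheroid_def)
  qed
qed

text \<open>
  Homotopy lifting relative to the boundary of the cube, up to the reparametrisation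
  \<open>cube_clamp\<close>: the absolute lift moves the boundary inside the fibre; the collar created by
  \<open>cube_clamp\<close> is filled with the inverse of this motion.
\<close>

lemma spheroid_homotopy_lifting:
  assumes lift: "homotopy_lifting (cube n) E B p"
    and \<beta>: "spheroid n E e0 \<beta>" and H: "continuous_map (cube_cylinder n) B H"
    and H0: "\<And>u. u \<in> topspace (cube n) \<Longrightarrow> H (0, u) = p (\<beta> u)"
    and Hb: "\<And>t u. 0 \<le> t \<Longrightarrow> t \<le> 1 \<Longrightarrow> u \<in> cube_boundary n \<Longrightarrow> H (t, u) = p e0"
  obtains K where "continuous_map (cube_cylinder n) E K"
    "\<And>u. u \<in> topspace (cube n) \<Longrightarrow> K (0, u) = \<beta> (cube_clamp n u)"
    "\<And>t u. 0 \<le> t \<Longrightarrow> t \<le> 1 \<Longrightarrow> u \<in> cube_boundary n \<Longrightarrow> K (t, u) = e0"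
    "\<And>t u. 0 \<le> t \<Longrightarrow> t \<le> 1 \<Longrightarrow> u \<in> topspace (cube n) \<Longrightarrow> p (K (t, u)) = H (t, cube_clamp n u)"
proof -
  have "continuous_map (cube n) E \<beta>" using \<beta> by (simp add: spheroid_def)
  with lift H H0 obtain G where G: "continuous_map (cube_cylinder n) E G"
    and G0: "\<And>u. u \<in> topspace (cube n) \<Longrightarrow> G (0, u) = \<beta> u"
    and GH: "\<And>t u. 0 \<le> t \<Longrightarrow> t \<le> 1 \<Longrightarrow> u \<in> topspace (cube n) \<Longrightarrow> p (G (t, u)) = H (t, u)"
    unfolding homotopy_lifting_def by (metis atLeastAtMost_iff)
  \<comment> \<open>\<open>d u\<close> measures how far the stretched point 3 * u - 1 overshoots the
    cube. It vanishes on the middle cube, where the lift runs for the full time, and is at least 1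
    on the boundary, where the truncated time is 0; in between, the lift is run backwards.\<close>
  define d where "d u = (\<Sum>j<n. \<bar>3 * u j - 1 - cube_clamp n u j\<bar>)" for u :: "nat \<Rightarrow> real"
  define K where "K = G \<circ> (\<lambda>z. (max 0 (fst z - d (snd z)), cube_clamp n (snd z)))"
  have d: "0 \<le> d u" for u by (simp add: d_def sum_nonneg)
  have clamp: "continuous_map (cube_cylinder n) (cube n) (\<lambda>z. cube_clamp n (snd z))"
    using continuous_map_compose[OF continuous_map_snd continuous_map_cube_clamp]
    by (simp add: o_def)
  have "continuous_map (cube_cylinder n) euclideanreal (\<lambda>z. max 0 (fst z - d (snd z)))"
    unfolding d_def
    by (intro continuous_intros continuous_map_cylinder_fst continuous_map_cylinder_coord
        continuous_map_cube_coord[OF clamp]) auto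
  then have "continuous_map (cube_cylinder n) (cube_cylinder n)
      (\<lambda>z. (max 0 (fst z - d (snd z)), cube_clamp n (snd z)))"
  proof (rule continuous_map_into_cylinder[OF _ _ clamp])
    fix z assume "z \<in> topspace (cube_cylinder n)"
    then show "0 \<le> max 0 (fst z - d (snd z)) \<and> max 0 (fst z - d (snd z)) \<le> 1"
      using d[of "snd z"] by auto
  qed
  then have "continuous_map (cube_cylinder n) E K"
    unfolding K_def using G by (rule continuous_map_compose)
  moreover have "K (0, u) = \<beta> (cube_clamp n u)" if "u \<in> topspace (cube n)" for u
    using d[of u] by (simp add: K_def max_absorb1 G0 cube_clamp_in_cube)
  moreover have "K (t, u) = e0" if t: "0 \<le> t" "t \<le> 1" and u: "u \<in> cube_boundary n" for t u
  proof -
    obtain j where j: "j < n" "u j = 0 \<or> u j = 1" using u by (auto simp: cube_boundary_def)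
    then have "1 \<le> \<bar>3 * u j - 1 - cube_clamp n u j\<bar>" by (auto simp: cube_clamp_def)
    also have "\<dots> \<le> d u" unfolding d_def using j(1) by (intro member_le_sum) auto
    finally have "max 0 (t - d u) = 0" using t by simp
    then have "K (t, u) = \<beta> (cube_clamp n u)" by (simp add: K_def G0 cube_clamp_in_cube)
    then show ?thesis using \<beta> cube_clamp_boundary[OF u] by (simp add: spheroid_def)
  qed
  moreover have "p (K (t, u)) = H (t, cube_clamp n u)"
    if t: "0 \<le> t" "t \<le> 1" and u: "u \<in> topspace (cube n)" for t u
  proof -
    have pK: "p (K (t, u)) = H (max 0 (t - d u), cube_clamp n u)"
      using t d[of u] by (simp add: K_def GH cube_clamp_in_cube)
    show ?thesis
    proof (cases "d u = 0")
      case True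
      then show ?thesis using pK t by simp
    next
      case False
      \<comment> \<open>In the collar the time is wrong, but some coordinate has been clamped to 0
        or 1. So \<open>H\<close> is evaluated on the boundary of the cube, where it does not depend
        on time.\<close>
      then obtain j where j: "j < n" "3 * u j - 1 - cube_clamp n u j \<noteq> 0"
        unfolding d_def by (metis (no_types, lifting) abs_zero lessThan_iff sum.neutral)
      then have "cube_clamp n u j = 0 \<or> cube_clamp n u j = 1"
        by (auto simp: cube_clamp_def max_def min_def split: if_splits)
      then have "cube_clamp n u \<in> cube_boundary n"
        using j(1) cube_clamp_in_cube[of n u] by (auto simp: cube_boundary_def)
      then show ?thesis using pK t d[of u] by (simp add: Hb)
    qed
  qed
  ultimately show ?thesis by (rule that)
qed

subsection \<open>Concatenation of spheroids\<close>

text \<open>The two homotopies run side by side on the halves of the cube. They agree where the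
  halves meet, because the value 1/2 is rescaled to 1 on the left and to 0 on the right, and both
  faces go to the base point.\<close>

lemma spheroid_homotopic_concat:
  assumes n: "0 < n" and a: "spheroid_homotopic n X x0 \<alpha> \<alpha>'" and b: "spheroid_homotopic n X x0 \<beta> \<beta>'"
  shows "spheroid_homotopic n X x0 (spheroid_concat \<alpha> \<beta>) (spheroid_concat \<alpha>' \<beta>')"
proof -
  obtain h where h: "continuous_map (cube_cylinder n) X h"
    and h01: "\<And>u. u \<in> topspace (cube n) \<Longrightarrow> h (0, u) = \<alpha> u"
      "\<And>u. u \<in> topspace (cube n) \<Longrightarrow> h (1, u) = \<alpha>' u"
    and hb: "\<And>t u. 0 \<le> t \<Longrightarrow> t \<le> 1 \<Longrightarrow> u \<in> cube_boundary n \<Longrightarrow> h (t, u) = x0"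
    using a by (rule spheroid_homotopicE) blast
  obtain k where k: "continuous_map (cube_cylinder n) X k"
    and k01: "\<And>u. u \<in> topspace (cube n) \<Longrightarrow> k (0, u) = \<beta> u"
      "\<And>u. u \<in> topspace (cube n) \<Longrightarrow> k (1, u) = \<beta>' u"
    and kb: "\<And>t u. 0 \<le> t \<Longrightarrow> t \<le> 1 \<Longrightarrow> u \<in> cube_boundary n \<Longrightarrow> k (t, u) = x0"
    using b by (rule spheroid_homotopicE) blast
  define L where "L z = (if snd z 0 \<le> 1/2 then h (fst z, (snd z)(0 := 2 * snd z 0))
    else k (fst z, (snd z)(0 := 2 * snd z 0 - 1)))" for z :: "real \<times> (nat \<Rightarrow> real)"
  have cont: "continuous_map (cube_cylinder n) X L"
    unfolding L_def
  proof (rule continuous_map_cases_le)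
    show "continuous_map (cube_cylinder n) euclideanreal (\<lambda>z. snd z 0)"
      using n by (rule continuous_map_cylinder_coord)
    show "continuous_map (subtopology (cube_cylinder n) {z \<in> topspace (cube_cylinder n). snd z 0 \<le> 1/2}) X
        (\<lambda>z. h (fst z, (snd z)(0 := 2 * snd z 0)))" (is "continuous_map ?S X _")
    proof (rule continuous_map_compose[of _ "cube_cylinder n" _ X h, unfolded o_def, OF _ h])
      have id: "continuous_map ?S (cube_cylinder n) (\<lambda>z. z)"
        by (rule continuous_map_from_subtopology) (simp add: id_def[symmetric])
      note snd = continuous_map_compose[OF id continuous_map_snd, unfolded o_def]
      show "continuous_map ?S (cube_cylinder n) (\<lambda>z. (fst z, (snd z)(0 := 2 * snd z 0)))"
        by (intro continuous_map_into_cylinder continuous_map_cube_update snd n continuous_intros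
            continuous_map_from_subtopology[OF continuous_map_cylinder_fst]
            continuous_map_from_subtopology[OF continuous_map_cylinder_coord])
          (use n in \<open>auto simp: topspace_cube\<close>)
    qed
    show "continuous_map (subtopology (cube_cylinder n) {z \<in> topspace (cube_cylinder n). 1/2 \<le> snd z 0}) X
        (\<lambda>z. k (fst z, (snd z)(0 := 2 * snd z 0 - 1)))" (is "continuous_map ?S X _")
    proof (rule continuous_map_compose[of _ "cube_cylinder n" _ X k, unfolded o_def, OF _ k])
      have id: "continuous_map ?S (cube_cylinder n) (\<lambda>z. z)"
        by (rule continuous_map_from_subtopology) (simp add: id_def[symmetric])
      note snd = continuous_map_compose[OF id continuous_map_snd, unfolded o_def]
      show "continuous_map ?S (cube_cylinder n) (\<lambda>z. (fst z, (snd z)(0 := 2 * snd z 0 - 1)))"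
        by (intro continuous_map_into_cylinder continuous_map_cube_update snd n continuous_intros
            continuous_map_from_subtopology[OF continuous_map_cylinder_fst]
            continuous_map_from_subtopology[OF continuous_map_cylinder_coord])
          (use n in \<open>auto simp: topspace_cube\<close>)
    qed
    show "h (fst z, (snd z)(0 := 2 * snd z 0)) = k (fst z, (snd z)(0 := 2 * snd z 0 - 1))"
      if z: "z \<in> topspace (cube_cylinder n)" "snd z 0 = 1/2" for z
    proof -
      have "(snd z)(0 := 1) \<in> cube_boundary n" "(snd z)(0 := 0) \<in> cube_boundary n"
        using z n by (auto intro!: cube_boundary_update)
      then show ?thesis unfolding z(2) using z(1) hb kb by auto
    qed
  qed simp
  show ?thesis
  proof (rule spheroid_homotopicI[OF cont])
    fix u assume u: "u \<in> topspace (cube n)"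
    then have u0: "0 \<le> u 0 \<and> u 0 \<le> 1" using n by (rule cube_coord_bounds)
    show "L (0, u) = spheroid_concat \<alpha> \<beta> u" "L (1, u) = spheroid_concat \<alpha>' \<beta>' u"
      using cube_update[OF u n, of "2 * u 0"] cube_update[OF u n, of "2 * u 0 - 1"] u0
      by (auto simp: L_def spheroid_concat_def h01 k01)
  next
    fix t u assume t: "0 \<le> t" "t \<le> (1::real)" and u: "u \<in> cube_boundary n"
    have u': "u \<in> topspace (cube n)" using u by (rule cube_boundary_subset)
    then have u0: "0 \<le> u 0 \<and> u 0 \<le> 1" using n by (rule cube_coord_bounds)
    obtain j where j: "j < n" "u j = 0 \<or> u j = 1" using u by (auto simp: cube_boundary_def)
    show "L (t, u) = x0"
    proof (cases "u 0 \<le> 1/2")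
      case True
      have "u(0 := 2 * u 0) \<in> cube_boundary n"
        using True u0 j by (intro cube_boundary_update[OF u' n]) (cases "j = 0"; auto)+
      then show ?thesis using True t by (simp add: L_def hb)
    next
      case False
      have "u(0 := 2 * u 0 - 1) \<in> cube_boundary n"
        using False u0 j by (intro cube_boundary_update[OF u' n]) (cases "j = 0"; auto)+
      then show ?thesis using False t by (simp add: L_def kb)
    qed
  qed
qed

text \<open>Constant homotopies in the preceding lemma already yield continuity and the boundary
  condition.\<close>

lemma spheroid_concat_spheroid:
  "0 < n \<Longrightarrow> spheroid n X x0 \<alpha> \<Longrightarrow> spheroid n X x0 \<beta> \<Longrightarrow> spheroid n X x0 (spheroid_concat \<alpha> \<beta>)"
  by (meson spheroid_homotopic_concat spheroid_homotopic_refl spheroid_homotopic_imp_spheroid)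

lemma compose_spheroid_concat: "f \<circ> spheroid_concat \<alpha> \<beta> = spheroid_concat (f \<circ> \<alpha>) (f \<circ> \<beta>)"
  by (simp add: spheroid_concat_def fun_eq_iff)

definition spheroid_reverse :: "((nat \<Rightarrow> real) \<Rightarrow> 'a) \<Rightarrow> (nat \<Rightarrow> real) \<Rightarrow> 'a" where
  "spheroid_reverse \<alpha> u = \<alpha> (u(0 := 1 - u 0))"

lemma compose_spheroid_reverse: "f \<circ> spheroid_reverse \<alpha> = spheroid_reverse (f \<circ> \<alpha>)"
  by (simp add: spheroid_reverse_def fun_eq_iff)

lemma spheroid_reverse_spheroid:
  assumes n: "0 < n" and \<alpha>: "spheroid n X x0 \<alpha>"
  shows "spheroid n X x0 (spheroid_reverse \<alpha>)"
  unfolding spheroid_def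
proof (intro conjI ballI)
  have "continuous_map (cube n) (cube n) (\<lambda>u. u(0 := 1 - u 0))"
    using n continuous_map_cube_coord[OF continuous_map_id[of "cube n"] n]
    by (intro continuous_map_cube_update continuous_intros continuous_map_id[unfolded id_def])
      (auto simp: topspace_cube)
  from continuous_map_compose[OF this, of X \<alpha>] \<alpha>
  show "continuous_map (cube n) X (spheroid_reverse \<alpha>)"
    by (simp add: spheroid_def o_def spheroid_reverse_def[abs_def])
next
  fix u assume u: "u \<in> cube_boundary n"
  have u': "u \<in> topspace (cube n)" using u by (rule cube_boundary_subset)
  then have u0: "0 \<le> u 0 \<and> u 0 \<le> 1" using n by (rule cube_coord_bounds)
  obtain j where j: "j < n" "u j = 0 \<or> u j = 1" using u by (auto simp: cube_boundary_def)
  have "u(0 := 1 - u 0) \<in> cube_boundary n"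
    using u0 j by (intro cube_boundary_update[OF u' n]) (cases "j = 0"; auto)+
  then show "spheroid_reverse \<alpha> u = x0" using \<alpha> by (simp add: spheroid_def spheroid_reverse_def)
qed

text \<open>The concatenation runs along \<alpha> and back on the same track; the turning point is
  withdrawn to the start.\<close>

lemma spheroid_concat_reverse:
  assumes n: "0 < n" and \<alpha>: "spheroid n X x0 \<alpha>"
  shows "spheroid_homotopic n X x0 (spheroid_concat \<alpha> (spheroid_reverse \<alpha>)) (\<lambda>_. x0)"
proof -
  \<comment> \<open>The minimum is the tent function with peak 1 at 1/2, so at time 0 this is out
    and back. The factor \<open>1 - fst z\<close> lowers the peak until only the face with
    coordinate 0 equal to 0 is reached.\<close>
  define r where "r z = (1 - fst z) * min (2 * snd z 0) (2 - 2 * snd z 0)"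
    for z :: "real \<times> (nat \<Rightarrow> real)"
  have r: "0 \<le> r z \<and> r z \<le> 1" if z: "z \<in> topspace (cube_cylinder n)" for z
  proof -
    have "0 \<le> snd z 0" "snd z 0 \<le> 1" "0 \<le> fst z" "fst z \<le> 1"
      using z n by (auto simp: topspace_cube)
    then have "0 \<le> min (2 * snd z 0) (2 - 2 * snd z 0)" "min (2 * snd z 0) (2 - 2 * snd z 0) \<le> 1"
      "0 \<le> 1 - fst z" "1 - fst z \<le> 1" by auto
    then show ?thesis unfolding r_def by (simp add: mult_le_one)
  qed
  have "continuous_map (cube_cylinder n) euclideanreal r"
    unfolding r_def
    by (intro continuous_intros continuous_map_cylinder_fst continuous_map_cylinder_coord n) auto
  then have "continuous_map (cube_cylinder n) (cube n) (\<lambda>z. (snd z)(0 := r z))"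
    using r n by (intro continuous_map_cube_update continuous_map_snd)
  then have cont: "continuous_map (cube_cylinder n) X (\<alpha> \<circ> (\<lambda>z. (snd z)(0 := r z)))"
    using \<alpha> by (auto simp: spheroid_def intro: continuous_map_compose)
  show ?thesis
  proof (rule spheroid_homotopicI[OF cont])
    fix u assume u: "u \<in> topspace (cube n)"
    then have u0: "0 \<le> u 0 \<and> u 0 \<le> 1" using n by (rule cube_coord_bounds)
    then show "(\<alpha> \<circ> (\<lambda>z. (snd z)(0 := r z))) (0, u) = spheroid_concat \<alpha> (spheroid_reverse \<alpha>) u"
      by (auto simp: r_def spheroid_concat_def spheroid_reverse_def min_def)
    have "u(0 := 0) \<in> cube_boundary n" using u n by (auto intro: cube_boundary_update)
    then show "(\<alpha> \<circ> (\<lambda>z. (snd z)(0 := r z))) (1, u) = x0"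
      using \<alpha> by (simp add: r_def spheroid_def)
  next
    fix t u assume t: "0 \<le> t" "t \<le> (1::real)" and u: "u \<in> cube_boundary n"
    have u': "u \<in> topspace (cube n)" using u by (rule cube_boundary_subset)
    then have u0: "0 \<le> u 0 \<and> u 0 \<le> 1" using n by (rule cube_coord_bounds)
    obtain j where j: "j < n" "u j = 0 \<or> u j = 1" using u by (auto simp: cube_boundary_def)
    have "r (t, u) = 0 \<or> r (t, u) = 1 \<or> (\<exists>j. 0 < j \<and> j < n \<and> (u j = 0 \<or> u j = 1))"
      using j u0 by (cases "j = 0") (auto simp: r_def)
    then have "u(0 := r (t, u)) \<in> cube_boundary n"
      using r[of "(t, u)"] t u' by (intro cube_boundary_update[OF u' n]) auto
    then show "(\<alpha> \<circ> (\<lambda>z. (snd z)(0 := r z))) (t, u) = x0" using \<alpha> by (simp add: spheroid_def)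
  qed
qed

text \<open>
  In the square with coordinates \<open>(u 0, t)\<close> the null homotopy \<open>N\<close> is \<open>\<alpha>\<close> and the reverse of \<open>\<beta>\<close> on
  the halves of the bottom edge and constant on the other edges. The homotopy from \<open>\<alpha>\<close> to \<open>\<beta>\<close>
  restricts \<open>N\<close> to the segments from \<open>(e1, e2)\<close> to the midpoint of the bottom edge, where
  \<open>(e1, e2)\<close> runs along the other edges from \<open>(0, 0)\<close> to \<open>(1, 0)\<close>.
\<close>

lemma spheroid_homotopic_if_concat_reverse:
  assumes n: "0 < n" and \<alpha>: "spheroid n X x0 \<alpha>" and \<beta>: "spheroid n X x0 \<beta>"
    and null: "spheroid_homotopic n X x0 (spheroid_concat \<alpha> (spheroid_reverse \<beta>)) (\<lambda>_. x0)"
  shows "spheroid_homotopic n X x0 \<alpha> \<beta>"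
proof -
  obtain N where N: "continuous_map (cube_cylinder n) X N"
    and N0: "\<And>u. u \<in> topspace (cube n) \<Longrightarrow> N (0, u) = spheroid_concat \<alpha> (spheroid_reverse \<beta>) u"
    and N1: "\<And>u. u \<in> topspace (cube n) \<Longrightarrow> N (1, u) = x0"
    and Nb: "\<And>t u. 0 \<le> t \<Longrightarrow> t \<le> 1 \<Longrightarrow> u \<in> cube_boundary n \<Longrightarrow> N (t, u) = x0"
    using null by (rule spheroid_homotopicE) blast
  \<comment> \<open>The pair (\<open>e1 s\<close>, \<open>e2 s\<close>) spends a third of the time
    on each of the left, top and right edges. Both \<open>r\<close> and \<open>t\<close> are convex
    combinations with weight \<open>snd z 0\<close> of this point and the midpoint (1/2, 0).\<close>
  define e1 where "e1 s = max 0 (min 1 (3 * s - 1))" for s :: real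
  define e2 where "e2 s = min 1 (min (3 * s) (3 - 3 * s))" for s :: real
  define r where "r z = (1 - snd z 0) * e1 (fst z) + snd z 0 * (1/2)" for z :: "real \<times> (nat \<Rightarrow> real)"
  define t where "t z = (1 - snd z 0) * e2 (fst z)" for z :: "real \<times> (nat \<Rightarrow> real)"
  have e1: "0 \<le> e1 s" "e1 s \<le> 1" for s by (auto simp: e1_def)
  have e2: "0 \<le> e2 s" "e2 s \<le> 1" if "0 \<le> s" "s \<le> 1" for s using that by (auto simp: e2_def)
  have rt: "0 \<le> r z \<and> r z \<le> 1" "0 \<le> t z \<and> t z \<le> 1" if z: "z \<in> topspace (cube_cylinder n)" for z
  proof -
    have z': "0 \<le> snd z 0" "snd z 0 \<le> 1" "0 \<le> fst z" "fst z \<le> 1"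
      using z n by (auto simp: topspace_cube)
    then show "0 \<le> r z \<and> r z \<le> 1"
      using e1[of "fst z"] convex_bound_le[of "e1 (fst z)" 1 "1/2" "1 - snd z 0" "snd z 0"]
      by (simp add: r_def)
    show "0 \<le> t z \<and> t z \<le> 1"
      unfolding t_def using z' e2[of "fst z"] by (auto intro!: mult_le_one)
  qed
  have "continuous_map (cube_cylinder n) euclideanreal r"
    unfolding r_def e1_def
    by (intro continuous_intros continuous_map_cylinder_fst continuous_map_cylinder_coord n) auto
  then have upd: "continuous_map (cube_cylinder n) (cube n) (\<lambda>z. (snd z)(0 := r z))"
    using rt n by (intro continuous_map_cube_update continuous_map_snd)
  have "continuous_map (cube_cylinder n) euclideanreal t"
    unfolding t_def e2_def
    by (intro continuous_intros continuous_map_cylinder_fst continuous_map_cylinder_coord n) auto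
  then have "continuous_map (cube_cylinder n) (cube_cylinder n) (\<lambda>z. (t z, (snd z)(0 := r z)))"
    using rt upd by (intro continuous_map_into_cylinder)
  then have cont: "continuous_map (cube_cylinder n) X (N \<circ> (\<lambda>z. (t z, (snd z)(0 := r z))))"
    using N by (rule continuous_map_compose)
  show ?thesis
  proof (rule spheroid_homotopicI[OF cont])
    fix u assume u: "u \<in> topspace (cube n)"
    then have u0: "0 \<le> u 0 \<and> u 0 \<le> 1" using n by (rule cube_coord_bounds)
    have "u(0 := u 0 / 2) \<in> topspace (cube n)" using u0 by (intro cube_update[OF u n]) auto
    then show "(N \<circ> (\<lambda>z. (t z, (snd z)(0 := r z)))) (0, u) = \<alpha> u"
      using u0 by (simp add: t_def r_def e1_def e2_def N0 spheroid_concat_def)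
    \<comment> \<open>At time 1 the segment goes from (1, 0) to (1/2, 0), that is, through the right
      half of the bottom edge in the opposite direction. This undoes the reversal of
      \<beta>.\<close>
    have eq: "(N \<circ> (\<lambda>z. (t z, (snd z)(0 := r z)))) (1, u)
        = spheroid_concat \<alpha> (spheroid_reverse \<beta>) (u(0 := 1 - u 0 / 2))"
    proof -
      have "u(0 := 1 - u 0 / 2) \<in> topspace (cube n)" using u0 by (intro cube_update[OF u n]) auto
      moreover have "t (1, u) = 0" "r (1, u) = 1 - u 0 / 2" by (auto simp: t_def r_def e1_def e2_def)
      ultimately show ?thesis by (simp add: N0)
    qed
    show "(N \<circ> (\<lambda>z. (t z, (snd z)(0 := r z)))) (1, u) = \<beta> u"
    \<comment> \<open>At the midpoint 1/2 \<open>spheroid_concat\<close> takes its first branch, so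
      the value comes from \<alpha> instead of \<beta>; both are at the base point there.\<close>
    proof (cases "u 0 = 1")
      case True
      have bd: "u(0 := 1) \<in> cube_boundary n" using u n by (auto intro: cube_boundary_update)
      with True have "u \<in> cube_boundary n" by (metis fun_upd_triv)
      then show ?thesis using True bd \<alpha> \<beta> unfolding eq by (simp add: spheroid_concat_def spheroid_def)
    next
      case False
      then show ?thesis using u0 unfolding eq by (simp add: spheroid_concat_def spheroid_reverse_def)
    qed
  next
    fix s u assume s: "0 \<le> s" "s \<le> (1::real)" and u: "u \<in> cube_boundary n"
    have u': "u \<in> topspace (cube n)" using u by (rule cube_boundary_subset)
    then have u0: "0 \<le> u 0 \<and> u 0 \<le> 1" using n by (rule cube_coord_bounds)
    have z: "(s, u) \<in> topspace (cube_cylinder n)" using s u' by simp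
    note rt' = rt[OF z]
    obtain j where j: "j < n" "u j = 0 \<or> u j = 1" using u by (auto simp: cube_boundary_def)
    consider "0 < j" | "u 0 = 1" | "u 0 = 0" using j by (cases "j = 0") auto
    then have "N (t (s, u), u(0 := r (s, u))) = x0"
    proof cases
      case 1
      then show ?thesis using rt' j by (intro Nb cube_boundary_update[OF u' n]) auto
    next
      case 2
      have "u(0 := 1/2) \<in> topspace (cube n)" by (intro cube_update[OF u' n]) auto
      moreover have "u(0 := 1) \<in> cube_boundary n" using u' n by (auto intro: cube_boundary_update)
      ultimately show ?thesis
        using 2 \<alpha> by (simp add: t_def r_def N0 spheroid_concat_def spheroid_def)
    next
      case 3
      \<comment> \<open>The start of the segment lies on the top edge, where the null homotopy has
        ended, or on the left or right edge, which is boundary of the cube.\<close>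
      have e: "e2 s = 1 \<or> e1 s = 0 \<or> e1 s = 1" using s by (auto simp: e1_def e2_def)
      have up: "u(0 := e1 s) \<in> topspace (cube n)" using e1 by (intro cube_update[OF u' n])
      show ?thesis
      proof (cases "e2 s = 1")
        case True
        then show ?thesis using 3 N1[OF up] by (simp add: t_def r_def)
      next
        case False
        then have "u(0 := e1 s) \<in> cube_boundary n"
          using e e1 by (intro cube_boundary_update[OF u' n]) auto
        then show ?thesis using 3 e2[OF s] by (simp add: t_def r_def Nb)
      qed
    qed
    then show "(N \<circ> (\<lambda>z. (t z, (snd z)(0 := r z)))) (s, u) = x0" by simp
  qed
qed


subsection \<open>Isomorphisms on homotopy groups\<close>

definition spheroid_class ::
  "nat \<Rightarrow> 'a topology \<Rightarrow> 'a \<Rightarrow> ((nat \<Rightarrow> real) \<Rightarrow> 'a) \<Rightarrow> ((nat \<Rightarrow> real) \<Rightarrow> 'a) set" where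
  "spheroid_class n X x0 \<alpha> = {\<beta>. spheroid_homotopic n X x0 \<alpha> \<beta>}"

lemma homotopy_classes_eq: "homotopy_classes n X x0 = spheroid_class n X x0 ` {\<alpha>. spheroid n X x0 \<alpha>}"
  by (auto simp: homotopy_classes_def quotient_def spheroid_class_def)

lemma spheroid_class_eq_iff:
  assumes "spheroid n X x0 \<alpha>" "spheroid n X x0 \<beta>"
  shows "spheroid_class n X x0 \<alpha> = spheroid_class n X x0 \<beta> \<longleftrightarrow> spheroid_homotopic n X x0 \<alpha> \<beta>"
  unfolding spheroid_class_def
  using assms spheroid_homotopic_refl spheroid_homotopic_sym spheroid_homotopic_trans
  by (metis (mono_tags, lifting) Collect_cong mem_Collect_eq)

definition pointed_map :: "'x topology \<Rightarrow> 'x \<Rightarrow> 'y topology \<Rightarrow> 'y \<Rightarrow> ('x \<Rightarrow> 'y) \<Rightarrow> bool" where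
  "pointed_map X x0 Y y0 f \<longleftrightarrow> continuous_map X Y f \<and> f x0 = y0"

lemma pointed_map_spheroid:
  "pointed_map X x0 Y y0 f \<Longrightarrow> spheroid n X x0 \<alpha> \<Longrightarrow> spheroid n Y y0 (f \<circ> \<alpha>)"
  unfolding pointed_map_def by (elim conjE) (rule spheroid_compose)

lemma pointed_map_spheroid_homotopic:
  "pointed_map X x0 Y y0 f \<Longrightarrow> spheroid_homotopic n X x0 \<alpha> \<beta> \<Longrightarrow>
    spheroid_homotopic n Y y0 (f \<circ> \<alpha>) (f \<circ> \<beta>)"
  unfolding pointed_map_def by (elim conjE) (rule spheroid_homotopic_compose)

lemma induced_map_class:
  assumes "pointed_map X x0 Y y0 f" "spheroid n X x0 \<alpha>"
  shows "induced_map n Y y0 f (spheroid_class n X x0 \<alpha>) = spheroid_class n Y y0 (f \<circ> \<alpha>)"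
proof (intro equalityI subsetI)
  fix \<gamma> assume "\<gamma> \<in> induced_map n Y y0 f (spheroid_class n X x0 \<alpha>)"
  then obtain \<beta> where "spheroid_homotopic n X x0 \<alpha> \<beta>" "spheroid_homotopic n Y y0 (f \<circ> \<beta>) \<gamma>"
    unfolding induced_map_def spheroid_class_def by blast
  then have "spheroid_homotopic n Y y0 (f \<circ> \<alpha>) \<gamma>"
    using spheroid_homotopic_trans[OF pointed_map_spheroid_homotopic[OF assms(1)]] by metis
  then show "\<gamma> \<in> spheroid_class n Y y0 (f \<circ> \<alpha>)"
    by (simp add: spheroid_class_def)
next
  fix \<gamma> assume "\<gamma> \<in> spheroid_class n Y y0 (f \<circ> \<alpha>)"
  then show "\<gamma> \<in> induced_map n Y y0 f (spheroid_class n X x0 \<alpha>)"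
    using spheroid_homotopic_refl[OF assms(2)] unfolding induced_map_def spheroid_class_def by blast
qed

lemma mult_spheroid_class:
  assumes "0 < n" "spheroid n X x0 \<alpha>" "spheroid n X x0 \<beta>"
  shows "spheroid_class n X x0 \<alpha> \<otimes>\<^bsub>homotopy_group n X x0\<^esub> spheroid_class n X x0 \<beta>
    = spheroid_class n X x0 (spheroid_concat \<alpha> \<beta>)"
proof -
  have "(\<exists>\<alpha>' \<beta>'. spheroid_homotopic n X x0 \<alpha> \<alpha>' \<and> spheroid_homotopic n X x0 \<beta> \<beta>' \<and>
      spheroid_homotopic n X x0 (spheroid_concat \<alpha>' \<beta>') \<gamma>) \<longleftrightarrow>
    spheroid_homotopic n X x0 (spheroid_concat \<alpha> \<beta>) \<gamma>" for \<gamma>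
    using spheroid_homotopic_refl[OF assms(2)] spheroid_homotopic_refl[OF assms(3)]
      spheroid_homotopic_trans[OF spheroid_homotopic_concat[OF assms(1)]] by metis
  then show ?thesis
    by (simp add: homotopy_group_def spheroid_class_def)
qed

lemma induced_map_hom:
  assumes n: "0 < n" and f: "pointed_map X x0 Y y0 f"
  shows "induced_map n Y y0 f \<in> hom (homotopy_group n X x0) (homotopy_group n Y y0)"
proof (rule homI)
  fix c assume "c \<in> carrier (homotopy_group n X x0)"
  then obtain \<alpha> where "spheroid n X x0 \<alpha>" "c = spheroid_class n X x0 \<alpha>"
    by (auto simp: homotopy_group_def homotopy_classes_eq)
  then show "induced_map n Y y0 f c \<in> carrier (homotopy_group n Y y0)"
    using f by (auto simp: induced_map_class homotopy_group_def homotopy_classes_eq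
        intro!: imageI pointed_map_spheroid)
next
  fix c d assume "c \<in> carrier (homotopy_group n X x0)" "d \<in> carrier (homotopy_group n X x0)"
  then obtain \<alpha> \<beta> where \<alpha>: "spheroid n X x0 \<alpha>" "c = spheroid_class n X x0 \<alpha>"
    and \<beta>: "spheroid n X x0 \<beta>" "d = spheroid_class n X x0 \<beta>"
    by (auto simp: homotopy_group_def homotopy_classes_eq)
  show "induced_map n Y y0 f (c \<otimes>\<^bsub>homotopy_group n X x0\<^esub> d)
      = induced_map n Y y0 f c \<otimes>\<^bsub>homotopy_group n Y y0\<^esub> induced_map n Y y0 f d"
    using n f \<alpha> \<beta> pointed_map_spheroid[OF f \<alpha>(1)] pointed_map_spheroid[OF f \<beta>(1)]
    by (simp add: mult_spheroid_class induced_map_class spheroid_concat_spheroid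
        compose_spheroid_concat)
qed

lemma image_subset_image_image_iff:
  "g ` {x. Q x} \<subseteq> F ` h ` {x. P x} \<longleftrightarrow> (\<forall>b. Q b \<longrightarrow> (\<exists>a. P a \<and> g b = F (h a)))"
  by blast

lemma inj_on_image_Collect_iff:
  "inj_on F (h ` {x. P x}) \<longleftrightarrow> (\<forall>a b. P a \<longrightarrow> P b \<longrightarrow> F (h a) = F (h b) \<longrightarrow> h a = h b)"
  unfolding inj_on_def by blast

text \<open>The induced map is automatically a homomorphism in positive degrees, so being an
  isomorphism is bijectivity there as in degree 0. The criterion expresses it by representatives and
  makes the later proofs uniform in the degree.\<close>

lemma induces_iso_iff:
  assumes f: "pointed_map X x0 Y y0 f"
  shows "induces_iso n X x0 Y y0 f \<longleftrightarrow>
    (\<forall>\<alpha> \<beta>. spheroid n X x0 \<alpha> \<longrightarrow> spheroid n X x0 \<beta> \<longrightarrow> spheroid_homotopic n Y y0 (f \<circ> \<alpha>) (f \<circ> \<beta>) \<longrightarrow>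
      spheroid_homotopic n X x0 \<alpha> \<beta>) \<and>
    (\<forall>\<beta>. spheroid n Y y0 \<beta> \<longrightarrow> (\<exists>\<alpha>. spheroid n X x0 \<alpha> \<and> spheroid_homotopic n Y y0 (f \<circ> \<alpha>) \<beta>))"
proof -
  have cl: "induced_map n Y y0 f (spheroid_class n X x0 \<alpha>) = spheroid_class n Y y0 (f \<circ> \<alpha>)"
    "spheroid n Y y0 (f \<circ> \<alpha>)" if "spheroid n X x0 \<alpha>" for \<alpha>
    using induced_map_class[OF f that] pointed_map_spheroid[OF f that] by simp_all
  have "induces_iso n X x0 Y y0 f \<longleftrightarrow>
      bij_betw (induced_map n Y y0 f) (homotopy_classes n X x0) (homotopy_classes n Y y0)"
  proof (cases "n = 0")
    case False
    then have "induced_map n Y y0 f \<in> hom (homotopy_group n X x0) (homotopy_group n Y y0)"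
      using f by (intro induced_map_hom) auto
    moreover have "carrier (homotopy_group n X x0) = homotopy_classes n X x0"
      "carrier (homotopy_group n Y y0) = homotopy_classes n Y y0"
      by (simp_all add: homotopy_group_def)
    ultimately show ?thesis using False unfolding induces_iso_def iso_def by simp
  qed (simp add: induces_iso_def)
  also have "\<dots> \<longleftrightarrow> inj_on (induced_map n Y y0 f) (homotopy_classes n X x0) \<and>
      homotopy_classes n Y y0 \<subseteq> induced_map n Y y0 f ` homotopy_classes n X x0"
  proof -
    have "induced_map n Y y0 f ` homotopy_classes n X x0 \<subseteq> homotopy_classes n Y y0"
    proof (rule image_subsetI)
      fix c assume "c \<in> homotopy_classes n X x0"
      then obtain \<alpha> where \<alpha>: "spheroid n X x0 \<alpha>" "c = spheroid_class n X x0 \<alpha>"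
        unfolding homotopy_classes_eq by blast
      have "spheroid_class n Y y0 (f \<circ> \<alpha>) \<in> homotopy_classes n Y y0"
        unfolding homotopy_classes_eq using cl(2)[OF \<alpha>(1)] by (intro imageI CollectI)
      then show "induced_map n Y y0 f c \<in> homotopy_classes n Y y0"
        by (simp only: \<alpha>(2) cl(1)[OF \<alpha>(1)])
    qed
    then show ?thesis unfolding bij_betw_def by (simp only: set_eq_subset simp_thms)
  qed
  also have "inj_on (induced_map n Y y0 f) (homotopy_classes n X x0) \<longleftrightarrow>
    (\<forall>\<alpha> \<beta>. spheroid n X x0 \<alpha> \<longrightarrow> spheroid n X x0 \<beta> \<longrightarrow>
      induced_map n Y y0 f (spheroid_class n X x0 \<alpha>) = induced_map n Y y0 f (spheroid_class n X x0 \<beta>) \<longrightarrow>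
      spheroid_class n X x0 \<alpha> = spheroid_class n X x0 \<beta>)"
    unfolding homotopy_classes_eq by (rule inj_on_image_Collect_iff)
  also have "\<dots> \<longleftrightarrow>
    (\<forall>\<alpha> \<beta>. spheroid n X x0 \<alpha> \<longrightarrow> spheroid n X x0 \<beta> \<longrightarrow> spheroid_homotopic n Y y0 (f \<circ> \<alpha>) (f \<circ> \<beta>) \<longrightarrow>
      spheroid_homotopic n X x0 \<alpha> \<beta>)"
    by (intro iff_allI imp_cong refl) (simp_all only: cl spheroid_class_eq_iff)
  also have "homotopy_classes n Y y0 \<subseteq> induced_map n Y y0 f ` homotopy_classes n X x0 \<longleftrightarrow>
    (\<forall>\<beta>. spheroid n Y y0 \<beta> \<longrightarrow> (\<exists>\<alpha>. spheroid n X x0 \<alpha> \<and>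
      spheroid_class n Y y0 \<beta> = induced_map n Y y0 f (spheroid_class n X x0 \<alpha>)))"
    unfolding homotopy_classes_eq by (rule image_subset_image_image_iff)
  also have "\<dots> \<longleftrightarrow>
    (\<forall>\<beta>. spheroid n Y y0 \<beta> \<longrightarrow> (\<exists>\<alpha>. spheroid n X x0 \<alpha> \<and> spheroid_homotopic n Y y0 (f \<circ> \<alpha>) \<beta>))"
  proof (intro iff_allI imp_cong refl ex_cong1 conj_cong)
    fix \<beta> \<alpha> assume \<beta>: "spheroid n Y y0 \<beta>" and \<alpha>: "spheroid n X x0 \<alpha>"
    show "spheroid_class n Y y0 \<beta> = induced_map n Y y0 f (spheroid_class n X x0 \<alpha>) \<longleftrightarrow>
        spheroid_homotopic n Y y0 (f \<circ> \<alpha>) \<beta>"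
      unfolding cl(1)[OF \<alpha>] spheroid_class_eq_iff[OF \<beta> cl(2)[OF \<alpha>]]
      by (rule iffI; rule spheroid_homotopic_sym)
  qed
  finally show ?thesis .
qed

text \<open>Both maps act identically on classes of spheroids. This makes the isomorphism condition
  independent of the representative of a fibrewise homotopy class.\<close>

lemma induces_iso_homotopic:
  assumes "pointed_map X x0 Y y0 f" "pointed_map X x0 Y y0 g"
    and fg: "\<And>\<alpha>. spheroid n X x0 \<alpha> \<Longrightarrow> spheroid_homotopic n Y y0 (f \<circ> \<alpha>) (g \<circ> \<alpha>)"
    and "induces_iso n X x0 Y y0 f"
  shows "induces_iso n X x0 Y y0 g"
  unfolding induces_iso_iff[OF assms(2)]
proof (intro conjI allI impI)
  note iso = assms(4)[unfolded induces_iso_iff[OF assms(1)]]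
  {
    fix \<alpha> \<beta> assume \<alpha>: "spheroid n X x0 \<alpha>" and \<beta>: "spheroid n X x0 \<beta>"
      and "spheroid_homotopic n Y y0 (g \<circ> \<alpha>) (g \<circ> \<beta>)"
    then have "spheroid_homotopic n Y y0 (f \<circ> \<alpha>) (f \<circ> \<beta>)"
      using spheroid_homotopic_trans[OF fg[OF \<alpha>] spheroid_homotopic_trans[OF _ spheroid_homotopic_sym[OF fg[OF \<beta>]]]]
      by simp
    with iso \<alpha> \<beta> show "spheroid_homotopic n X x0 \<alpha> \<beta>" by simp
  next
    fix \<beta> assume "spheroid n Y y0 \<beta>"
    with iso obtain \<alpha> where \<alpha>: "spheroid n X x0 \<alpha>" "spheroid_homotopic n Y y0 (f \<circ> \<alpha>) \<beta>" by metis
    then have "spheroid_homotopic n Y y0 (g \<circ> \<alpha>) \<beta>"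
      using spheroid_homotopic_trans[OF spheroid_homotopic_sym[OF fg[OF \<alpha>(1)]]] by simp
    with \<alpha>(1) show "\<exists>\<alpha>. spheroid n X x0 \<alpha> \<and> spheroid_homotopic n Y y0 (g \<circ> \<alpha>) \<beta>" by metis
  }
qed

lemma induces_iso_compose:
  assumes f: "pointed_map X x0 Y y0 f" "induces_iso n X x0 Y y0 f"
    and g: "pointed_map Y y0 Z z0 g" "induces_iso n Y y0 Z z0 g"
  shows "induces_iso n X x0 Z z0 (g \<circ> f)"
proof -
  have gf: "pointed_map X x0 Z z0 (g \<circ> f)"
    using f(1) g(1) by (auto simp: pointed_map_def intro: continuous_map_compose)
  note fi = f(2)[unfolded induces_iso_iff[OF f(1)]]
  note gi = g(2)[unfolded induces_iso_iff[OF g(1)]]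
  show ?thesis
    unfolding induces_iso_iff[OF gf] comp_assoc
  proof (intro conjI allI impI)
    fix \<alpha> \<beta> assume "spheroid n X x0 \<alpha>" "spheroid n X x0 \<beta>"
      "spheroid_homotopic n Z z0 (g \<circ> (f \<circ> \<alpha>)) (g \<circ> (f \<circ> \<beta>))"
    then show "spheroid_homotopic n X x0 \<alpha> \<beta>"
      using fi gi pointed_map_spheroid[OF f(1)] by blast
  next
    fix \<gamma> assume "spheroid n Z z0 \<gamma>"
    then obtain \<beta> where \<beta>: "spheroid n Y y0 \<beta>" "spheroid_homotopic n Z z0 (g \<circ> \<beta>) \<gamma>" using gi by blast
    then obtain \<alpha> where \<alpha>: "spheroid n X x0 \<alpha>" "spheroid_homotopic n Y y0 (f \<circ> \<alpha>) \<beta>" using fi by blast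
    have "spheroid_homotopic n Z z0 (g \<circ> (f \<circ> \<alpha>)) \<gamma>"
      by (rule spheroid_homotopic_trans[OF pointed_map_spheroid_homotopic[OF g(1) \<alpha>(2)] \<beta>(2)])
    with \<alpha>(1) show "\<exists>\<alpha>. spheroid n X x0 \<alpha> \<and> spheroid_homotopic n Z z0 (g \<circ> (f \<circ> \<alpha>)) \<gamma>" by metis
  qed
qed

lemma induces_iso_id:
  assumes "x0 \<in> topspace X" shows "induces_iso n X x0 X x0 id"
  by (subst induces_iso_iff) (auto simp: pointed_map_def intro: spheroid_homotopic_refl)

text \<open>The usual argument that a homomorphism with trivial kernel is injective, applied to
  \<alpha> followed by the reverse of \<beta>. Working with spheroids, it needs neither
  associativity nor units of the homotopy group.\<close>

lemma spheroid_homotopic_if_trivial_kernel: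
  assumes n: "0 < n" and f: "pointed_map X x0 Y y0 f"
    and ker: "\<And>\<gamma>. spheroid n X x0 \<gamma> \<Longrightarrow> spheroid_homotopic n Y y0 (f \<circ> \<gamma>) (\<lambda>_. y0) \<Longrightarrow>
      spheroid_homotopic n X x0 \<gamma> (\<lambda>_. x0)"
    and \<alpha>: "spheroid n X x0 \<alpha>" and \<beta>: "spheroid n X x0 \<beta>"
    and hom: "spheroid_homotopic n Y y0 (f \<circ> \<alpha>) (f \<circ> \<beta>)"
  shows "spheroid_homotopic n X x0 \<alpha> \<beta>"
proof (rule spheroid_homotopic_if_concat_reverse[OF n \<alpha> \<beta> ker])
  note rev = spheroid_reverse_spheroid[OF n]
  show "spheroid n X x0 (spheroid_concat \<alpha> (spheroid_reverse \<beta>))"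
    by (intro spheroid_concat_spheroid rev n \<alpha> \<beta>)
  have f\<beta>: "spheroid n Y y0 (f \<circ> \<beta>)" using pointed_map_spheroid[OF f \<beta>] .
  have "spheroid_homotopic n Y y0 (spheroid_concat (f \<circ> \<alpha>) (spheroid_reverse (f \<circ> \<beta>)))
      (spheroid_concat (f \<circ> \<beta>) (spheroid_reverse (f \<circ> \<beta>)))"
    by (intro spheroid_homotopic_concat n hom spheroid_homotopic_refl rev f\<beta>)
  then show "spheroid_homotopic n Y y0 (f \<circ> spheroid_concat \<alpha> (spheroid_reverse \<beta>)) (\<lambda>_. y0)"
    unfolding compose_spheroid_concat compose_spheroid_reverse
    using spheroid_concat_reverse[OF n f\<beta>] by (rule spheroid_homotopic_trans)
qed

text \<open>The only point of the 0-cube is the function that is \<open>undefined\<close>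
  everywhere, and the boundary is empty. So a spheroid of degree 0 is an arbitrary point of the
  space and a homotopy is a path; the base point imposes nothing.\<close>

lemma spheroid_0_homotopic:
  assumes "path_connected_space X" "spheroid 0 X x0 \<alpha>" "spheroid 0 X x0 \<beta>"
  shows "spheroid_homotopic 0 X x0 \<alpha> \<beta>"
proof -
  let ?u = "\<lambda>_. undefined :: real"
  have cube: "topspace (cube 0) = {?u}" by (auto simp: topspace_cube)
  have "\<alpha> ?u \<in> topspace X" "\<beta> ?u \<in> topspace X"
    using assms(2,3) continuous_map_image_subset_topspace[of "cube 0" X] cube
    by (auto simp: spheroid_def image_subset_iff)
  then obtain g where g: "pathin X g" "g 0 = \<alpha> ?u" "g 1 = \<beta> ?u"
    using assms(1) unfolding path_connected_space_def by blast
  show ?thesis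
  proof (rule spheroid_homotopicI)
    show "continuous_map (cube_cylinder 0) X (g \<circ> fst)"
      using g(1) unfolding pathin_def by (rule continuous_map_compose[OF continuous_map_fst])
  qed (use g cube in \<open>auto simp: cube_boundary_def\<close>)
qed

section \<open>Fibrewise homotopy classes\<close>

text \<open>The analogue of \<open>spheroid_cong\<close> for \<open>fw_homotopic\<close>. That
  \<open>X\<close> is pointed ensures that the points of the section, where \<open>fw_map\<close>
  also evaluates, lie in the total space.\<close>

lemma fw_map_cong:
  assumes "fw_pointed_space B X" "\<And>x. x \<in> topspace (total X) \<Longrightarrow> f x = g x"
  shows "fw_map B X Y f \<longleftrightarrow> fw_map B X Y g"
proof -
  have "continuous_map (total X) (total Y) f \<longleftrightarrow> continuous_map (total X) (total Y) g"
    using assms(2) by (metis continuous_map_eq)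
  moreover have "sect X b \<in> topspace (total X)" if "b \<in> topspace B" for b
    using assms(1) that continuous_map_image_subset_topspace[of B "total X" "sect X"]
    by (auto simp: fw_pointed_space_def)
  ultimately show ?thesis using assms(2) by (auto simp: fw_map_def)
qed

lemma fw_map_continuous: "fw_map B X Y f \<Longrightarrow> continuous_map (total X) (total Y) f"
  by (simp add: fw_map_def)

lemma fw_map_in_topspace:
  "fw_map B X Y f \<Longrightarrow> x \<in> topspace (total X) \<Longrightarrow> f x \<in> topspace (total Y)"
  by (rule funcset_mem[OF continuous_map_funspace[OF fw_map_continuous]])

lemma fw_map_proj: "fw_map B X Y f \<Longrightarrow> x \<in> topspace (total X) \<Longrightarrow> proj Y (f x) = proj X x"
  by (simp add: fw_map_def)

lemma fw_map_sect: "fw_map B X Y f \<Longrightarrow> b \<in> topspace B \<Longrightarrow> f (sect X b) = sect Y b"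
  by (simp add: fw_map_def)

lemma fw_map_id: "fw_map B X X id"
  by (simp add: fw_map_def)

lemma fw_homotopicI:
  assumes X: "fw_pointed_space B X"
    and "continuous_map (prod_topology (top_of_set {0..1::real}) (total X)) (total Y) h"
    and "\<And>x. x \<in> topspace (total X) \<Longrightarrow> h (0, x) = f x"
    and "\<And>x. x \<in> topspace (total X) \<Longrightarrow> h (1, x) = g x"
    and "\<And>t. 0 \<le> t \<Longrightarrow> t \<le> 1 \<Longrightarrow> fw_map B X Y (\<lambda>x. h (t, x))"
  shows "fw_homotopic B X Y f g"
  unfolding fw_homotopic_def
  by (subst homotopic_with[OF fw_map_cong[OF X]]) (use assms in auto)

lemma fw_homotopicE:
  assumes "fw_homotopic B X Y f g"
  obtains h where "continuous_map (prod_topology (top_of_set {0..1::real}) (total X)) (total Y) h"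
    and "\<And>x. h (0, x) = f x" and "\<And>x. h (1, x) = g x"
    and "\<And>t. 0 \<le> t \<Longrightarrow> t \<le> 1 \<Longrightarrow> fw_map B X Y (\<lambda>x. h (t, x))"
  using assms unfolding fw_homotopic_def homotopic_with_def by auto

lemma fw_homotopic_refl: "fw_map B X Y f \<Longrightarrow> fw_homotopic B X Y f f"
  by (simp add: fw_homotopic_def fw_map_def)

lemma fw_homotopic_sym: "fw_homotopic B X Y f g \<Longrightarrow> fw_homotopic B X Y g f"
  unfolding fw_homotopic_def by (rule homotopic_with_symD)

lemma fw_homotopic_trans:
  "fw_homotopic B X Y f g \<Longrightarrow> fw_homotopic B X Y g h \<Longrightarrow> fw_homotopic B X Y f h"
  unfolding fw_homotopic_def by (rule homotopic_with_trans)

lemma fw_homotopic_imp_map: "fw_homotopic B X Y f g \<Longrightarrow> fw_map B X Y f \<and> fw_map B X Y g"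
  unfolding fw_homotopic_def by (drule homotopic_with_imp_property)

lemma fw_homotopic_eq:
  assumes X: "fw_pointed_space B X" and f: "fw_map B X Y f"
    and eq: "\<And>x. x \<in> topspace (total X) \<Longrightarrow> f x = g x"
  shows "fw_homotopic B X Y f g"
proof -
  have "fw_map B X Y g" using f fw_map_cong[OF X, of f g Y] eq by simp
  then show ?thesis
    unfolding fw_homotopic_def using f eq
    by (intro homotopic_with_equal) (auto simp: fw_map_continuous)
qed

lemma fw_class_eq_iff:
  assumes "fw_map B X Y f" "fw_map B X Y g"
  shows "fw_class B X Y f = fw_class B X Y g \<longleftrightarrow> fw_homotopic B X Y f g"
proof
  assume "fw_class B X Y f = fw_class B X Y g"
  then show "fw_homotopic B X Y f g"
    using fw_homotopic_refl[OF assms(2)] unfolding fw_class_def by blast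
next
  assume fg: "fw_homotopic B X Y f g"
  show "fw_class B X Y f = fw_class B X Y g"
    unfolding fw_class_def
    using fw_homotopic_trans[OF fg] fw_homotopic_trans[OF fw_homotopic_sym[OF fg]] by blast
qed

lemma fw_class_eqI: "fw_homotopic B X Y f g \<Longrightarrow> fw_class B X Y f = fw_class B X Y g"
  using fw_class_eq_iff fw_homotopic_imp_map by metis

text \<open>Compatibility of homotopy with composition is contained in \<open>fw_comp_class\<close>;
  it is recovered by comparing the classes of the composites.\<close>

lemma fw_homotopic_compose_left:
  assumes "fw_homotopic B X Y f f'" "fw_map B Y Z g"
  shows "fw_homotopic B X Z (g \<circ> f) (g \<circ> f')"
  using fw_homotopic_imp_map[OF assms(1)] assms fw_comp_class[of B X Y _ Z g]
    fw_class_eq_iff[of B X Z "g \<circ> f" "g \<circ> f'"] fw_map_comp[of B X Y _ Z g] fw_class_eqI[OF assms(1)]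
  by metis

lemma fw_homotopic_compose_right:
  assumes "fw_homotopic B Y Z g g'" "fw_map B X Y f"
  shows "fw_homotopic B X Z (g \<circ> f) (g' \<circ> f)"
  using fw_homotopic_imp_map[OF assms(1)] assms fw_comp_class[of B X Y f Z]
    fw_class_eq_iff[of B X Z "g \<circ> f" "g' \<circ> f"] fw_map_comp[of B X Y f Z] fw_class_eqI[OF assms(1)]
  by metis

lemma fw_pointed_sect:
  "fw_pointed_space B X \<Longrightarrow> b \<in> topspace B \<Longrightarrow> sect X b \<in> topspace (total X)"
  using continuous_map_image_subset_topspace[of B "total X" "sect X"]
  by (auto simp: fw_pointed_space_def)

lemma fw_map_pointed:
  "fw_map B X Y f \<Longrightarrow> b0 \<in> topspace B \<Longrightarrow> pointed_map (total X) (sect X b0) (total Y) (sect Y b0) f"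
  by (simp add: fw_map_def pointed_map_def)

text \<open>Every stage of a fibrewise pointed homotopy preserves the section, in particular its
  value at \<open>b0\<close>. So the homotopy runs through spheroids and does not move the base
  point.\<close>

lemma fw_homotopic_spheroid:
  assumes fg: "fw_homotopic B X Y f g" and b0: "b0 \<in> topspace B"
    and \<alpha>: "spheroid n (total X) (sect X b0) \<alpha>"
  shows "spheroid_homotopic n (total Y) (sect Y b0) (f \<circ> \<alpha>) (g \<circ> \<alpha>)"
  unfolding spheroid_homotopic_def
proof (rule homotopic_with_compose_continuous_map_right[OF fg[unfolded fw_homotopic_def]])
  show "continuous_map (cube n) (total X) \<alpha>" using \<alpha> by (simp add: spheroid_def)
  show "spheroid n (total Y) (sect Y b0) (j \<circ> \<alpha>)" if "fw_map B X Y j" for j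
    using pointed_map_spheroid[OF fw_map_pointed[OF that b0] \<alpha>] .
qed

definition fw_self_iso :: "'b topology \<Rightarrow> 'b \<Rightarrow> nat \<Rightarrow> ('b, 'x) fw_space \<Rightarrow> ('x \<Rightarrow> 'x) \<Rightarrow> bool" where
  "fw_self_iso B b0 k X f \<longleftrightarrow> fw_map B X X f \<and>
     (\<forall>i\<le>k. induces_iso i (total X) (sect X b0) (total X) (sect X b0) f)"

lemma fw_self_iso_homotopic:
  assumes "fw_self_iso B b0 k X f" "fw_homotopic B X X f g" "b0 \<in> topspace B"
  shows "fw_self_iso B b0 k X g"
proof -
  have "fw_map B X X f" "fw_map B X X g" using fw_homotopic_imp_map[OF assms(2)] by simp_all
  then have "induces_iso i (total X) (sect X b0) (total X) (sect X b0) g"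
    if "induces_iso i (total X) (sect X b0) (total X) (sect X b0) f" for i
    using that fw_homotopic_spheroid[OF assms(2,3)] fw_map_pointed[OF _ assms(3)]
    by (intro induces_iso_homotopic[where f = f and g = g])
  then show ?thesis using assms(1) \<open>fw_map B X X g\<close> by (simp add: fw_self_iso_def)
qed

lemma fw_self_iso_comp:
  assumes "fw_self_iso B b0 k X f" "fw_self_iso B b0 k X g" "b0 \<in> topspace B"
  shows "fw_self_iso B b0 k X (g \<circ> f)"
  using assms fw_map_pointed[OF _ assms(3), of X X] induces_iso_compose fw_map_comp[of B X X f X g]
  unfolding fw_self_iso_def by metis

lemma fw_self_iso_id:
  assumes "fw_pointed_space B X" "b0 \<in> topspace B"
  shows "fw_self_iso B b0 k X id"
  unfolding fw_self_iso_def
  using fw_map_id induces_iso_id[OF fw_pointed_sect[OF assms]] by simp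

text \<open>\<open>self_classes\<close> imposes its condition on all members of a class; homotopy
  invariance reduces it to a single representative.\<close>

lemma fw_class_in_self_classes:
  assumes b0: "b0 \<in> topspace B" and f: "fw_map B X X f"
  shows "fw_class B X X f \<in> self_classes B b0 k X \<longleftrightarrow> fw_self_iso B b0 k X f"
proof
  assume "fw_class B X X f \<in> self_classes B b0 k X"
  then show "fw_self_iso B b0 k X f"
    using fw_homotopic_refl[OF f] f unfolding self_classes_def fw_self_iso_def fw_class_def by blast
next
  assume iso: "fw_self_iso B b0 k X f"
  have "fw_class B X X f \<in> fw_classes B X X"
    using f by (auto simp: fw_classes_def quotient_def fw_class_def)
  then show "fw_class B X X f \<in> self_classes B b0 k X"
    using fw_self_iso_homotopic[OF iso _ b0] unfolding self_classes_def fw_class_def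
    by (auto simp: fw_self_iso_def)
qed

lemma self_classesE:
  assumes "c \<in> self_classes B b0 k X" "b0 \<in> topspace B"
  obtains f where "fw_self_iso B b0 k X f" "fw_map B X X f" "c = fw_class B X X f"
proof -
  have "c \<in> fw_classes B X X" using assms by (simp add: self_classes_def)
  then obtain f where f: "fw_map B X X f" "c = fw_class B X X f"
    by (auto simp: fw_classes_def quotient_def fw_class_def)
  then show ?thesis using that assms fw_class_in_self_classes[OF assms(2) f(1)] by simp
qed

lemma fw_comp_classes_mem:
  assumes "c \<in> self_classes B b0 k X" "d \<in> self_classes B b0 k X" "b0 \<in> topspace B"
  shows "fw_comp B X X c d \<in> self_classes B b0 k X"
proof -
  obtain f where f: "fw_self_iso B b0 k X f" "fw_map B X X f" "c = fw_class B X X f"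
    using assms(1,3) by (rule self_classesE)
  obtain g where g: "fw_self_iso B b0 k X g" "fw_map B X X g" "d = fw_class B X X g"
    using assms(2,3) by (rule self_classesE)
  show ?thesis
    unfolding f(3) g(3) fw_comp_class[OF g(2) f(2)] fw_class_in_self_classes[OF assms(3) fw_map_comp[OF g(2) f(2)]]
    using g(1) f(1) assms(3) by (rule fw_self_iso_comp)
qed

text \<open>The unit and associativity laws hold for representatives under composition of functions.
  Stating them for a subset \<open>S\<close> serves the full monoid, the classes over a factor and
  the kernel at once.\<close>

lemma submonoid_self_monoid:
  assumes X: "fw_pointed_space B X" and b0: "b0 \<in> topspace B"
    and S: "S \<subseteq> self_classes B b0 k X" "fw_class B X X id \<in> S"
    and comp: "\<And>c d. c \<in> S \<Longrightarrow> d \<in> S \<Longrightarrow> fw_comp B X X c d \<in> S"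
  shows "monoid ((self_monoid B b0 k X)\<lparr>carrier := S\<rparr>)"
proof (rule monoidI)
  have rep: "\<exists>f. fw_map B X X f \<and> c = fw_class B X X f" if "c \<in> S" for c
    using that S(1) b0 by (meson self_classesE subsetD)
  fix c assume "c \<in> carrier ((self_monoid B b0 k X)\<lparr>carrier := S\<rparr>)"
  then have "c \<in> S" by simp
  with rep obtain f where f: "fw_map B X X f" "c = fw_class B X X f" by metis
  show "\<one>\<^bsub>(self_monoid B b0 k X)\<lparr>carrier := S\<rparr>\<^esub> \<otimes>\<^bsub>(self_monoid B b0 k X)\<lparr>carrier := S\<rparr>\<^esub> c = c"
    "c \<otimes>\<^bsub>(self_monoid B b0 k X)\<lparr>carrier := S\<rparr>\<^esub> \<one>\<^bsub>(self_monoid B b0 k X)\<lparr>carrier := S\<rparr>\<^esub> = c"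
    by (simp_all add: self_monoid_def f fw_comp_class fw_map_id)
  fix d e assume "d \<in> carrier ((self_monoid B b0 k X)\<lparr>carrier := S\<rparr>)"
    "e \<in> carrier ((self_monoid B b0 k X)\<lparr>carrier := S\<rparr>)"
  then have "d \<in> S" "e \<in> S" by simp_all
  with rep obtain g h where g: "fw_map B X X g" "d = fw_class B X X g"
    and h: "fw_map B X X h" "e = fw_class B X X h" by metis
  show "c \<otimes>\<^bsub>(self_monoid B b0 k X)\<lparr>carrier := S\<rparr>\<^esub> d \<otimes>\<^bsub>(self_monoid B b0 k X)\<lparr>carrier := S\<rparr>\<^esub> e
    = c \<otimes>\<^bsub>(self_monoid B b0 k X)\<lparr>carrier := S\<rparr>\<^esub> (d \<otimes>\<^bsub>(self_monoid B b0 k X)\<lparr>carrier := S\<rparr>\<^esub> e)"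
    by (simp add: self_monoid_def f g h fw_comp_class comp_assoc
        fw_map_comp[OF g(1) f(1)] fw_map_comp[OF h(1) g(1)])
qed (use S comp in \<open>simp_all add: self_monoid_def\<close>)

lemma fw_class_id_self:
  "fw_pointed_space B X \<Longrightarrow> b0 \<in> topspace B \<Longrightarrow> fw_class B X X id \<in> self_classes B b0 k X"
  by (simp add: fw_class_in_self_classes fw_map_id fw_self_iso_id)

lemma monoid_self_monoid:
  assumes "fw_pointed_space B X" "b0 \<in> topspace B"
  shows "monoid (self_monoid B b0 k X)"
proof -
  have "monoid ((self_monoid B b0 k X)\<lparr>carrier := self_classes B b0 k X\<rparr>)"
    using assms by (intro submonoid_self_monoid fw_class_id_self fw_comp_classes_mem) auto
  then show ?thesis by (simp add: self_monoid_def)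
qed


section \<open>Fibred products of two factors\<close>

text \<open>
  A presentation of \<open>P\<close> as the fibred product of \<open>X\<close> and \<open>Y\<close>: \<open>a\<close> and \<open>b\<close> are the projections and
  \<open>m\<close> assembles a point from its components. It applies to \<open>fprod\<close> with either factor in the
  role of \<open>X\<close>, and to \<open>fprods\<close> with one factor split off.
\<close>

locale fw_product =
  fixes B :: "'b topology" and b0 :: 'b and X :: "('b, 'x) fw_space" and Y :: "('b, 'y) fw_space"
    and P :: "('b, 'p) fw_space" and a :: "'p \<Rightarrow> 'x" and b :: "'p \<Rightarrow> 'y" and m :: "'x \<Rightarrow> 'y \<Rightarrow> 'p"
  assumes b0: "b0 \<in> topspace B"
    and X: "fw_pointed_space B X" and Y: "fw_pointed_space B Y" and P: "fw_pointed_space B P"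
    and a: "fw_map B P X a" and b: "fw_map B P Y b"
    and m: "continuous_map (total (fprod X Y)) (total P) (\<lambda>(x, y). m x y)"
    and a_m: "\<And>x y. x \<in> topspace (total X) \<Longrightarrow> y \<in> topspace (total Y) \<Longrightarrow> proj X x = proj Y y \<Longrightarrow> a (m x y) = x"
    and b_m: "\<And>x y. x \<in> topspace (total X) \<Longrightarrow> y \<in> topspace (total Y) \<Longrightarrow> proj X x = proj Y y \<Longrightarrow> b (m x y) = y"
    and m_ab: "\<And>z. z \<in> topspace (total P) \<Longrightarrow> m (a z) (b z) = z"
begin

text \<open>Exchanging the factors makes each result of this locale available in two forms; the
  restriction argument uses the deformation of spheroids in the exchanged form.\<close>

lemma swap: "fw_product B b0 Y X P b a (\<lambda>y x. m x y)"
proof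
  have "continuous_map (total (fprod Y X)) (total (fprod X Y)) (\<lambda>z. (snd z, fst z))"
    unfolding fprod_def fw_space.simps continuous_map_in_subtopology
    by (auto intro!: continuous_intros continuous_map_from_subtopology)
  from continuous_map_compose[OF this m]
  show "continuous_map (total (fprod Y X)) (total P) (\<lambda>(y, x). m x y)"
    by (simp add: o_def case_prod_unfold)
qed (use b0 X Y P a b a_m b_m m_ab in simp_all)

lemma continuous_map_m:
  assumes "continuous_map Z (total X) u" "continuous_map Z (total Y) v"
    and "\<And>z. z \<in> topspace Z \<Longrightarrow> proj X (u z) = proj Y (v z)"
  shows "continuous_map Z (total P) (\<lambda>z. m (u z) (v z))"
proof -
  have "continuous_map Z (total (fprod X Y)) (\<lambda>z. (u z, v z))"
    using assms by (auto simp: fprod_def continuous_map_in_subtopology intro: continuous_map_pairedI)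
  from continuous_map_compose[OF this m] show ?thesis by (simp add: o_def)
qed

lemma m_in_topspace:
  assumes "x \<in> topspace (total X)" "y \<in> topspace (total Y)" "proj X x = proj Y y"
  shows "m x y \<in> topspace (total P)"
proof -
  have "(x, y) \<in> topspace (total (fprod X Y))" using assms by (simp add: fprod_def)
  then show ?thesis using continuous_map_image_subset_topspace[OF m] by (auto simp: image_subset_iff)
qed

lemma proj_m:
  assumes "x \<in> topspace (total X)" "y \<in> topspace (total Y)" "proj X x = proj Y y"
  shows "proj P (m x y) = proj X x"
  using fw_map_proj[OF a m_in_topspace[OF assms]] a_m[OF assms] by simp

lemma m_sect: "\<beta> \<in> topspace B \<Longrightarrow> m (sect X \<beta>) (sect Y \<beta>) = sect P \<beta>"
  using m_ab[OF fw_pointed_sect[OF P]] fw_map_sect[OF a] fw_map_sect[OF b] by simp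

lemma proj_ab: "z \<in> topspace (total P) \<Longrightarrow> proj X (a z) = proj Y (b z)"
  using fw_map_proj[OF a] fw_map_proj[OF b] by simp

lemma fw_map_m:
  assumes u: "fw_map B Z X u" and v: "fw_map B Z Y v"
  shows "fw_map B Z P (\<lambda>z. m (u z) (v z))"
proof -
  have eq: "proj X (u z) = proj Y (v z)" if "z \<in> topspace (total Z)" for z
    using fw_map_proj[OF u that] fw_map_proj[OF v that] by simp
  have "continuous_map (total Z) (total P) (\<lambda>z. m (u z) (v z))"
    by (rule continuous_map_m[OF fw_map_continuous[OF u] fw_map_continuous[OF v] eq])
  moreover have "proj P (m (u z) (v z)) = proj Z z" if "z \<in> topspace (total Z)" for z
    using proj_m[OF fw_map_in_topspace[OF u that] fw_map_in_topspace[OF v that] eq[OF that]]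
      fw_map_proj[OF u that] by simp
  ultimately show ?thesis
    unfolding fw_map_def[of B Z P] using fw_map_sect[OF u] fw_map_sect[OF v] m_sect by simp
qed

text \<open>A fibrewise homotopy does not move the base coordinate of a point, so the two homotopies
  lie over the same point of \<open>B\<close> at every time and can be paired.\<close>

lemma fw_homotopic_m:
  assumes Z: "fw_pointed_space B Z" and u: "fw_homotopic B Z X u u'" and v: "fw_homotopic B Z Y v v'"
  shows "fw_homotopic B Z P (\<lambda>z. m (u z) (v z)) (\<lambda>z. m (u' z) (v' z))"
proof -
  obtain h where h: "continuous_map (prod_topology (top_of_set {0..1::real}) (total Z)) (total X) h"
    and h01: "\<And>x. h (0, x) = u x" "\<And>x. h (1, x) = u' x"
    and hm: "\<And>t. 0 \<le> t \<Longrightarrow> t \<le> 1 \<Longrightarrow> fw_map B Z X (\<lambda>x. h (t, x))"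
    using u by (rule fw_homotopicE) blast
  obtain k where k: "continuous_map (prod_topology (top_of_set {0..1::real}) (total Z)) (total Y) k"
    and k01: "\<And>x. k (0, x) = v x" "\<And>x. k (1, x) = v' x"
    and km: "\<And>t. 0 \<le> t \<Longrightarrow> t \<le> 1 \<Longrightarrow> fw_map B Z Y (\<lambda>x. k (t, x))"
    using v by (rule fw_homotopicE) blast
  have "proj X (h (t, x)) = proj Y (k (t, x))"
    if "0 \<le> t" "t \<le> 1" "x \<in> topspace (total Z)" for t x
    using fw_map_proj[OF hm[OF that(1,2)] that(3)] fw_map_proj[OF km[OF that(1,2)] that(3)] by simp
  then have "continuous_map (prod_topology (top_of_set {0..1::real}) (total Z)) (total P)
      (\<lambda>z. m (h z) (k z))"
    by (intro continuous_map_m h k) auto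
  then show ?thesis
    by (rule fw_homotopicI[OF Z]) (auto simp: h01 k01 intro: fw_map_m hm km)
qed

lemma spheroid_m:
  assumes \<alpha>: "spheroid n (total X) (sect X b0) \<alpha>" and \<beta>: "spheroid n (total Y) (sect Y b0) \<beta>"
    and eq: "\<And>u. u \<in> topspace (cube n) \<Longrightarrow> proj X (\<alpha> u) = proj Y (\<beta> u)"
  shows "spheroid n (total P) (sect P b0) (\<lambda>u. m (\<alpha> u) (\<beta> u))"
  using \<alpha> \<beta> continuous_map_m[OF _ _ eq] m_sect[OF b0] by (auto simp: spheroid_def)

text \<open>A homotopy of the X-component alone would leave the fibred product. Its image in
  \<open>B\<close> is lifted to Y, starting at the Y-component of \<gamma>, and the lift serves as
  the second coordinate of the deformation.\<close>

lemma spheroid_deform: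
  assumes lift: "homotopy_lifting (cube n) (total Y) B (proj Y)"
    and \<gamma>: "spheroid n (total P) (sect P b0) \<gamma>"
    and hom: "spheroid_homotopic n (total X) (sect X b0) (a \<circ> \<gamma>) \<alpha>"
  obtains \<gamma>' where "spheroid_homotopic n (total P) (sect P b0) \<gamma> \<gamma>'"
    "\<And>u. u \<in> topspace (cube n) \<Longrightarrow> a (\<gamma>' u) = \<alpha> (cube_clamp n u)"
proof -
  note \<gamma>_in = spheroid_in_topspace[OF \<gamma>]
  have proj_sect: "proj X (sect X b0) = b0" "proj Y (sect Y b0) = b0"
    using X Y b0 by (simp_all add: fw_pointed_space_def)
  obtain M where M: "continuous_map (cube_cylinder n) (total X) M"
    and M0: "\<And>u. u \<in> topspace (cube n) \<Longrightarrow> M (0, u) = (a \<circ> \<gamma>) u"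
    and M1: "\<And>u. u \<in> topspace (cube n) \<Longrightarrow> M (1, u) = \<alpha> u"
    and Mb: "\<And>t u. 0 \<le> t \<Longrightarrow> t \<le> 1 \<Longrightarrow> u \<in> cube_boundary n \<Longrightarrow> M (t, u) = sect X b0"
    using hom by (rule spheroid_homotopicE) blast
  have b\<gamma>: "spheroid n (total Y) (sect Y b0) (b \<circ> \<gamma>)"
    by (rule pointed_map_spheroid[OF fw_map_pointed[OF b b0] \<gamma>])
  have H: "continuous_map (cube_cylinder n) B (proj X \<circ> M)"
    using M X by (auto simp: fw_pointed_space_def intro: continuous_map_compose)
  obtain K where K: "continuous_map (cube_cylinder n) (total Y) K"
    and K0: "\<And>u. u \<in> topspace (cube n) \<Longrightarrow> K (0, u) = (b \<circ> \<gamma>) (cube_clamp n u)"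
    and Kb: "\<And>t u. 0 \<le> t \<Longrightarrow> t \<le> 1 \<Longrightarrow> u \<in> cube_boundary n \<Longrightarrow> K (t, u) = sect Y b0"
    and pK: "\<And>t u. 0 \<le> t \<Longrightarrow> t \<le> 1 \<Longrightarrow> u \<in> topspace (cube n) \<Longrightarrow>
      proj Y (K (t, u)) = (proj X \<circ> M) (t, cube_clamp n u)"
  proof (rule spheroid_homotopy_lifting[OF lift b\<gamma> H])
    show "(proj X \<circ> M) (0, u) = proj Y ((b \<circ> \<gamma>) u)" if "u \<in> topspace (cube n)" for u
      using M0[OF that] proj_ab[OF \<gamma>_in[OF that]] by simp
    show "(proj X \<circ> M) (t, u) = proj Y (sect Y b0)"
      if "0 \<le> t" "t \<le> 1" "u \<in> cube_boundary n" for t u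
      using Mb[OF that] proj_sect by simp
  qed blast
  \<comment> \<open>The first coordinate is clamped as well, since the lift \<open>K\<close> lies
    over the clamped homotopy. Hence \<open>h\<close> starts at \<gamma> composed with
    \<open>cube_clamp\<close>, which is homotopic to \<gamma>.\<close>
  define h where "h z = m (M (fst z, cube_clamp n (snd z))) (K z)" for z
  have clamp: "continuous_map (cube_cylinder n) (cube n) (\<lambda>z. cube_clamp n (snd z))"
    using continuous_map_compose[OF continuous_map_snd continuous_map_cube_clamp]
    by (simp add: o_def)
  have "continuous_map (cube_cylinder n) (cube_cylinder n) (\<lambda>z. (fst z, cube_clamp n (snd z)))"
    by (intro continuous_map_into_cylinder continuous_map_cylinder_fst clamp) auto
  from continuous_map_compose[OF this M]
  have "continuous_map (cube_cylinder n) (total P) h"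
    unfolding h_def by (intro continuous_map_m K) (auto simp: o_def pK)
  then have "spheroid_homotopic n (total P) (sect P b0) (\<gamma> \<circ> cube_clamp n) (\<lambda>u. h (1, u))"
  proof (rule spheroid_homotopicI)
    fix u assume "u \<in> topspace (cube n)"
    then show "h (0, u) = (\<gamma> \<circ> cube_clamp n) u"
      by (simp add: h_def M0 K0 cube_clamp_in_cube m_ab \<gamma>_in)
  next
    fix t u assume "0 \<le> t" "t \<le> (1::real)" "u \<in> cube_boundary n"
    then show "h (t, u) = sect P b0"
      by (simp add: h_def Mb Kb cube_clamp_boundary m_sect b0)
  qed simp
  then have "spheroid_homotopic n (total P) (sect P b0) \<gamma> (\<lambda>u. h (1, u))"
    by (rule spheroid_homotopic_trans[OF spheroid_homotopic_sym[OF spheroid_homotopic_clamp[OF \<gamma>]]])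
  moreover have "a (h (1, u)) = \<alpha> (cube_clamp n u)" if u: "u \<in> topspace (cube n)" for u
  proof -
    have "(1, u) \<in> topspace (cube_cylinder n)" "(1, cube_clamp n u) \<in> topspace (cube_cylinder n)"
      using u cube_clamp_in_cube by auto
    then have "M (1, cube_clamp n u) \<in> topspace (total X)" "K (1, u) \<in> topspace (total Y)"
      using continuous_map_image_subset_topspace[OF M] continuous_map_image_subset_topspace[OF K]
      by blast+
    then have "a (h (1, u)) = M (1, cube_clamp n u)"
      using pK[of 1 u] u by (simp add: h_def a_m)
    then show ?thesis by (simp add: M1 cube_clamp_in_cube)
  qed
  ultimately show ?thesis by (rule that)
qed

section \<open>The inclusion of a factor and restriction along it\<close>

definition \<iota> :: "'x \<Rightarrow> 'p" where
  "\<iota> x = m x (sect Y (proj X x))"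

lemma proj_in_base: "x \<in> topspace (total X) \<Longrightarrow> proj X x \<in> topspace B"
  using X continuous_map_image_subset_topspace[of "total X" B "proj X"]
  by (auto simp: fw_pointed_space_def)

lemma sect_proj:
  assumes "x \<in> topspace (total X)"
  shows "sect Y (proj X x) \<in> topspace (total Y)" "proj Y (sect Y (proj X x)) = proj X x"
  using proj_in_base[OF assms] fw_pointed_sect[OF Y] Y by (auto simp: fw_pointed_space_def)

lemma fw_map_sect_proj: "fw_map B X Y (\<lambda>x. sect Y (proj X x))"
proof -
  have "continuous_map (total X) (total Y) (sect Y \<circ> proj X)"
    using X Y by (auto simp: fw_pointed_space_def intro: continuous_map_compose)
  then show ?thesis
    using X sect_proj by (auto simp: fw_map_def o_def fw_pointed_space_def)
qed

lemma fw_map_\<iota>: "fw_map B X P \<iota>"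
  using fw_map_m[OF fw_map_id fw_map_sect_proj] by (simp add: \<iota>_def[abs_def])

lemma a_\<iota>: "x \<in> topspace (total X) \<Longrightarrow> a (\<iota> x) = x"
  by (simp add: \<iota>_def a_m sect_proj)

lemma b_\<iota>: "x \<in> topspace (total X) \<Longrightarrow> b (\<iota> x) = sect Y (proj X x)"
  by (simp add: \<iota>_def b_m sect_proj)

text \<open>\<open>f\<close> preserves the Y-component and the point of \<open>B\<close>. So the
  Y-component of \<open>f (\<iota> x)\<close> is still the section over its own base point, and a
  point of the product with this property is the image under \<iota> of its X-component.\<close>

lemma over_\<iota>:
  assumes f: "fw_map B P P f" and over: "\<And>z. z \<in> topspace (total P) \<Longrightarrow> b (f z) = b z"
    and x: "x \<in> topspace (total X)"
  shows "f (\<iota> x) = \<iota> (a (f (\<iota> x)))"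
proof -
  have \<iota>x: "\<iota> x \<in> topspace (total P)" by (rule fw_map_in_topspace[OF fw_map_\<iota> x])
  then have f\<iota>x: "f (\<iota> x) \<in> topspace (total P)" by (rule fw_map_in_topspace[OF f])
  have "proj X (a (f (\<iota> x))) = proj X x"
    using fw_map_proj[OF a f\<iota>x] fw_map_proj[OF f \<iota>x] fw_map_proj[OF fw_map_\<iota> x] by simp
  then have "b (f (\<iota> x)) = sect Y (proj X (a (f (\<iota> x))))" using over[OF \<iota>x] b_\<iota>[OF x] by simp
  then show ?thesis using m_ab[OF f\<iota>x] by (simp add: \<iota>_def)
qed

lemma induces_iso_restrict:
  assumes lift: "homotopy_lifting (cube n) (total X) B (proj X)"
    and f: "fw_map B P P f" and over: "\<And>z. z \<in> topspace (total P) \<Longrightarrow> b (f z) = b z"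
    and iso: "induces_iso n (total P) (sect P b0) (total P) (sect P b0) f"
  shows "induces_iso n (total X) (sect X b0) (total X) (sect X b0) (a \<circ> f \<circ> \<iota>)"
proof -
  let ?X = "spheroid_homotopic n (total X) (sect X b0)" and ?P = "spheroid_homotopic n (total P) (sect P b0)"
  note iso' = iso[unfolded induces_iso_iff[OF fw_map_pointed[OF f b0]]]
  note pa = fw_map_pointed[OF a b0] and pf = fw_map_pointed[OF f b0]
    and p\<iota> = fw_map_pointed[OF fw_map_\<iota> b0]
  have g: "fw_map B X X (a \<circ> f \<circ> \<iota>)" using fw_map_\<iota> a f by (metis fw_map_comp)
  note pg = fw_map_pointed[OF g b0]
  \<comment> \<open>The two sides agree at the points of the cube; elsewhere they may differ, so a
    homotopy stands in for an equation of functions.\<close>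
  have comm: "?P (f \<circ> (\<iota> \<circ> \<alpha>)) (\<iota> \<circ> (a \<circ> f \<circ> \<iota> \<circ> \<alpha>))"
    if \<alpha>: "spheroid n (total X) (sect X b0) \<alpha>" for \<alpha>
    by (rule spheroid_homotopic_eq[OF pointed_map_spheroid[OF pf pointed_map_spheroid[OF p\<iota> \<alpha>]]])
      (use over_\<iota>[OF f over] spheroid_in_topspace[OF \<alpha>] in simp)
  have a\<iota>: "?X (a \<circ> (\<iota> \<circ> \<alpha>)) \<alpha>" if \<alpha>: "spheroid n (total X) (sect X b0) \<alpha>" for \<alpha>
    by (rule spheroid_homotopic_sym[OF spheroid_homotopic_eq[OF \<alpha>]])
      (use a_\<iota> spheroid_in_topspace[OF \<alpha>] in simp)
  show ?thesis
    unfolding induces_iso_iff[OF pg]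
  proof (intro conjI allI impI)
    fix \<alpha> \<beta> assume \<alpha>: "spheroid n (total X) (sect X b0) \<alpha>" and \<beta>: "spheroid n (total X) (sect X b0) \<beta>"
      and "?X (a \<circ> f \<circ> \<iota> \<circ> \<alpha>) (a \<circ> f \<circ> \<iota> \<circ> \<beta>)"
    then have "?P (\<iota> \<circ> (a \<circ> f \<circ> \<iota> \<circ> \<alpha>)) (\<iota> \<circ> (a \<circ> f \<circ> \<iota> \<circ> \<beta>))"
      by (intro pointed_map_spheroid_homotopic[OF p\<iota>])
    then have "?P (f \<circ> (\<iota> \<circ> \<alpha>)) (f \<circ> (\<iota> \<circ> \<beta>))"
      by (rule spheroid_homotopic_trans[OF spheroid_homotopic_trans[OF comm[OF \<alpha>]] spheroid_homotopic_sym[OF comm[OF \<beta>]]])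
    then have "?P (\<iota> \<circ> \<alpha>) (\<iota> \<circ> \<beta>)"
      using iso' pointed_map_spheroid[OF p\<iota> \<alpha>] pointed_map_spheroid[OF p\<iota> \<beta>] by metis
    then have "?X (a \<circ> (\<iota> \<circ> \<alpha>)) (a \<circ> (\<iota> \<circ> \<beta>))" by (rule pointed_map_spheroid_homotopic[OF pa])
    then show "?X \<alpha> \<beta>"
      by (rule spheroid_homotopic_trans[OF spheroid_homotopic_trans[OF spheroid_homotopic_sym[OF a\<iota>[OF \<alpha>]]] a\<iota>[OF \<beta>]])
  next
    fix \<alpha> assume \<alpha>: "spheroid n (total X) (sect X b0) \<alpha>"
    note \<iota>\<alpha> = pointed_map_spheroid[OF p\<iota> \<alpha>]
    obtain \<gamma> where \<gamma>: "spheroid n (total P) (sect P b0) \<gamma>" "?P (f \<circ> \<gamma>) (\<iota> \<circ> \<alpha>)"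
      using iso' \<iota>\<alpha> by metis
    define \<beta> where "\<beta> u = sect Y (proj X (\<alpha> u))" for u
    have "spheroid_homotopic n (total Y) (sect Y b0) (b \<circ> (f \<circ> \<gamma>)) (b \<circ> (\<iota> \<circ> \<alpha>))"
      by (rule pointed_map_spheroid_homotopic[OF fw_map_pointed[OF b b0] \<gamma>(2)])
    moreover have "spheroid_homotopic n (total Y) (sect Y b0) (b \<circ> \<gamma>) (b \<circ> (f \<circ> \<gamma>))"
      by (rule spheroid_homotopic_eq[OF pointed_map_spheroid[OF fw_map_pointed[OF b b0] \<gamma>(1)]])
        (use over spheroid_in_topspace[OF \<gamma>(1)] in simp)
    moreover have "spheroid_homotopic n (total Y) (sect Y b0) (b \<circ> (\<iota> \<circ> \<alpha>)) \<beta>"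
      by (rule spheroid_homotopic_eq[OF pointed_map_spheroid[OF fw_map_pointed[OF b b0] \<iota>\<alpha>]])
        (use b_\<iota> spheroid_in_topspace[OF \<alpha>] in \<open>simp add: \<beta>_def\<close>)
    ultimately have "spheroid_homotopic n (total Y) (sect Y b0) (b \<circ> \<gamma>) \<beta>"
      by (metis spheroid_homotopic_trans)
    \<comment> \<open>The roles are exchanged here: the given homotopy is one of Y-components, and
      its image in \<open>B\<close> is lifted to X.\<close>
    then obtain \<gamma>' where \<gamma>': "?P \<gamma> \<gamma>'"
      and b\<gamma>': "\<And>u. u \<in> topspace (cube n) \<Longrightarrow> b (\<gamma>' u) = \<beta> (cube_clamp n u)"
      using fw_product.spheroid_deform[OF swap lift \<gamma>(1)] by metis
    have s\<gamma>': "spheroid n (total P) (sect P b0) \<gamma>'" using spheroid_homotopic_imp_spheroid[OF \<gamma>'] by simp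
    note a\<gamma>' = pointed_map_spheroid[OF pa s\<gamma>']
    \<comment> \<open>The Y-component of \<open>\<gamma>' u\<close> is a section value over the base
      point of \<open>\<gamma>' u\<close> itself, which is what membership in the image of \<iota>
      amounts to.\<close>
    have \<gamma>'\<iota>: "\<gamma>' u = \<iota> (a (\<gamma>' u))" if u: "u \<in> topspace (cube n)" for u
    proof -
      note z = spheroid_in_topspace[OF s\<gamma>' u]
      have \<alpha>c: "\<alpha> (cube_clamp n u) \<in> topspace (total X)"
        by (rule spheroid_in_topspace[OF \<alpha> cube_clamp_in_cube])
      have "proj X (a (\<gamma>' u)) = proj X (\<alpha> (cube_clamp n u))"
        using proj_ab[OF z] b\<gamma>'[OF u] sect_proj(2)[OF \<alpha>c] by (simp add: \<beta>_def)
      then have "b (\<gamma>' u) = sect Y (proj X (a (\<gamma>' u)))" using b\<gamma>'[OF u] by (simp add: \<beta>_def)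
      then show ?thesis using m_ab[OF z] by (simp add: \<iota>_def)
    qed
    have "?X (a \<circ> f \<circ> \<iota> \<circ> (a \<circ> \<gamma>')) (a \<circ> (f \<circ> \<gamma>'))"
      by (rule spheroid_homotopic_eq[OF pointed_map_spheroid[OF pg a\<gamma>']]) (use \<gamma>'\<iota> in simp)
    moreover have "?X (a \<circ> (f \<circ> \<gamma>')) (a \<circ> (f \<circ> \<gamma>))"
      by (intro pointed_map_spheroid_homotopic[OF pa] pointed_map_spheroid_homotopic[OF pf]
          spheroid_homotopic_sym[OF \<gamma>'])
    moreover have "?X (a \<circ> (f \<circ> \<gamma>)) (a \<circ> (\<iota> \<circ> \<alpha>))"
      by (rule pointed_map_spheroid_homotopic[OF pa \<gamma>(2)])
    ultimately have "?X (a \<circ> f \<circ> \<iota> \<circ> (a \<circ> \<gamma>')) \<alpha>"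
      using a\<iota>[OF \<alpha>] by (metis spheroid_homotopic_trans)
    with a\<gamma>' show "\<exists>\<gamma>. spheroid n (total X) (sect X b0) \<gamma> \<and> ?X (a \<circ> f \<circ> \<iota> \<circ> \<gamma>) \<alpha>" by metis
  qed
qed

text \<open>A point of the product is moved in two stages: a path in X brings its first coordinate
  to the base point while a lift carries the second along; the second coordinate then lies in the
  fibre over \<open>b0\<close> and is joined to the base point inside that fibre.\<close>

lemma spheroid_0_nullhomotopic:
  assumes lift: "homotopy_lifting (cube 0) (total Y) B (proj Y)"
    and pcX: "path_connected_space (total X)"
    and pcY: "path_connected_space (subtopology (total Y) {y \<in> topspace (total Y). proj Y y = b0})"
    and \<gamma>: "spheroid 0 (total P) (sect P b0) \<gamma>"
  shows "spheroid_homotopic 0 (total P) (sect P b0) \<gamma> (\<lambda>_. sect P b0)"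
proof -
  let ?F = "subtopology (total Y) {y \<in> topspace (total Y). proj Y y = b0}"
  have x0: "sect X b0 \<in> topspace (total X)" and y0: "sect Y b0 \<in> topspace (total Y)"
    using fw_pointed_sect[OF X b0] fw_pointed_sect[OF Y b0] .
  have proj_sect: "proj X (sect X b0) = b0" "proj Y (sect Y b0) = b0"
    using X Y b0 by (simp_all add: fw_pointed_space_def)
  have "spheroid_homotopic 0 (total X) (sect X b0) (a \<circ> \<gamma>) (\<lambda>_. sect X b0)"
    using pcX pointed_map_spheroid[OF fw_map_pointed[OF a b0] \<gamma>] spheroid_const[OF x0]
    by (rule spheroid_0_homotopic)
  then obtain \<gamma>' where \<gamma>': "spheroid_homotopic 0 (total P) (sect P b0) \<gamma> \<gamma>'"
    and a\<gamma>': "\<And>u. u \<in> topspace (cube 0) \<Longrightarrow> a (\<gamma>' u) = sect X b0"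
    using spheroid_deform[OF lift \<gamma>] by metis
  have s\<gamma>': "spheroid 0 (total P) (sect P b0) \<gamma>'" using spheroid_homotopic_imp_spheroid[OF \<gamma>'] by simp
  have "spheroid 0 (total Y) (sect Y b0) (b \<circ> \<gamma>')"
    by (rule pointed_map_spheroid[OF fw_map_pointed[OF b b0] s\<gamma>'])
  moreover have "proj Y (b (\<gamma>' u)) = b0" if u: "u \<in> topspace (cube 0)" for u
    using proj_ab[OF spheroid_in_topspace[OF s\<gamma>' u]] a\<gamma>'[OF u] proj_sect by simp
  ultimately have "spheroid 0 ?F (sect Y b0) (b \<circ> \<gamma>')"
    using fw_map_in_topspace[OF b spheroid_in_topspace[OF s\<gamma>']]
    by (auto simp: spheroid_def continuous_map_in_subtopology)
  moreover have "spheroid 0 ?F (sect Y b0) (\<lambda>_. sect Y b0)"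
    using y0 proj_sect by (intro spheroid_const) simp
  ultimately have "spheroid_homotopic 0 ?F (sect Y b0) (b \<circ> \<gamma>') (\<lambda>_. sect Y b0)"
    by (rule spheroid_0_homotopic[OF pcY])
  then obtain h where h: "continuous_map (cube_cylinder 0) ?F h"
    and h0: "\<And>u. u \<in> topspace (cube 0) \<Longrightarrow> h (0, u) = (b \<circ> \<gamma>') u"
    and h1: "\<And>u. u \<in> topspace (cube 0) \<Longrightarrow> h (1, u) = sect Y b0"
    by (rule spheroid_homotopicE) blast
  \<comment> \<open>Since \<open>h\<close> stays in the fibre over \<open>b0\<close>, it can be
    paired with the constant first coordinate.\<close>
  have "continuous_map (cube_cylinder 0) (total P) (\<lambda>z. m (sect X b0) (h z))"
    using h x0 proj_sect by (intro continuous_map_m) (auto simp: continuous_map_in_subtopology)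
  then have "spheroid_homotopic 0 (total P) (sect P b0) \<gamma>' (\<lambda>_. sect P b0)"
  proof (rule spheroid_homotopicI)
    fix u assume u: "u \<in> topspace (cube 0)"
    show "m (sect X b0) (h (0, u)) = \<gamma>' u"
      using h0[OF u] a\<gamma>'[OF u] m_ab[OF spheroid_in_topspace[OF s\<gamma>' u]] by simp
    show "m (sect X b0) (h (1, u)) = sect P b0" using h1[OF u] m_sect[OF b0] by simp
  qed (simp add: cube_boundary_def)
  with \<gamma>' show ?thesis by (rule spheroid_homotopic_trans)
qed

section \<open>Extension of self-maps of a factor\<close>

definition extend :: "('x \<Rightarrow> 'x) \<Rightarrow> 'p \<Rightarrow> 'p" where
  "extend g z = m (g (a z)) (b z)"

lemma
  assumes g: "fw_map B X X g"
  shows fw_map_extend: "fw_map B P P (extend g)"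
    and a_extend: "z \<in> topspace (total P) \<Longrightarrow> a (extend g z) = g (a z)"
    and b_extend: "z \<in> topspace (total P) \<Longrightarrow> b (extend g z) = b z"
proof -
  have ga: "fw_map B P X (g \<circ> a)" using a g by (rule fw_map_comp)
  from fw_map_m[OF this b] show "fw_map B P P (extend g)" by (simp add: extend_def[abs_def])
  assume z: "z \<in> topspace (total P)"
  have "proj X (g (a z)) = proj Y (b z)" using fw_map_proj[OF ga z] fw_map_proj[OF b z] by simp
  then show "a (extend g z) = g (a z)" "b (extend g z) = b z"
    using fw_map_in_topspace[OF ga z] fw_map_in_topspace[OF b z] by (simp_all add: extend_def a_m b_m)
qed

lemma induces_iso_extend:
  assumes lift: "homotopy_lifting (cube n) (total Y) B (proj Y)"
    and pcX: "path_connected_space (total X)"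
    and pcY: "path_connected_space (subtopology (total Y) {y \<in> topspace (total Y). proj Y y = b0})"
    and g: "fw_map B X X g"
    and iso: "induces_iso n (total X) (sect X b0) (total X) (sect X b0) g"
  shows "induces_iso n (total P) (sect P b0) (total P) (sect P b0) (extend g)"
proof -
  let ?X = "spheroid_homotopic n (total X) (sect X b0)" and ?P = "spheroid_homotopic n (total P) (sect P b0)"
  note f = fw_map_extend[OF g]
  note pa = fw_map_pointed[OF a b0] and pb = fw_map_pointed[OF b b0]
    and pg = fw_map_pointed[OF g b0] and pf = fw_map_pointed[OF f b0]
  note iso' = iso[unfolded induces_iso_iff[OF pg]]
  have x0: "sect X b0 \<in> topspace (total X)" using fw_pointed_sect[OF X b0] .
  have ker: "?P \<gamma> (\<lambda>_. sect P b0)"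
    if \<gamma>: "spheroid n (total P) (sect P b0) \<gamma>" and hom: "?P (extend g \<circ> \<gamma>) (\<lambda>_. sect P b0)" for \<gamma>
  proof -
    note a\<gamma> = pointed_map_spheroid[OF pa \<gamma>]
    have "?X (a \<circ> (extend g \<circ> \<gamma>)) (a \<circ> (\<lambda>_. sect P b0))"
      by (rule pointed_map_spheroid_homotopic[OF pa hom])
    moreover have "?X (g \<circ> (a \<circ> \<gamma>)) (a \<circ> (extend g \<circ> \<gamma>))"
      by (rule spheroid_homotopic_eq[OF pointed_map_spheroid[OF pg a\<gamma>]])
        (simp add: a_extend[OF g] spheroid_in_topspace[OF \<gamma>])
    moreover have "a \<circ> (\<lambda>_::nat \<Rightarrow> real. sect P b0) = g \<circ> (\<lambda>_. sect X b0)"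
      using fw_map_sect[OF a b0] fw_map_sect[OF g b0] by (simp add: fun_eq_iff)
    ultimately have "?X (g \<circ> (a \<circ> \<gamma>)) (g \<circ> (\<lambda>_. sect X b0))"
      by (metis spheroid_homotopic_trans)
    then have "?X (a \<circ> \<gamma>) (\<lambda>_. sect X b0)" using iso' a\<gamma> spheroid_const[OF x0] by metis
    then obtain \<gamma>' where \<gamma>': "?P \<gamma> \<gamma>'"
      and a\<gamma>': "\<And>u. u \<in> topspace (cube n) \<Longrightarrow> a (\<gamma>' u) = sect X b0"
      using spheroid_deform[OF lift \<gamma>] by metis
    have s\<gamma>': "spheroid n (total P) (sect P b0) \<gamma>'" using spheroid_homotopic_imp_spheroid[OF \<gamma>'] by simp
    \<comment> \<open>The chain is \<gamma>, \<gamma>', f \<gamma>', f \<gamma>, constant, where f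
      is \<open>extend g\<close>. Thus the null homotopy of f \<gamma> is used twice: to obtain
      \<gamma>' and to finish the chain.\<close>
    have "?P \<gamma>' (extend g \<circ> \<gamma>')"
    proof (rule spheroid_homotopic_eq[OF s\<gamma>'])
      fix u assume u: "u \<in> topspace (cube n)"
      show "\<gamma>' u = (extend g \<circ> \<gamma>') u"
        using a\<gamma>'[OF u] fw_map_sect[OF g b0] m_ab[OF spheroid_in_topspace[OF s\<gamma>' u]]
        by (simp add: extend_def)
    qed
    moreover have "?P (extend g \<circ> \<gamma>') (extend g \<circ> \<gamma>)"
      by (rule pointed_map_spheroid_homotopic[OF pf spheroid_homotopic_sym[OF \<gamma>']])
    ultimately show ?thesis using \<gamma>' hom by (metis spheroid_homotopic_trans)
  qed
  show ?thesis
    unfolding induces_iso_iff[OF pf]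
  proof (intro conjI allI impI)
    fix \<gamma> \<delta> assume \<gamma>: "spheroid n (total P) (sect P b0) \<gamma>" and \<delta>: "spheroid n (total P) (sect P b0) \<delta>"
      and hom: "?P (extend g \<circ> \<gamma>) (extend g \<circ> \<delta>)"
    show "?P \<gamma> \<delta>"
    \<comment> \<open>The kernel argument needs concatenation, hence a coordinate 0; in degree 0 all
      spheroids of the product are homotopic anyway.\<close>
    proof (cases "n = 0")
      case True
      then have "?P \<gamma> (\<lambda>_. sect P b0)" "?P \<delta> (\<lambda>_. sect P b0)"
        using spheroid_0_nullhomotopic[OF _ pcX pcY] lift \<gamma> \<delta> by simp_all
      then show ?thesis by (metis spheroid_homotopic_trans spheroid_homotopic_sym)
    next
      case False
      then have "0 < n" by simp
      from this pf ker \<gamma> \<delta> hom show ?thesis by (rule spheroid_homotopic_if_trivial_kernel)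
    qed
  next
    fix \<gamma> assume \<gamma>: "spheroid n (total P) (sect P b0) \<gamma>"
    obtain \<alpha> where \<alpha>: "spheroid n (total X) (sect X b0) \<alpha>" "?X (g \<circ> \<alpha>) (a \<circ> \<gamma>)"
      using iso' pointed_map_spheroid[OF pa \<gamma>] by metis
    \<comment> \<open>Surjectivity of \<open>g\<close> gives a preimage of the X-component of
      \<gamma> up to homotopy only. The deformation makes it exact, up to
      \<open>cube_clamp\<close>.\<close>
    obtain \<gamma>' where \<gamma>': "?P \<gamma> \<gamma>'"
      and a\<gamma>': "\<And>u. u \<in> topspace (cube n) \<Longrightarrow> a (\<gamma>' u) = (g \<circ> \<alpha>) (cube_clamp n u)"
      using spheroid_deform[OF lift \<gamma> spheroid_homotopic_sym[OF \<alpha>(2)]] by metis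
    have s\<gamma>': "spheroid n (total P) (sect P b0) \<gamma>'" using spheroid_homotopic_imp_spheroid[OF \<gamma>'] by simp
    \<comment> \<open>A preimage of \<gamma>' under \<open>extend g\<close>: the first coordinate is
      replaced by its preimage under \<open>g\<close>, and the second is kept. The coordinates match
      over \<open>B\<close> because \<open>g\<close> preserves fibres.\<close>
    define \<delta> where "\<delta> u = m (\<alpha> (cube_clamp n u)) (b (\<gamma>' u))" for u
    have \<alpha>c_in: "\<alpha> (cube_clamp n u) \<in> topspace (total X)" for u
      by (rule spheroid_in_topspace[OF \<alpha>(1) cube_clamp_in_cube])
    have eq: "proj X (\<alpha> (cube_clamp n u)) = proj Y (b (\<gamma>' u))" if u: "u \<in> topspace (cube n)" for u
      using proj_ab[OF spheroid_in_topspace[OF s\<gamma>' u]] a\<gamma>'[OF u] fw_map_proj[OF g \<alpha>c_in] by simp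
    have "spheroid n (total X) (sect X b0) (\<alpha> \<circ> cube_clamp n)"
      using spheroid_homotopic_imp_spheroid[OF spheroid_homotopic_clamp[OF \<alpha>(1)]] by simp
    then have s\<delta>: "spheroid n (total P) (sect P b0) \<delta>"
      unfolding \<delta>_def using spheroid_m[of n "\<alpha> \<circ> cube_clamp n" "b \<circ> \<gamma>'"]
        pointed_map_spheroid[OF pb s\<gamma>'] eq by simp
    have "?P (extend g \<circ> \<delta>) \<gamma>'"
    proof (rule spheroid_homotopic_eq[OF pointed_map_spheroid[OF pf s\<delta>]])
      fix u assume u: "u \<in> topspace (cube n)"
      note z = spheroid_in_topspace[OF s\<gamma>' u]
      have "a (\<delta> u) = \<alpha> (cube_clamp n u)" "b (\<delta> u) = b (\<gamma>' u)"
        unfolding \<delta>_def using a_m b_m \<alpha>c_in fw_map_in_topspace[OF b z] eq[OF u] by simp_all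
      then show "(extend g \<circ> \<delta>) u = \<gamma>' u"
        using a\<gamma>'[OF u] m_ab[OF z] by (simp add: extend_def)
    qed
    then have "?P (extend g \<circ> \<delta>) \<gamma>"
      by (rule spheroid_homotopic_trans[OF _ spheroid_homotopic_sym[OF \<gamma>']])
    with s\<delta> show "\<exists>\<delta>. spheroid n (total P) (sect P b0) \<delta> \<and> ?P (extend g \<circ> \<delta>) \<gamma>" by metis
  qed
qed

end

section \<open>The monoids of classes over one factor and their split exact sequence\<close>

context fw_product
begin

definition over_classes :: "nat \<Rightarrow> ('p \<Rightarrow> 'p) set set" where
  "over_classes k =
     {c \<in> self_classes B b0 k P. fw_comp B P Y (fw_class B P Y b) c = fw_class B P Y b}"

definition over_under_classes :: "nat \<Rightarrow> ('p \<Rightarrow> 'p) set set" where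
  "over_under_classes k =
     {c \<in> over_classes k. fw_comp B X P c (fw_class B X P \<iota>) = fw_class B X P \<iota>}"

definition restrict_class :: "('p \<Rightarrow> 'p) set \<Rightarrow> ('x \<Rightarrow> 'x) set" where
  "restrict_class c = fw_comp B X X (fw_comp B P X (fw_class B P X a) c) (fw_class B X P \<iota>)"

text \<open>This is the splitting \<psi>. Taking all maps homotopic to some extension defines it on
  classes without choosing a representative.\<close>

definition extend_class :: "('x \<Rightarrow> 'x) set \<Rightarrow> ('p \<Rightarrow> 'p) set" where
  "extend_class c = {h. \<exists>g \<in> c. fw_homotopic B P P (extend g) h}"

lemma class_in_over_classes:
  assumes f: "fw_map B P P f"
  shows "fw_class B P P f \<in> over_classes k \<longleftrightarrow>
    fw_self_iso B b0 k P f \<and> fw_homotopic B P Y (b \<circ> f) b"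
  by (simp add: over_classes_def fw_class_in_self_classes[OF b0 f] fw_comp_class[OF f b]
      fw_class_eq_iff[OF fw_map_comp[OF f b] b])

lemma class_in_over_under_classes:
  assumes f: "fw_map B P P f"
  shows "fw_class B P P f \<in> over_under_classes k \<longleftrightarrow>
    fw_class B P P f \<in> over_classes k \<and> fw_homotopic B X P (f \<circ> \<iota>) \<iota>"
  by (simp add: over_under_classes_def fw_comp_class[OF fw_map_\<iota> f]
      fw_class_eq_iff[OF fw_map_comp[OF fw_map_\<iota> f] fw_map_\<iota>])

lemma restrict_class:
  assumes f: "fw_map B P P f"
  shows "restrict_class (fw_class B P P f) = fw_class B X X (a \<circ> f \<circ> \<iota>)"
  by (simp add: restrict_class_def fw_comp_class[OF f a]
      fw_comp_class[OF fw_map_\<iota> fw_map_comp[OF f a]])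

lemma over_classesI:
  assumes "fw_self_iso B b0 k P f" "\<And>z. z \<in> topspace (total P) \<Longrightarrow> b (f z) = b z"
  shows "fw_class B P P f \<in> over_classes k"
proof -
  have f: "fw_map B P P f" using assms(1) by (simp add: fw_self_iso_def)
  have "fw_homotopic B P Y (b \<circ> f) b"
    by (rule fw_homotopic_eq[OF P fw_map_comp[OF f b]]) (simp add: assms(2))
  with assms(1) show ?thesis by (simp add: class_in_over_classes[OF f])
qed

text \<open>The class gives \<open>b \<circ> f\<close> homotopic to \<open>b\<close>. Moving the
  second coordinate of \<open>f\<close> along this homotopy, with the first held fixed, ends at a
  map that preserves \<open>b\<close> exactly; this is possible because the homotopy stays in the
  fibres over \<open>B\<close>.\<close>

lemma over_classesE:
  assumes "c \<in> over_classes k"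
  obtains f where "fw_self_iso B b0 k P f" "fw_map B P P f" "c = fw_class B P P f"
    "\<And>z. z \<in> topspace (total P) \<Longrightarrow> b (f z) = b z"
proof -
  have "c \<in> self_classes B b0 k P" using assms by (simp add: over_classes_def)
  then obtain f where f: "fw_self_iso B b0 k P f" "fw_map B P P f" "c = fw_class B P P f"
    using b0 by (rule self_classesE)
  have bf: "fw_homotopic B P Y (b \<circ> f) b" using assms class_in_over_classes[OF f(2)] f(3) by simp
  define f' where "f' z = m (a (f z)) (b z)" for z
  have af: "fw_map B P X (a \<circ> f)" by (rule fw_map_comp[OF f(2) a])
  have "fw_homotopic B P P (\<lambda>z. m ((a \<circ> f) z) ((b \<circ> f) z)) (\<lambda>z. m ((a \<circ> f) z) (b z))"
    by (rule fw_homotopic_m[OF P fw_homotopic_refl[OF af] bf])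
  moreover have "fw_homotopic B P P f (\<lambda>z. m ((a \<circ> f) z) ((b \<circ> f) z))"
    by (rule fw_homotopic_eq[OF P f(2)]) (simp add: m_ab fw_map_in_topspace[OF f(2)])
  ultimately have ff': "fw_homotopic B P P f f'"
    unfolding f'_def[abs_def] using fw_homotopic_trans by fastforce
  have "b (f' z) = b z" if z: "z \<in> topspace (total P)" for z
    using fw_map_in_topspace[OF af z] fw_map_in_topspace[OF b z] fw_map_proj[OF af z]
      fw_map_proj[OF b z] by (simp add: f'_def b_m)
  then show ?thesis
    using that[of f'] fw_self_iso_homotopic[OF f(1) ff' b0] fw_homotopic_imp_map[OF ff']
      fw_class_eqI[OF ff'] f(3) by simp
qed

lemma over_classes_comp:
  assumes "c \<in> over_classes k" "d \<in> over_classes k"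
  shows "fw_comp B P P c d \<in> over_classes k"
proof -
  obtain f where f: "fw_self_iso B b0 k P f" "fw_map B P P f" "c = fw_class B P P f"
    "\<And>z. z \<in> topspace (total P) \<Longrightarrow> b (f z) = b z"
    using assms(1) by (rule over_classesE) blast
  obtain g where g: "fw_self_iso B b0 k P g" "fw_map B P P g" "d = fw_class B P P g"
    "\<And>z. z \<in> topspace (total P) \<Longrightarrow> b (g z) = b z"
    using assms(2) by (rule over_classesE) blast
  have "fw_class B P P (f \<circ> g) \<in> over_classes k"
    by (rule over_classesI[OF fw_self_iso_comp[OF g(1) f(1) b0]])
      (simp add: f(4) g(4) fw_map_in_topspace[OF g(2)])
  then show ?thesis by (simp add: f(3) g(3) fw_comp_class[OF g(2) f(2)])
qed

lemma id_in_over_classes: "fw_class B P P id \<in> over_classes k"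
  by (rule over_classesI[OF fw_self_iso_id[OF P b0]]) simp

lemma over_classes_subset: "over_classes k \<subseteq> self_classes B b0 k P"
  by (auto simp: over_classes_def)

lemma over_under_classes_subset: "over_under_classes k \<subseteq> over_classes k"
  by (auto simp: over_under_classes_def)

lemma id_in_over_under_classes: "fw_class B P P id \<in> over_under_classes k"
  by (simp add: class_in_over_under_classes[OF fw_map_id] id_in_over_classes
      fw_homotopic_refl[OF fw_map_\<iota>])

lemma over_under_classes_comp:
  assumes "c \<in> over_under_classes k" "d \<in> over_under_classes k"
  shows "fw_comp B P P c d \<in> over_under_classes k"
proof -
  have cd: "c \<in> over_classes k" "d \<in> over_classes k"
    using assms over_under_classes_subset by auto
  obtain f where f: "fw_map B P P f" "c = fw_class B P P f"
    using cd(1) by (rule over_classesE) blast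
  obtain g where g: "fw_map B P P g" "d = fw_class B P P g"
    using cd(2) by (rule over_classesE) blast
  have "fw_homotopic B X P (g \<circ> \<iota>) \<iota>" "fw_homotopic B X P (f \<circ> \<iota>) \<iota>"
    using assms class_in_over_under_classes f g by auto
  then have "fw_homotopic B X P (f \<circ> (g \<circ> \<iota>)) \<iota>"
    using fw_homotopic_trans[OF fw_homotopic_compose_left] f(1) by metis
  moreover have "fw_class B P P (f \<circ> g) \<in> over_classes k"
    using over_classes_comp[OF cd] by (simp add: f(2) g(2) fw_comp_class[OF g(1) f(1)])
  ultimately have "fw_class B P P (f \<circ> g) \<in> over_under_classes k"
    by (simp add: class_in_over_under_classes[OF fw_map_comp[OF g(1) f(1)]] comp_assoc)
  then show ?thesis by (simp add: f(2) g(2) fw_comp_class[OF g(1) f(1)])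
qed

text \<open>For a strict representative, \<open>f \<circ> \<iota>\<close> equals \<iota> composed
  with the restriction of \<open>f\<close> on X. Composing homotopies with \<iota> gives one
  direction, composing with \<open>a\<close> the other.\<close>

lemma restrict_class_eq_one_iff:
  assumes c: "c \<in> over_classes k"
  shows "restrict_class c = fw_class B X X id \<longleftrightarrow> c \<in> over_under_classes k"
proof -
  obtain f where f: "fw_map B P P f" "c = fw_class B P P f"
    and over: "\<And>z. z \<in> topspace (total P) \<Longrightarrow> b (f z) = b z"
    using c by (rule over_classesE) blast
  have f\<iota>: "fw_map B X P (f \<circ> \<iota>)" by (rule fw_map_comp[OF fw_map_\<iota> f(1)])
  have g: "fw_map B X X (a \<circ> (f \<circ> \<iota>))" by (rule fw_map_comp[OF f\<iota> a])
  have "fw_homotopic B X X (a \<circ> (f \<circ> \<iota>)) id \<longleftrightarrow> fw_homotopic B X P (f \<circ> \<iota>) \<iota>"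
  proof
    assume "fw_homotopic B X X (a \<circ> (f \<circ> \<iota>)) id"
    then have "fw_homotopic B X P (\<iota> \<circ> (a \<circ> (f \<circ> \<iota>))) (\<iota> \<circ> id)"
      by (rule fw_homotopic_compose_left[OF _ fw_map_\<iota>])
    moreover have "fw_homotopic B X P (f \<circ> \<iota>) (\<iota> \<circ> (a \<circ> (f \<circ> \<iota>)))"
      by (rule fw_homotopic_eq[OF X f\<iota>]) (use over_\<iota>[OF f(1) over] in simp)
    ultimately show "fw_homotopic B X P (f \<circ> \<iota>) \<iota>" using fw_homotopic_trans by fastforce
  next
    assume "fw_homotopic B X P (f \<circ> \<iota>) \<iota>"
    then have "fw_homotopic B X X (a \<circ> (f \<circ> \<iota>)) (a \<circ> \<iota>)"
      by (rule fw_homotopic_compose_left[OF _ a])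
    moreover have "fw_homotopic B X X (a \<circ> \<iota>) id"
      by (rule fw_homotopic_eq[OF X fw_map_comp[OF fw_map_\<iota> a]]) (simp add: a_\<iota>)
    ultimately show "fw_homotopic B X X (a \<circ> (f \<circ> \<iota>)) id" by (rule fw_homotopic_trans)
  qed
  then show ?thesis
    using c by (simp add: f(2) restrict_class[OF f(1)] class_in_over_under_classes[OF f(1)]
        fw_class_eq_iff[OF g fw_map_id] comp_assoc)
qed

text \<open>Restriction is multiplicative since the inner map \<open>g\<close> sends the image of
  \<iota> into itself: inserting \<iota> after \<open>a\<close> between \<open>f\<close> and
  \<open>g\<close> changes nothing there.\<close>

lemma restrict_class_comp:
  assumes "c \<in> over_classes k" "d \<in> over_classes k"
  shows "restrict_class (fw_comp B P P c d) = fw_comp B X X (restrict_class c) (restrict_class d)"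
proof -
  obtain f where f: "fw_map B P P f" "c = fw_class B P P f"
    using assms(1) by (rule over_classesE) blast
  obtain g where g: "fw_map B P P g" "d = fw_class B P P g"
    and over: "\<And>z. z \<in> topspace (total P) \<Longrightarrow> b (g z) = b z"
    using assms(2) by (rule over_classesE) blast
  note fg = fw_map_comp[OF g(1) f(1)]
  note af\<iota> = fw_map_comp[OF fw_map_\<iota> fw_map_comp[OF f(1) a]]
    and ag\<iota> = fw_map_comp[OF fw_map_\<iota> fw_map_comp[OF g(1) a]]
    and afg\<iota> = fw_map_comp[OF fw_map_\<iota> fw_map_comp[OF fg a]]
  have "fw_homotopic B X X (a \<circ> (f \<circ> g) \<circ> \<iota>) (a \<circ> f \<circ> \<iota> \<circ> (a \<circ> g \<circ> \<iota>))"
    by (rule fw_homotopic_eq[OF X afg\<iota>]) (use over_\<iota>[OF g(1) over] in simp)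
  then show ?thesis
    unfolding f(2) g(2) fw_comp_class[OF g(1) f(1)] restrict_class[OF fg] restrict_class[OF f(1)]
      restrict_class[OF g(1)] fw_comp_class[OF ag\<iota> af\<iota>]
    by (rule fw_class_eqI)
qed

lemma extend_class:
  assumes g: "fw_map B X X g"
  shows "extend_class (fw_class B X X g) = fw_class B P P (extend g)"
proof -
  have "fw_homotopic B P P (extend g) (extend g')" if "fw_homotopic B X X g g'" for g'
    unfolding extend_def[abs_def]
    using fw_homotopic_m[OF P fw_homotopic_compose_right[OF that a] fw_homotopic_refl[OF b]] by simp
  then show ?thesis
    unfolding extend_class_def fw_class_def
    using fw_homotopic_refl[OF g] fw_homotopic_trans by blast
qed

lemma extend_comp:
  assumes g: "fw_map B X X g" and h: "fw_map B X X h"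
  shows "fw_homotopic B P P (extend (g \<circ> h)) (extend g \<circ> extend h)"
proof (rule fw_homotopic_eq[OF P fw_map_extend[OF fw_map_comp[OF h g]]])
  fix z assume "z \<in> topspace (total P)"
  then show "extend (g \<circ> h) z = (extend g \<circ> extend h) z"
    using a_extend[OF h] b_extend[OF h] by (simp add: extend_def[of g] extend_def[of "g \<circ> h"])
qed

lemma restrict_extend:
  assumes g: "fw_map B X X g"
  shows "fw_homotopic B X X (a \<circ> extend g \<circ> \<iota>) g"
  by (rule fw_homotopic_sym[OF fw_homotopic_eq[OF X g]])
    (simp add: a_extend[OF g] a_\<iota> fw_map_in_topspace[OF fw_map_\<iota>])

lemma fw_self_iso_restrict:
  assumes lift: "\<And>n. homotopy_lifting (cube n) (total X) B (proj X)"
    and f: "fw_self_iso B b0 k P f" and over: "\<And>z. z \<in> topspace (total P) \<Longrightarrow> b (f z) = b z"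
  shows "fw_self_iso B b0 k X (a \<circ> f \<circ> \<iota>)"
proof -
  have f': "fw_map B P P f" using f by (simp add: fw_self_iso_def)
  have "induces_iso i (total X) (sect X b0) (total X) (sect X b0) (a \<circ> f \<circ> \<iota>)" if "i \<le> k" for i
    using f that by (intro induces_iso_restrict[OF lift f' over]) (auto simp: fw_self_iso_def)
  then show ?thesis
    using fw_map_comp[OF fw_map_\<iota> fw_map_comp[OF f' a]] by (simp add: fw_self_iso_def)
qed

text \<open>Lifting to X makes the restriction land in the self-maps that are isomorphisms on
  homotopy groups; lifting to Y and path connectedness do the same for the extension. Surjectivity
  of the restriction then follows from the splitting.\<close>

theorem split_exact_over_classes:
  assumes liftX: "\<And>n. homotopy_lifting (cube n) (total X) B (proj X)"
    and liftY: "\<And>n. homotopy_lifting (cube n) (total Y) B (proj Y)"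
    and pcX: "path_connected_space (total X)"
    and pcY: "path_connected_space (subtopology (total Y) {y \<in> topspace (total Y). proj Y y = b0})"
  shows "split_exact
    ((self_monoid B b0 k P)\<lparr>carrier := over_under_classes k\<rparr>) (\<lambda>f. f)
    ((self_monoid B b0 k P)\<lparr>carrier := over_classes k\<rparr>) restrict_class (self_monoid B b0 k X)"
    (is "split_exact ?K _ ?M _ ?N")
proof -
  have simps: "carrier ?K = over_under_classes k" "carrier ?M = over_classes k"
    "carrier ?N = self_classes B b0 k X" "\<And>c d. c \<otimes>\<^bsub>?K\<^esub> d = fw_comp B P P c d"
    "\<And>c d. c \<otimes>\<^bsub>?M\<^esub> d = fw_comp B P P c d" "\<And>c d. c \<otimes>\<^bsub>?N\<^esub> d = fw_comp B X X c d"
    "\<one>\<^bsub>?K\<^esub> = fw_class B P P id" "\<one>\<^bsub>?M\<^esub> = fw_class B P P id" "\<one>\<^bsub>?N\<^esub> = fw_class B X X id"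
    by (simp_all add: self_monoid_def)
  have monK: "monoid ?K"
    using over_under_classes_subset over_classes_subset
    by (intro submonoid_self_monoid[OF P b0] id_in_over_under_classes over_under_classes_comp) auto
  have monM: "monoid ?M"
    by (intro submonoid_self_monoid[OF P b0] id_in_over_classes over_classes_comp over_classes_subset)
  have monN: "monoid ?N" by (rule monoid_self_monoid[OF X b0])
  have j: "(\<lambda>f. f) \<in> monoid_homs ?K ?M"
    using over_under_classes_subset by (auto simp: monoid_homs_def hom_def simps)
  have ker: "(\<lambda>f. f) ` carrier ?K = {c \<in> carrier ?M. restrict_class c = \<one>\<^bsub>?N\<^esub>}"
    unfolding simps image_ident using over_under_classes_subset restrict_class_eq_one_iff by blast
  have into: "restrict_class c \<in> self_classes B b0 k X" if c: "c \<in> over_classes k" for c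
  proof -
    obtain f where f: "fw_self_iso B b0 k P f" "fw_map B P P f" "c = fw_class B P P f"
      "\<And>z. z \<in> topspace (total P) \<Longrightarrow> b (f z) = b z"
      using c by (rule over_classesE) blast
    have "fw_self_iso B b0 k X (a \<circ> f \<circ> \<iota>)" by (rule fw_self_iso_restrict[OF liftX f(1,4)])
    then show ?thesis
      using fw_class_in_self_classes[OF b0, of X "a \<circ> f \<circ> \<iota>"]
      by (simp add: f(3) restrict_class[OF f(2)] fw_self_iso_def)
  qed
  have "restrict_class (fw_class B P P id) = fw_class B X X id"
    using restrict_class_eq_one_iff[OF id_in_over_classes] id_in_over_under_classes by blast
  then have \<phi>: "restrict_class \<in> monoid_homs ?M ?N"
    unfolding monoid_homs_def hom_def simps using into restrict_class_comp by (simp add: Pi_iff)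
  have ext: "extend_class c \<in> over_classes k" "restrict_class (extend_class c) = c"
    if c: "c \<in> self_classes B b0 k X" for c
  proof -
    obtain g where g: "fw_self_iso B b0 k X g" "fw_map B X X g" "c = fw_class B X X g"
      using c b0 by (rule self_classesE)
    have "fw_self_iso B b0 k P (extend g)"
      using g(1) induces_iso_extend[OF liftY pcX pcY g(2)] fw_map_extend[OF g(2)]
      by (simp add: fw_self_iso_def)
    then show "extend_class c \<in> over_classes k"
      using over_classesI b_extend[OF g(2)] by (simp add: g(3) extend_class[OF g(2)])
    show "restrict_class (extend_class c) = c"
      by (simp add: g(3) extend_class[OF g(2)] restrict_class[OF fw_map_extend[OF g(2)]]
          fw_class_eqI[OF restrict_extend[OF g(2)]])
  qed
  have "extend_class (fw_comp B X X c d) = fw_comp B P P (extend_class c) (extend_class d)"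
    if c: "c \<in> self_classes B b0 k X" and d: "d \<in> self_classes B b0 k X" for c d
  proof -
    obtain g where g: "fw_map B X X g" "c = fw_class B X X g" using c b0 by (rule self_classesE) blast
    obtain h where h: "fw_map B X X h" "d = fw_class B X X h" using d b0 by (rule self_classesE) blast
    show ?thesis
      unfolding g(2) h(2) fw_comp_class[OF h(1) g(1)] extend_class[OF g(1)] extend_class[OF h(1)]
        extend_class[OF fw_map_comp[OF h(1) g(1)]]
        fw_comp_class[OF fw_map_extend[OF h(1)] fw_map_extend[OF g(1)]]
      by (rule fw_class_eqI[OF extend_comp[OF g(1) h(1)]])
  qed
  moreover have "extend_class (fw_class B X X id) = fw_class B P P id"
  proof -
    have "fw_homotopic B P P id (extend id)"
      by (rule fw_homotopic_eq[OF P fw_map_id]) (simp add: extend_def m_ab)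
    then show ?thesis
      unfolding extend_class[OF fw_map_id] by (rule fw_class_eqI[symmetric])
  qed
  ultimately have \<psi>: "extend_class \<in> monoid_homs ?N ?M"
    unfolding monoid_homs_def hom_def simps using ext by (simp add: Pi_iff)
  have "restrict_class ` carrier ?M = carrier ?N"
    using into ext by (force simp: simps)
  then show ?thesis
    unfolding split_exact_def
    by (intro conjI monK monM monN j ker \<phi> inj_on_id2 bexI[OF _ \<psi>]) (simp_all add: simps(3) ext(2))
qed

end


subsection \<open>The fibred product of two spaces\<close>

lemma topspace_fprod:
  "topspace (total (fprod X Y)) =
    {(x, y). x \<in> topspace (total X) \<and> y \<in> topspace (total Y) \<and> proj X x = proj Y y}"
  by (auto simp: fprod_def)

lemma fprod_sel:
  "proj (fprod X Y) = (\<lambda>(x, y). proj X x)" "sect (fprod X Y) = (\<lambda>b. (sect X b, sect Y b))"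
  by (simp_all add: fprod_def)

lemma fw_product_fprod:
  assumes b0: "b0 \<in> topspace B" and X: "fw_pointed_space B X" and Y: "fw_pointed_space B Y"
  shows "fw_product B b0 X Y (fprod X Y) fst snd Pair"
proof
  have fst: "continuous_map (total (fprod X Y)) (total X) fst"
    and snd: "continuous_map (total (fprod X Y)) (total Y) snd"
    by (auto simp: fprod_def intro: continuous_map_from_subtopology continuous_map_fst continuous_map_snd)
  have "continuous_map (total (fprod X Y)) B (proj X \<circ> fst)"
    using fst X by (auto simp: fw_pointed_space_def intro: continuous_map_compose)
  moreover have "continuous_map B (total (fprod X Y)) (\<lambda>b. (sect X b, sect Y b))"
    using X Y by (auto simp: fprod_def continuous_map_in_subtopology fw_pointed_space_def
        intro: continuous_map_pairedI)
  ultimately show "fw_pointed_space B (fprod X Y)"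
    using X by (auto simp: fw_pointed_space_def fprod_sel case_prod_unfold o_def)
  show "fw_map B (fprod X Y) X fst" "fw_map B (fprod X Y) Y snd"
    using fst snd by (auto simp: fw_map_def fprod_sel topspace_fprod)
  show "continuous_map (total (fprod X Y)) (total (fprod X Y)) (\<lambda>(x, y). (x, y))"
    by (simp add: case_prod_unfold flip: id_def)
qed (use b0 X Y in simp_all)

lemma CW_fw_spaceD:
  assumes "CW_fw_space T B b0 X"
  shows "fw_pointed_space B X" "homotopy_lifting Z (total X) B (proj X)"
    "path_connected_space (total X)"
    "path_connected_space (subtopology (total X) {x \<in> topspace (total X). proj X x = b0})"
  using assms fibration_homotopy_lifting path_connected_space_CW_homotopy_type
  unfolding CW_fw_space_def by blast+

text \<open>Both sequences are the one sequence of a presented product, read with X or with Y as the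
  distinguished factor.\<close>

lemma split_exact_fprod:
  assumes b0: "b0 \<in> topspace B" and X: "CW_fw_space T B b0 X" and Y: "CW_fw_space T B b0 Y"
  shows "split_exact
      ((self_monoid B b0 k (fprod X Y))\<lparr>carrier := self_over_Y_under_X B b0 k X Y\<rparr>) (\<lambda>f. f)
      ((self_monoid B b0 k (fprod X Y))\<lparr>carrier := self_over_Y B b0 k X Y\<rparr>) (phiX B X Y)
      (self_monoid B b0 k X)"
    and "split_exact
      ((self_monoid B b0 k (fprod X Y))\<lparr>carrier := self_over_X_under_Y B b0 k X Y\<rparr>) (\<lambda>f. f)
      ((self_monoid B b0 k (fprod X Y))\<lparr>carrier := self_over_X B b0 k X Y\<rparr>) (phiY B X Y)
      (self_monoid B b0 k Y)"
proof -
  note XD = CW_fw_spaceD[OF X] and YD = CW_fw_spaceD[OF Y]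
  interpret XY: fw_product B b0 X Y "fprod X Y" fst snd Pair
    by (rule fw_product_fprod[OF b0 XD(1) YD(1)])
  interpret YX: fw_product B b0 Y X "fprod X Y" snd fst "\<lambda>y x. (x, y)"
    by (rule XY.swap)
  have eqX: "XY.over_classes k = self_over_Y B b0 k X Y"
    "XY.over_under_classes k = self_over_Y_under_X B b0 k X Y" "XY.restrict_class = phiX B X Y"
    by (simp_all add: fun_eq_iff XY.over_classes_def self_over_Y_def compY_def prY_def
        XY.over_under_classes_def self_over_Y_under_X_def inX_def XY.\<iota>_def[abs_def]
        XY.restrict_class_def phiX_def compX_def prX_def)
  have eqY: "YX.over_classes k = self_over_X B b0 k X Y"
    "YX.over_under_classes k = self_over_X_under_Y B b0 k X Y" "YX.restrict_class = phiY B X Y"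
    by (simp_all add: fun_eq_iff YX.over_classes_def self_over_X_def compX_def prX_def
        YX.over_under_classes_def self_over_X_under_Y_def inY_def YX.\<iota>_def[abs_def]
        YX.restrict_class_def phiY_def compY_def prY_def)
  show "split_exact
      ((self_monoid B b0 k (fprod X Y))\<lparr>carrier := self_over_Y_under_X B b0 k X Y\<rparr>) (\<lambda>f. f)
      ((self_monoid B b0 k (fprod X Y))\<lparr>carrier := self_over_Y B b0 k X Y\<rparr>) (phiX B X Y)
      (self_monoid B b0 k X)"
    using XY.split_exact_over_classes[OF XD(2) YD(2) XD(3) YD(4), of k] by (simp only: eqX)
  show "split_exact
      ((self_monoid B b0 k (fprod X Y))\<lparr>carrier := self_over_X_under_Y B b0 k X Y\<rparr>) (\<lambda>f. f)
      ((self_monoid B b0 k (fprod X Y))\<lparr>carrier := self_over_X B b0 k X Y\<rparr>) (phiY B X Y)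
      (self_monoid B b0 k Y)"
    using YX.split_exact_over_classes[OF YD(2) XD(2) YD(3) XD(4), of k] by (simp only: eqY)
qed

section \<open>Factorisation of self-maps of a product of two spaces\<close>

lemma self_classes_fprod_eq:
  assumes b0: "b0 \<in> topspace B" and X: "fw_pointed_space B X" and Y: "fw_pointed_space B Y"
    and red: "\<And>f. f \<in> self_classes B b0 k (fprod X Y) \<Longrightarrow> k_reducible B b0 k X Y f"
    and fac: "\<And>f. f \<in> self_classes B b0 k (fprod X Y) \<Longrightarrow> compY B X Y f =
      fw_comp B (fprod X Y) Y (fw_comp B Y Y (compY B X Y f) (inY B X Y)) (prY B X Y)"
  shows "self_classes B b0 k (fprod X Y) =
    self_over_X B b0 k X Y <#>\<^bsub>self_monoid B b0 k (fprod X Y)\<^esub> self_over_Y B b0 k X Y"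
proof (intro equalityI subsetI)
  let ?P = "fprod X Y"
  interpret XY: fw_product B b0 X Y ?P fst snd Pair
    by (rule fw_product_fprod[OF b0 X Y])
  interpret YX: fw_product B b0 Y X ?P snd fst "\<lambda>y x. (x, y)"
    by (rule XY.swap)
  {
    fix c assume "c \<in> self_over_X B b0 k X Y <#>\<^bsub>self_monoid B b0 k ?P\<^esub> self_over_Y B b0 k X Y"
    then show "c \<in> self_classes B b0 k ?P"
      using fw_comp_classes_mem[OF _ _ b0, of _ k ?P]
      by (auto simp: set_mult_def self_monoid_def self_over_X_def self_over_Y_def)
  next
    \<comment> \<open>Pairing of classes is pairing of representatives. This turns reducibility into
      a statement about the maps \<open>u\<close> and \<open>v\<close> below.\<close>
    have pair: "fw_pair B X Y (fw_class B ?P X u) (fw_class B ?P Y v) = fw_class B ?P ?P (\<lambda>z. (u z, v z))"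
      if u: "fw_map B ?P X u" and v: "fw_map B ?P Y v" for u v
      unfolding fw_pair_def fw_class_def
      using fw_homotopic_refl[OF u] fw_homotopic_refl[OF v]
        fw_homotopic_trans[OF XY.fw_homotopic_m[OF XY.P]] by (auto; metis)
    fix c assume c: "c \<in> self_classes B b0 k ?P"
    then obtain f where f: "fw_self_iso B b0 k ?P f" "fw_map B ?P ?P f" "c = fw_class B ?P ?P f"
      using b0 by (rule self_classesE)
    note fX = fw_map_comp[OF f(2) XY.a] and fY = fw_map_comp[OF f(2) XY.b]
    have comp: "compX B X Y c = fw_class B ?P X (fst \<circ> f)" "compY B X Y c = fw_class B ?P Y (snd \<circ> f)"
      by (simp_all add: f(3) compX_def compY_def prX_def prY_def fw_comp_class[OF f(2) XY.a]
          fw_comp_class[OF f(2) XY.b])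
    define u where "u z = (fst z, (snd \<circ> f) z)" for z
    define v where "v z = ((fst \<circ> f) z, snd z)" for z
    have u: "fw_map B ?P ?P u" and v: "fw_map B ?P ?P v"
      unfolding u_def[abs_def] v_def[abs_def]
      by (rule XY.fw_map_m[OF XY.a fY], rule XY.fw_map_m[OF fX XY.b])
    have "fw_class B ?P ?P u \<in> self_classes B b0 k ?P" "fw_class B ?P ?P v \<in> self_classes B b0 k ?P"
      using red[OF c] unfolding k_reducible_def comp prX_def prY_def
      by (simp_all only: pair[OF XY.a fY] pair[OF fX XY.b] u_def[abs_def] v_def[abs_def])
    moreover have "fst \<circ> u = fst" "snd \<circ> v = snd" by (simp_all add: fun_eq_iff u_def v_def)
    ultimately have uv: "fw_class B ?P ?P u \<in> self_over_X B b0 k X Y"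
      "fw_class B ?P ?P v \<in> self_over_Y B b0 k X Y"
      by (simp_all only: self_over_X_def self_over_Y_def compX_def compY_def prX_def prY_def
          fw_comp_class[OF u XY.a] fw_comp_class[OF v XY.b] mem_Collect_eq simp_thms)
    note iY = YX.fw_map_\<iota>
    note fYi = fw_map_comp[OF iY fY]
    have "fw_class B ?P Y (snd \<circ> f) = fw_class B ?P Y (snd \<circ> f \<circ> YX.\<iota> \<circ> snd)"
      using fac[OF c] unfolding comp prY_def inY_def YX.\<iota>_def[abs_def, symmetric]
      by (simp only: fw_comp_class[OF iY fY] fw_comp_class[OF XY.b fYi])
    then have fac': "fw_homotopic B ?P Y (snd \<circ> f) (snd \<circ> f \<circ> YX.\<iota> \<circ> snd)"
      using fw_class_eq_iff[OF fY fw_map_comp[OF XY.b fYi]] by simp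
    \<comment> \<open>Up to homotopy the second coordinate of \<open>f\<close> depends only on the
      second coordinate of its argument, and \<open>v\<close> leaves that unchanged. So applying
      \<open>v\<close> before \<open>u\<close> still produces the second coordinate of
      \<open>f\<close>.\<close>
    have "fw_homotopic B ?P Y (snd \<circ> f \<circ> v) (snd \<circ> f \<circ> YX.\<iota> \<circ> snd \<circ> v)"
      by (rule fw_homotopic_compose_right[OF fac' v])
    moreover have "snd \<circ> f \<circ> YX.\<iota> \<circ> snd \<circ> v = snd \<circ> f \<circ> YX.\<iota> \<circ> snd"
      by (simp add: fun_eq_iff v_def)
    ultimately have "fw_homotopic B ?P Y (snd \<circ> f \<circ> v) (snd \<circ> f)"
      using fw_homotopic_trans[OF _ fw_homotopic_sym[OF fac']] by simp
    from XY.fw_homotopic_m[OF XY.P fw_homotopic_refl[OF fX] this]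
    have "fw_homotopic B ?P ?P (u \<circ> v) f" by (simp add: u_def[abs_def] v_def o_def)
    then have "c = fw_comp B ?P ?P (fw_class B ?P ?P u) (fw_class B ?P ?P v)"
      unfolding fw_comp_class[OF v u] f(3) by (rule fw_class_eqI[symmetric])
    with uv show "c \<in> self_over_X B b0 k X Y <#>\<^bsub>self_monoid B b0 k ?P\<^esub> self_over_Y B b0 k X Y"
      by (auto simp: set_mult_def self_monoid_def)
  }
qed

subsection \<open>Fibred products of finite families\<close>

lemma topspace_fprods:
  "z \<in> topspace (total (fprods n X)) \<longleftrightarrow> z \<in> extensional {1..n} \<and>
    (\<forall>i \<in> {1..n}. z i \<in> topspace (total (X i))) \<and>
    (\<forall>i \<in> {1..n}. proj (X i) (z i) = proj (fprods n X) z)"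
proof -
  have "(\<forall>i \<in> {1..n}. \<forall>j \<in> {1..n}. proj (X i) (z i) = proj (X j) (z j)) \<longleftrightarrow>
      (\<forall>i \<in> {1..n}. proj (X i) (z i) = proj (X 1) (z 1))"
  proof (intro iffI ballI)
    fix i assume all: "\<forall>i \<in> {1..n}. \<forall>j \<in> {1..n}. proj (X i) (z i) = proj (X j) (z j)" and i: "i \<in> {1..n}"
    have "1 \<in> {1..n}" using i by simp
    then show "proj (X i) (z i) = proj (X 1) (z 1)" by (rule all[rule_format, OF i])
  next
    fix i j assume all: "\<forall>i \<in> {1..n}. proj (X i) (z i) = proj (X 1) (z 1)"
      and i: "i \<in> {1..n}" and j: "j \<in> {1..n}"
    show "proj (X i) (z i) = proj (X j) (z j)"
      by (rule trans[OF all[rule_format, OF i] all[rule_format, OF j, symmetric]])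
  qed
  then show ?thesis
    unfolding fprods_def fw_space.simps topspace_subtopology topspace_product_topology PiE_iff
      Int_iff mem_Collect_eq by blast
qed

lemma continuous_map_into_fprods:
  assumes "\<And>z. z \<in> topspace Z \<Longrightarrow> f z \<in> extensional {1..n}"
    and "\<And>i. i \<in> {1..n} \<Longrightarrow> continuous_map Z (total (X i)) (\<lambda>z. f z i)"
    and "\<And>z i j. z \<in> topspace Z \<Longrightarrow> i \<in> {1..n} \<Longrightarrow> j \<in> {1..n} \<Longrightarrow>
      proj (X i) (f z i) = proj (X j) (f z j)"
  shows "continuous_map Z (total (fprods n X)) f"
  unfolding fprods_def fw_space.simps continuous_map_in_subtopology continuous_map_componentwise
proof (intro conjI ballI image_subsetI funcsetI CollectI)
qed (rule assms; assumption)+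

text \<open>
  \<open>rest i\<close> is the fibred product of all factors but the \<open>i\<close>-th, realised inside the full product
  by letting the \<open>i\<close>-th coordinate run through the section; thus it is \<open>B\<close> if there is only one factor.
\<close>

locale fw_family =
  fixes B :: "'b topology" and b0 :: 'b and n :: nat and X :: "nat \<Rightarrow> ('b, 'x) fw_space"
  assumes b0: "b0 \<in> topspace B" and n: "1 \<le> n"
    and X: "\<And>i. i \<in> {1..n} \<Longrightarrow> fw_pointed_space B (X i)"
begin

abbreviation "PX \<equiv> fprods n X"

text \<open>This plays the role of the projection that forgets coordinate \<open>i\<close>: the
  coordinate is reset to the section instead of being removed, so the values remain functions on the
  same index set.\<close>

definition fill :: "nat \<Rightarrow> (nat \<Rightarrow> 'x) \<Rightarrow> nat \<Rightarrow> 'x" where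
  "fill i z = z(i := sect (X i) (proj PX z))"

definition rest :: "nat \<Rightarrow> ('b, nat \<Rightarrow> 'x) fw_space" where
  "rest i = \<lparr>total = subtopology (total PX) {z. z i = sect (X i) (proj PX z)},
     proj = proj PX, sect = sect PX\<rparr>"

lemma proj_coord: "z \<in> topspace (total PX) \<Longrightarrow> i \<in> {1..n} \<Longrightarrow> proj (X i) (z i) = proj PX z"
  by (simp add: topspace_fprods)

lemma sect_PX: "sect PX \<beta> = (\<lambda>i\<in>{1..n}. sect (X i) \<beta>)"
  by (simp add: fprods_def)

lemma proj_PX: "proj PX z = proj (X 1) (z 1)"
  by (simp add: fprods_def)

lemma continuous_map_coord: "i \<in> {1..n} \<Longrightarrow> continuous_map (total PX) (total (X i)) (\<lambda>z. z i)"
  unfolding fprods_def fw_space.simps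
  by (intro continuous_map_from_subtopology continuous_map_product_projection)

lemma X_sect:
  assumes "i \<in> {1..n}" "\<beta> \<in> topspace B"
  shows "sect (X i) \<beta> \<in> topspace (total (X i))" "proj (X i) (sect (X i) \<beta>) = \<beta>"
  using fw_pointed_sect[OF X[OF assms(1)] assms(2)] X[OF assms(1)] assms(2)
  by (auto simp: fw_pointed_space_def)

lemma proj_PX_in_base: "z \<in> topspace (total PX) \<Longrightarrow> proj PX z \<in> topspace B"
proof -
  assume z: "z \<in> topspace (total PX)"
  have "continuous_map (total (X 1)) B (proj (X 1))" using X[of 1] n by (simp add: fw_pointed_space_def)
  moreover have "z 1 \<in> topspace (total (X 1))" using z n by (simp add: topspace_fprods)
  ultimately show "proj PX z \<in> topspace B"
    unfolding proj_PX by (rule funcset_mem[OF continuous_map_funspace])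
qed

lemma pointed_PX: "fw_pointed_space B PX"
proof -
  have "continuous_map (total PX) B (proj (X 1) \<circ> (\<lambda>z. z 1))"
    using n X[of 1] continuous_map_compose[OF continuous_map_coord[of 1], of B "proj (X 1)"]
    by (simp add: fw_pointed_space_def)
  moreover have "proj PX = proj (X 1) \<circ> (\<lambda>z. z 1)" by (simp add: fun_eq_iff proj_PX)
  moreover have "continuous_map B (total PX) (sect PX)"
  proof (rule continuous_map_into_fprods)
    fix i assume i: "i \<in> {1..n}"
    have "continuous_map B (total (X i)) (sect (X i))" using X[OF i] by (simp add: fw_pointed_space_def)
    then show "continuous_map B (total (X i)) (\<lambda>z. sect PX z i)" using i by (simp add: sect_PX eta_contract_eq)
  qed (auto simp: sect_PX X_sect)
  moreover have "proj PX (sect PX \<beta>) = \<beta>" if "\<beta> \<in> topspace B" for \<beta>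
    using X_sect(2)[of 1 \<beta>] n that by (simp add: proj_PX sect_PX)
  ultimately show ?thesis by (simp add: fw_pointed_space_def)
qed

lemma fw_map_coord: "i \<in> {1..n} \<Longrightarrow> fw_map B PX (X i) (\<lambda>z. z i)"
  by (simp add: fw_map_def continuous_map_coord proj_coord sect_PX)

lemma fw_map_tuple:
  assumes f: "\<And>i. i \<in> {1..n} \<Longrightarrow> fw_map B Z (X i) (f i)"
  shows "fw_map B Z PX (\<lambda>z. \<lambda>i\<in>{1..n}. f i z)"
proof -
  have "continuous_map (total Z) (total PX) (\<lambda>z. \<lambda>i\<in>{1..n}. f i z)"
  proof (rule continuous_map_into_fprods)
    fix i assume i: "i \<in> {1..n}"
    then show "continuous_map (total Z) (total (X i)) (\<lambda>z. (\<lambda>i\<in>{1..n}. f i z) i)"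
      using fw_map_continuous[OF f[OF i]] by (simp add: eta_contract_eq)
  next
    fix z i j assume z: "z \<in> topspace (total Z)" and i: "i \<in> {1..n}" and j: "j \<in> {1..n}"
    show "proj (X i) ((\<lambda>i\<in>{1..n}. f i z) i) = proj (X j) ((\<lambda>i\<in>{1..n}. f i z) j)"
      using fw_map_proj[OF f[OF i] z] fw_map_proj[OF f[OF j] z] i j by simp
  qed simp
  moreover have "proj PX (\<lambda>i\<in>{1..n}. f i z) = proj Z z" if "z \<in> topspace (total Z)" for z
    using n fw_map_proj[OF f[of 1] that] by (simp add: proj_PX)
  moreover have "(\<lambda>i\<in>{1..n}. f i (sect Z \<beta>)) = sect PX \<beta>" if "\<beta> \<in> topspace B" for \<beta>
    using fw_map_sect[OF f that] by (auto simp: sect_PX)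
  ultimately show ?thesis by (simp add: fw_map_def[of B Z PX])
qed

lemma fw_homotopic_tuple:
  assumes Z: "fw_pointed_space B Z"
    and fg: "\<And>i. i \<in> {1..n} \<Longrightarrow> fw_homotopic B Z (X i) (f i) (g i)"
  shows "fw_homotopic B Z PX (\<lambda>z. \<lambda>i\<in>{1..n}. f i z) (\<lambda>z. \<lambda>i\<in>{1..n}. g i z)"
proof -
  have "\<exists>h. continuous_map (prod_topology (top_of_set {0..1::real}) (total Z)) (total (X i)) h \<and>
      (\<forall>z. h (0, z) = f i z) \<and> (\<forall>z. h (1, z) = g i z) \<and>
      (\<forall>t. 0 \<le> t \<longrightarrow> t \<le> 1 \<longrightarrow> fw_map B Z (X i) (\<lambda>z. h (t, z)))" if "i \<in> {1..n}" for i
    using fg[OF that] by (rule fw_homotopicE) blast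
  then obtain h where
    h: "\<And>i. i \<in> {1..n} \<Longrightarrow> continuous_map (prod_topology (top_of_set {0..1::real}) (total Z)) (total (X i)) (h i)"
    and h01: "\<And>i z. i \<in> {1..n} \<Longrightarrow> h i (0, z) = f i z" "\<And>i z. i \<in> {1..n} \<Longrightarrow> h i (1, z) = g i z"
    and hm: "\<And>i t. i \<in> {1..n} \<Longrightarrow> 0 \<le> t \<Longrightarrow> t \<le> 1 \<Longrightarrow> fw_map B Z (X i) (\<lambda>z. h i (t, z))"
    by metis
  have "continuous_map (prod_topology (top_of_set {0..1::real}) (total Z)) (total PX)
      (\<lambda>z. \<lambda>i\<in>{1..n}. h i z)"
  proof (rule continuous_map_into_fprods)
    fix z i j assume z: "z \<in> topspace (prod_topology (top_of_set {0..1::real}) (total Z))"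
      and i: "i \<in> {1..n}" and j: "j \<in> {1..n}"
    obtain t x where tx: "z = (t, x)" by (cases z)
    with z have t: "0 \<le> t" "t \<le> 1" and x: "x \<in> topspace (total Z)" by auto
    show "proj (X i) ((\<lambda>i\<in>{1..n}. h i z) i) = proj (X j) ((\<lambda>i\<in>{1..n}. h i z) j)"
      using fw_map_proj[OF hm[OF i t] x] fw_map_proj[OF hm[OF j t] x] i j by (simp add: tx)
  next
    fix i assume "i \<in> {1..n}"
    then show "continuous_map (prod_topology (top_of_set {0..1::real}) (total Z)) (total (X i))
        (\<lambda>z. (\<lambda>i\<in>{1..n}. h i z) i)"
      using h by (simp add: eta_contract_eq)
  qed simp
  then show ?thesis
  proof (rule fw_homotopicI[OF Z])
    fix t assume "0 \<le> t" "t \<le> (1::real)"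
    then show "fw_map B Z PX (\<lambda>x. \<lambda>i\<in>{1..n}. h i (t, x))" by (intro fw_map_tuple hm)
  qed (auto simp: h01)
qed

lemma topspace_rest:
  "z \<in> topspace (total (rest i)) \<longleftrightarrow> z \<in> topspace (total PX) \<and> z i = sect (X i) (proj PX z)"
  by (auto simp: rest_def)

lemma rest_sel [simp]: "proj (rest i) = proj PX" "sect (rest i) = sect PX"
  by (simp_all add: rest_def)

lemma fill_in_PX:
  assumes z: "z \<in> topspace (total PX)" and i: "i \<in> {1..n}"
  shows "fill i z \<in> topspace (total PX)" "proj PX (fill i z) = proj PX z"
proof -
  note \<beta> = proj_PX_in_base[OF z]
  \<comment> \<open>\<open>proj PX\<close> is read off at index 1, so \<open>i = 1\<close> is the
    case in which the coordinate that defines the base point is itself overwritten.\<close>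
  show eq: "proj PX (fill i z) = proj PX z"
    using X_sect(2)[OF i \<beta>] proj_coord[OF z, of 1] n
    unfolding fill_def proj_PX[of "z(i := _)"] by (cases "i = 1") simp_all
  show "fill i z \<in> topspace (total PX)"
    using z i X_sect[OF i \<beta>] proj_coord[OF z] eq
    by (auto simp: topspace_fprods fill_def extensional_def)
qed

lemma fw_map_fill:
  assumes i: "i \<in> {1..n}"
  shows "fw_map B PX (rest i) (fill i)"
proof -
  have "continuous_map (total PX) (total PX) (fill i)"
  proof (rule continuous_map_into_fprods)
    fix j assume j: "j \<in> {1..n}"
    have "continuous_map (total PX) (total (X i)) (sect (X i) \<circ> proj PX)"
      using pointed_PX X[OF i] by (auto simp: fw_pointed_space_def intro: continuous_map_compose)
    then show "continuous_map (total PX) (total (X j)) (\<lambda>z. fill i z j)"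
      using continuous_map_coord[OF j] by (cases "j = i") (simp_all add: fill_def o_def)
  next
    fix z assume "z \<in> topspace (total PX)"
    from fill_in_PX[OF this i] show "fill i z \<in> extensional {1..n}" by (simp add: topspace_fprods)
  next
    fix z j l assume "z \<in> topspace (total PX)" "j \<in> {1..n}" "l \<in> {1..n}"
    then show "proj (X j) (fill i z j) = proj (X l) (fill i z l)"
      using fill_in_PX(1)[OF _ i] by (simp add: proj_coord)
  qed
  moreover have "fill i z i = sect (X i) (proj PX (fill i z))" if "z \<in> topspace (total PX)" for z
    using fill_in_PX(2)[OF that i] by (simp add: fill_def)
  ultimately have "continuous_map (total PX) (total (rest i)) (fill i)"
    by (auto simp: rest_def continuous_map_in_subtopology)
  moreover have "fill i (sect PX \<beta>) = sect PX \<beta>" if "\<beta> \<in> topspace B" for \<beta>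
    using i that pointed_PX by (auto simp: fill_def fw_pointed_space_def sect_PX)
  ultimately show ?thesis using fill_in_PX(2)[OF _ i] by (simp add: fw_map_def)
qed

lemma pointed_rest:
  assumes i: "i \<in> {1..n}"
  shows "fw_pointed_space B (rest i)"
proof -
  have "continuous_map B (total (rest i)) (sect PX)"
    using pointed_PX i
    by (auto simp: rest_def continuous_map_in_subtopology fw_pointed_space_def sect_PX)
  then show ?thesis
    using pointed_PX by (auto simp: fw_pointed_space_def rest_def intro: continuous_map_from_subtopology)
qed

lemma fw_product_rest:
  assumes i: "i \<in> {1..n}"
  shows "fw_product B b0 (X i) (rest i) PX (\<lambda>z. z i) (fill i) (\<lambda>x r. r(i := x))"
proof
  show "b0 \<in> topspace B" "fw_pointed_space B (X i)" "fw_pointed_space B (rest i)"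
    "fw_pointed_space B PX" "fw_map B PX (X i) (\<lambda>z. z i)" "fw_map B PX (rest i) (fill i)"
    using b0 X[OF i] pointed_rest[OF i] pointed_PX fw_map_coord[OF i] fw_map_fill[OF i] by simp_all
  have proj: "proj (X j) ((r(i := x)) j) = proj PX r"
    if "r \<in> topspace (total (rest i))" "proj (X i) x = proj PX r" "j \<in> {1..n}" for x r j
    using that proj_coord by (auto simp: topspace_rest)
  show "continuous_map (total (fprod (X i) (rest i))) (total PX) (\<lambda>(x, r). r(i := x))"
  proof (rule continuous_map_into_fprods)
    fix j assume j: "j \<in> {1..n}"
    have "continuous_map (total (fprod (X i) (rest i))) (total (X j)) (\<lambda>z. snd z j)"
      unfolding fprod_def fw_space.simps
      using continuous_map_compose[OF continuous_map_snd
          continuous_map_from_subtopology[OF continuous_map_coord[OF j], of "{z. z i = sect (X i) (proj PX z)}"]]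
      by (intro continuous_map_from_subtopology) (simp add: rest_def o_def)
    moreover have "continuous_map (total (fprod (X i) (rest i))) (total (X i)) fst"
      unfolding fprod_def fw_space.simps
      by (intro continuous_map_from_subtopology continuous_map_fst)
    ultimately show "continuous_map (total (fprod (X i) (rest i))) (total (X j))
        (\<lambda>z. (case z of (x, r) \<Rightarrow> r(i := x)) j)"
      by (cases "j = i") (simp_all add: case_prod_unfold)
  next
    fix z assume "z \<in> topspace (total (fprod (X i) (rest i)))"
    then show "(case z of (x, r) \<Rightarrow> r(i := x)) \<in> extensional {1..n}"
      using i by (auto simp: topspace_fprod topspace_rest topspace_fprods extensional_def)
  next
    fix z j l assume "z \<in> topspace (total (fprod (X i) (rest i)))" "j \<in> {1..n}" "l \<in> {1..n}"
    then show "proj (X j) ((case z of (x, r) \<Rightarrow> r(i := x)) j)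
        = proj (X l) ((case z of (x, r) \<Rightarrow> r(i := x)) l)"
      using proj by (auto simp: topspace_fprod case_prod_unfold)
  qed
  fix x r assume x: "x \<in> topspace (total (X i))" and r: "r \<in> topspace (total (rest i))"
    and xr: "proj (X i) x = proj (rest i) r"
  show "(r(i := x)) i = x" by simp
  \<comment> \<open>The base point survives the insertion of \<open>x\<close> even for
    \<open>i = 1\<close>, as \<open>x\<close> lies over the same point as \<open>r\<close>; hence
    \<open>fill\<close> restores the section value that \<open>r\<close> had at
    \<open>i\<close>.\<close>
  have "proj PX (r(i := x)) = proj PX r"
    using proj[OF r, of x 1] xr n by (simp only: proj_PX[of "r(i := x)"] rest_sel) simp
  then show "fill i (r(i := x)) = r"
    using r by (auto simp: fill_def topspace_rest)
next
  fix z assume "z \<in> topspace (total PX)"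
  show "(fill i z)(i := z i) = z" by (simp add: fill_def)
qed

text \<open>Each coordinate is lifted separately. All lifts lie over the same homotopy
  \<open>H\<close>, so together they form a map into the fibred product; coordinate \<open>i\<close>
  has no freedom and must follow the section along \<open>H\<close>.\<close>

lemma homotopy_lifting_rest:
  assumes i: "i \<in> {1..n}"
    and lift: "\<And>j. j \<in> {1..n} \<Longrightarrow> homotopy_lifting Z (total (X j)) B (proj (X j))"
  shows "homotopy_lifting Z (total (rest i)) B (proj (rest i))"
  unfolding homotopy_lifting_def
proof (intro allI impI, elim conjE)
  let ?C = "prod_topology (top_of_set {0..1::real}) Z"
  fix f H assume f: "continuous_map Z (total (rest i)) f" and H: "continuous_map ?C B H"
    and H0: "\<forall>z \<in> topspace Z. H (0, z) = proj (rest i) (f z)"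
  have f': "continuous_map Z (total PX) f" using f by (simp add: rest_def continuous_map_in_subtopology)
  have f_in: "f z \<in> topspace (total (rest i))" if "z \<in> topspace Z" for z
    using continuous_map_image_subset_topspace[OF f] that by auto
  have "\<exists>G. continuous_map ?C (total (X j)) G \<and> (\<forall>z \<in> topspace Z. G (0, z) = f z j) \<and>
      (\<forall>t \<in> {0..1}. \<forall>z \<in> topspace Z. proj (X j) (G (t, z)) = H (t, z))" if j: "j \<in> {1..n}" for j
  proof -
    have "continuous_map Z (total (X j)) (\<lambda>z. f z j)"
      using continuous_map_compose[OF f' continuous_map_coord[OF j]] by (simp add: o_def)
    moreover have "\<forall>z \<in> topspace Z. H (0, z) = proj (X j) (f z j)"
      using H0 f_in proj_coord[OF _ j] by (auto simp: topspace_rest)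
    ultimately show ?thesis
      by (intro lift[OF j, unfolded homotopy_lifting_def, THEN spec, THEN spec, THEN mp] conjI H)
  qed
  then obtain G where G: "\<And>j. j \<in> {1..n} \<Longrightarrow> continuous_map ?C (total (X j)) (G j)"
    and G0: "\<And>j z. j \<in> {1..n} \<Longrightarrow> z \<in> topspace Z \<Longrightarrow> G j (0, z) = f z j"
    and GH: "\<And>j t z. j \<in> {1..n} \<Longrightarrow> 0 \<le> t \<Longrightarrow> t \<le> 1 \<Longrightarrow> z \<in> topspace Z \<Longrightarrow> proj (X j) (G j (t, z)) = H (t, z)"
    by (metis atLeastAtMost_iff)
  define L where "L w = (\<lambda>j\<in>{1..n}. if j = i then sect (X i) (H w) else G j w)" for w
  have H_in: "H w \<in> topspace B" if "w \<in> topspace ?C" for w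
    using continuous_map_image_subset_topspace[OF H] that by auto
  have pL: "proj (X j) (L w j) = H w" if "w \<in> topspace ?C" "j \<in> {1..n}" for w j
    using that GH[of j "fst w" "snd w"] X_sect(2)[OF i H_in[OF that(1)]]
    by (cases w) (auto simp: L_def)
  have "continuous_map ?C (total PX) L"
  proof (rule continuous_map_into_fprods)
    fix j assume j: "j \<in> {1..n}"
    have "continuous_map ?C (total (X i)) (sect (X i) \<circ> H)"
      using H X[OF i] by (auto simp: fw_pointed_space_def intro: continuous_map_compose)
    then show "continuous_map ?C (total (X j)) (\<lambda>w. L w j)"
      using G[OF j] j by (cases "j = i") (simp_all add: L_def o_def eta_contract_eq)
  qed (simp_all add: pL, simp add: L_def)
  moreover have pL': "proj PX (L w) = H w" if "w \<in> topspace ?C" for w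
    using pL[OF that, of 1] n by (simp add: proj_PX)
  ultimately have "continuous_map ?C (total (rest i)) L"
    using i by (auto simp: rest_def continuous_map_in_subtopology L_def[of "(_, _)"])
  moreover have "L (0, z) = f z" if z: "z \<in> topspace Z" for z
  proof -
    \<comment> \<open>The prescribed start already has the section value at \<open>i\<close>, so the
      forced coordinate of \<open>L\<close> agrees with it at time 0.\<close>
    have "f z i = sect (X i) (H (0, z))" using f_in[OF z] H0 z by (simp add: topspace_rest)
    moreover have "f z \<in> extensional {1..n}"
      using f_in[OF z] by (simp add: topspace_rest topspace_fprods)
    ultimately show ?thesis
      using G0[OF _ z] by (auto simp: L_def fun_eq_iff extensional_def)
  qed
  moreover have "proj (rest i) (L (t, z)) = H (t, z)" if "t \<in> {0..1}" "z \<in> topspace Z" for t z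
    using pL'[of "(t, z)"] that by simp
  ultimately show "\<exists>G. continuous_map ?C (total (rest i)) G \<and> (\<forall>z \<in> topspace Z. G (0, z) = f z) \<and>
      (\<forall>t \<in> {0..1}. \<forall>z \<in> topspace Z. proj (rest i) (G (t, z)) = H (t, z))"
    by blast
qed

text \<open>The fibre over \<open>b0\<close> is the product of the fibres of the factors with
  coordinate \<open>i\<close> frozen at the section value, so paths can be chosen coordinate by
  coordinate.\<close>

lemma path_connected_fibre_rest:
  assumes i: "i \<in> {1..n}"
    and pc: "\<And>j. j \<in> {1..n} \<Longrightarrow>
      path_connected_space (subtopology (total (X j)) {x \<in> topspace (total (X j)). proj (X j) x = b0})"
  shows "path_connected_space
    (subtopology (total (rest i)) {z \<in> topspace (total (rest i)). proj (rest i) z = b0})" (is "path_connected_space ?F")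
  unfolding path_connected_space_def
proof (intro ballI)
  fix z w assume z: "z \<in> topspace ?F" and w: "w \<in> topspace ?F"
  then have zw: "z \<in> topspace (total PX)" "w \<in> topspace (total PX)" "proj PX z = b0" "proj PX w = b0"
    "z i = sect (X i) b0" "w i = sect (X i) b0"
    by (auto simp: topspace_rest)
  define F where "F j = subtopology (total (X j)) {x \<in> topspace (total (X j)). proj (X j) x = b0}" for j
  have "\<exists>g. pathin (F j) g \<and> g 0 = z j \<and> g 1 = w j" if j: "j \<in> {1..n}" for j
    using pc[OF j] zw j proj_coord[OF _ j] unfolding path_connected_space_def F_def
    by (auto simp: topspace_fprods)
  then have "\<forall>j\<in>{1..n}. \<exists>g. pathin (F j) g \<and> g 0 = z j \<and> g 1 = w j" by blast
  from bchoice[OF this] obtain g where g: "\<And>j. j \<in> {1..n} \<Longrightarrow> pathin (F j) (g j)"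
    and g01: "\<And>j. j \<in> {1..n} \<Longrightarrow> g j 0 = z j" "\<And>j. j \<in> {1..n} \<Longrightarrow> g j 1 = w j"
    by blast
  define h where "h t = (\<lambda>j\<in>{1..n}. if j = i then sect (X i) b0 else g j t)" for t :: real
  have ph: "proj (X j) (h t j) = b0" if t: "t \<in> {0..1}" and j: "j \<in> {1..n}" for t j
  proof -
    have "g j t \<in> {x \<in> topspace (total (X j)). proj (X j) x = b0}"
      using g[OF j] t by (auto simp: F_def pathin_def continuous_map_in_subtopology)
    then show ?thesis using j X_sect(2)[OF i b0] by (auto simp: h_def)
  qed
  have "continuous_map (top_of_set {0..1}) (total PX) h"
  proof (rule continuous_map_into_fprods)
    fix j assume j: "j \<in> {1..n}"
    then show "continuous_map (top_of_set {0..1}) (total (X j)) (\<lambda>t. h t j)"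
      using g[OF j] X_sect(1)[OF i b0]
      by (cases "j = i") (auto simp: h_def F_def pathin_def continuous_map_in_subtopology eta_contract_eq)
  qed (simp_all add: ph, simp add: h_def)
  moreover have "proj PX (h t) = b0" if "t \<in> {0..1}" for t
    using ph[OF that, of 1] n by (simp add: proj_PX)
  ultimately have "pathin ?F h"
    using i continuous_map_image_subset_topspace[of "top_of_set {0..1}" "total PX" h]
    by (auto simp: pathin_def rest_def continuous_map_in_subtopology h_def[of _ ] image_subset_iff)
  moreover have "h 0 = z" "h 1 = w"
    using zw g01 by (auto simp: h_def fun_eq_iff topspace_fprods extensional_def)
  ultimately show "\<exists>g. pathin ?F g \<and> g 0 = z \<and> g 1 = w" by blast
qed

section \<open>Homotopy classes of self-maps of a finite fibred product in coordinates\<close>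

lemma comp_at_class:
  assumes "fw_map B PX PX f" "i \<in> {1..n}"
  shows "comp_at B n X i (fw_class B PX PX f) = fw_class B PX (X i) (\<lambda>z. f z i)"
  using fw_comp_class[OF assms(1) fw_map_coord[OF assms(2)]] by (simp add: comp_at_def pr_def o_def)

lemma fw_map_at: "fw_map B PX PX f \<Longrightarrow> i \<in> {1..n} \<Longrightarrow> fw_map B PX (X i) (\<lambda>z. f z i)"
  using fw_map_comp[OF _ fw_map_coord] by (fastforce simp: o_def)

lemma comp_at_eq_pr_iff:
  assumes "fw_map B PX PX f" "i \<in> {1..n}"
  shows "comp_at B n X i (fw_class B PX PX f) = pr B n X i \<longleftrightarrow>
    fw_homotopic B PX (X i) (\<lambda>z. f z i) (\<lambda>z. z i)"
  by (simp only: comp_at_class[OF assms] pr_def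
      fw_class_eq_iff[OF fw_map_at[OF assms] fw_map_coord[OF assms(2)]])

text \<open>Conditions on the coordinates other than \<open>i\<close> are traded for one condition
  on their combined projection \<open>fill i\<close>. From right to left, one projects further to
  each coordinate.\<close>

lemma self_at_eq:
  assumes i: "i \<in> {1..n}"
  shows "self_at B b0 k n X i =
    fw_product.over_classes B b0 (rest i) PX (fill i) k"
proof -
  interpret fw_product B b0 "X i" "rest i" PX "\<lambda>z. z i" "fill i" "\<lambda>x r. r(i := x)"
    by (rule fw_product_rest[OF i])
  have "fw_homotopic B PX (rest i) (fill i \<circ> f) (fill i) \<longleftrightarrow>
      (\<forall>j \<in> {1..n} - {i}. fw_homotopic B PX (X j) (\<lambda>z. f z j) (\<lambda>z. z j))"
    if f: "fw_map B PX PX f" for f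
  proof
    assume hom: "fw_homotopic B PX (rest i) (fill i \<circ> f) (fill i)"
    show "\<forall>j \<in> {1..n} - {i}. fw_homotopic B PX (X j) (\<lambda>z. f z j) (\<lambda>z. z j)"
    proof
      fix j assume j: "j \<in> {1..n} - {i}"
      then have "fw_map B PX (X j) (\<lambda>z. z j)" by (intro fw_map_coord) simp
      then have "fw_map B (rest i) (X j) (\<lambda>z. z j)"
        by (auto simp: fw_map_def rest_def intro: continuous_map_from_subtopology)
      from fw_homotopic_compose_left[OF hom this]
      show "fw_homotopic B PX (X j) (\<lambda>z. f z j) (\<lambda>z. z j)" using j by (simp add: o_def fill_def)
    qed
  next
    assume hom: "\<forall>j \<in> {1..n} - {i}. fw_homotopic B PX (X j) (\<lambda>z. f z j) (\<lambda>z. z j)"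
    \<comment> \<open>The separate homotopies assemble to one in the full product, from
      \<open>f\<close> to a map that changes coordinate \<open>i\<close> alone. Such a change is
      invisible after \<open>fill i\<close>, which overwrites that coordinate.\<close>
    define g where "g z = (\<lambda>j\<in>{1..n}. if j = i then f z i else z j)" for z
    have h1: "fw_homotopic B PX PX (\<lambda>z. \<lambda>j\<in>{1..n}. f z j)
        (\<lambda>z. \<lambda>j\<in>{1..n}. (if j = i then (\<lambda>z. f z i) else (\<lambda>z. z j)) z)"
      by (rule fw_homotopic_tuple[OF pointed_PX])
        (use hom fw_homotopic_refl[OF fw_map_at[OF f i]] in auto)
    have h2: "fw_homotopic B PX PX f (\<lambda>z. \<lambda>j\<in>{1..n}. f z j)"
      by (rule fw_homotopic_eq[OF pointed_PX f])
        (use fw_map_in_topspace[OF f] in \<open>simp add: topspace_fprods extensional_restrict\<close>)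
    have g_eq: "(\<lambda>z. \<lambda>j\<in>{1..n}. (if j = i then (\<lambda>z. f z i) else (\<lambda>z. z j)) z) = g"
      by (auto simp: g_def fun_eq_iff)
    have fg: "fw_homotopic B PX PX f g"
      using fw_homotopic_trans[OF h2 h1] by (simp only: g_eq)
    then have g: "fw_map B PX PX g" using fw_homotopic_imp_map by blast
    have "fw_homotopic B PX (rest i) (fill i \<circ> f) (fill i \<circ> g)"
      by (rule fw_homotopic_compose_left[OF fg b])
    moreover have "fw_homotopic B PX (rest i) (fill i \<circ> g) (fill i)"
    proof (rule fw_homotopic_eq[OF pointed_PX fw_map_comp[OF g b]])
      fix z assume z: "z \<in> topspace (total PX)"
      have "proj PX (g z) = proj PX z" using fw_map_proj[OF g z] .
      then show "(fill i \<circ> g) z = fill i z"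
        using z i by (auto simp: fill_def g_def fun_eq_iff topspace_fprods extensional_def)
    qed
    ultimately show "fw_homotopic B PX (rest i) (fill i \<circ> f) (fill i)" by (rule fw_homotopic_trans)
  qed
  then have *: "fw_class B PX PX f \<in> self_at B b0 k n X i \<longleftrightarrow> fw_class B PX PX f \<in> over_classes k"
    if f: "fw_map B PX PX f" for f
    using f comp_at_eq_pr_iff[OF f]
    by (simp add: self_at_def class_in_over_classes[OF f] fw_class_in_self_classes[OF b0 f])
  show ?thesis
  proof (intro equalityI subsetI)
    fix c assume c: "c \<in> self_at B b0 k n X i"
    then have "c \<in> self_classes B b0 k PX" by (simp add: self_at_def)
    then obtain f where "fw_map B PX PX f" "c = fw_class B PX PX f" using b0 by (rule self_classesE) blast
    with c * show "c \<in> over_classes k" by blast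
  next
    fix c assume c: "c \<in> over_classes k"
    then have "c \<in> self_classes B b0 k PX" using over_classes_subset by blast
    then obtain f where "fw_map B PX PX f" "c = fw_class B PX PX f" using b0 by (rule self_classesE) blast
    with c * show "c \<in> self_at B b0 k n X i" by blast
  qed
qed

theorem split_exact_fprods:
  assumes i: "i \<in> {1..n}"
    and lift: "\<And>j m. j \<in> {1..n} \<Longrightarrow> homotopy_lifting (cube m) (total (X j)) B (proj (X j))"
    and pcX: "path_connected_space (total (X i))"
    and pcF: "\<And>j. j \<in> {1..n} \<Longrightarrow>
      path_connected_space (subtopology (total (X j)) {x \<in> topspace (total (X j)). proj (X j) x = b0})"
  shows "split_exact
    ((self_monoid B b0 k PX)\<lparr>carrier := self_at_under B b0 k n X i\<rparr>) (\<lambda>f. f)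
    ((self_monoid B b0 k PX)\<lparr>carrier := self_at B b0 k n X i\<rparr>) (phi_at B n X i)
    (self_monoid B b0 k (X i))"
proof -
  interpret fw_product B b0 "X i" "rest i" PX "\<lambda>z. z i" "fill i" "\<lambda>x r. r(i := x)"
    by (rule fw_product_rest[OF i])
  have "\<iota> = (\<lambda>x. \<lambda>j\<in>{1..n}. if j = i then x else sect (X j) (proj (X i) x))"
    using i by (auto simp: \<iota>_def fun_eq_iff sect_PX)
  then have incl: "fw_class B (X i) PX \<iota> = incl B n X i" by (simp only: incl_def)
  have under: "over_under_classes k = self_at_under B b0 k n X i"
    by (simp only: over_under_classes_def self_at_under_def self_at_eq[OF i] incl)
  have phi: "restrict_class = phi_at B n X i"
    by (simp add: fun_eq_iff restrict_class_def phi_at_def comp_at_def pr_def incl)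
  show ?thesis
    using split_exact_over_classes[OF lift[OF i] homotopy_lifting_rest[OF i lift] pcX
        path_connected_fibre_rest[OF i pcF], of k]
    by (simp only: under phi self_at_eq[OF i])
qed

section \<open>Factorisation of self-maps of a finite fibred product\<close>

lemma fw_tuple_class:
  assumes f: "\<And>i. i \<in> {1..n} \<Longrightarrow> fw_map B PX (X i) (f i)"
    and c: "\<And>i. i \<in> {1..n} \<Longrightarrow> c i = fw_class B PX (X i) (f i)"
  shows "fw_tuple B n X c = fw_class B PX PX (\<lambda>z. \<lambda>i\<in>{1..n}. f i z)"
proof (intro equalityI subsetI)
  fix h assume "h \<in> fw_tuple B n X c"
  then obtain g where g: "\<And>i. i \<in> {1..n} \<Longrightarrow> g i \<in> c i"
    and h: "fw_homotopic B PX PX (\<lambda>z. \<lambda>i\<in>{1..n}. g i z) h"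
    unfolding fw_tuple_def by blast
  have "fw_homotopic B PX PX (\<lambda>z. \<lambda>i\<in>{1..n}. f i z) (\<lambda>z. \<lambda>i\<in>{1..n}. g i z)"
    using g c by (intro fw_homotopic_tuple[OF pointed_PX]) (auto simp: fw_class_def)
  from fw_homotopic_trans[OF this h] show "h \<in> fw_class B PX PX (\<lambda>z. \<lambda>i\<in>{1..n}. f i z)"
    by (simp add: fw_class_def)
next
  fix h assume "h \<in> fw_class B PX PX (\<lambda>z. \<lambda>i\<in>{1..n}. f i z)"
  then show "h \<in> fw_tuple B n X c"
    unfolding fw_tuple_def using fw_homotopic_refl[OF f] c
    by (auto simp: fw_class_def intro!: exI[of _ f])
qed

lemma set_product_subset_self_classes:
  assumes "\<And>M. M \<in> set Ms \<Longrightarrow> M \<subseteq> self_classes B b0 k PX"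
  shows "set_product (self_monoid B b0 k PX) Ms \<subseteq> self_classes B b0 k PX"
  using assms
proof (induction Ms)
  case Nil
  show ?case using fw_class_id_self[OF pointed_PX b0] by (simp add: set_product_def self_monoid_def)
next
  case (Cons M Ms)
  then have "M \<subseteq> self_classes B b0 k PX" "set_product (self_monoid B b0 k PX) Ms \<subseteq> self_classes B b0 k PX"
    by auto
  then show ?case
    using fw_comp_classes_mem[OF _ _ b0, of _ k PX]
    by (auto simp: set_product_def set_mult_def self_monoid_def)
qed

text \<open>The factors are applied in increasing order of the index, so the product is written with
  decreasing indices. The first factor acts on the untouched point; this is why the factorisation
  through the projection is required only from index 2 on.\<close>

theorem self_classes_fprods_eq:
  assumes red: "\<And>c. c \<in> self_classes B b0 k PX \<Longrightarrow> k_reducibles B b0 k n X c"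
    and fac: "\<And>c i. c \<in> self_classes B b0 k PX \<Longrightarrow> i \<in> {2..n} \<Longrightarrow> comp_at B n X i c =
      fw_comp B PX (X i) (fw_comp B (X i) (X i) (comp_at B n X i c) (incl B n X i)) (pr B n X i)"
  shows "self_classes B b0 k PX =
    set_product (self_monoid B b0 k PX) (map (self_at B b0 k n X) (rev [1..<Suc n]))"
proof (intro equalityI subsetI)
  fix c assume "c \<in> set_product (self_monoid B b0 k PX) (map (self_at B b0 k n X) (rev [1..<Suc n]))"
  then show "c \<in> self_classes B b0 k PX"
    using set_product_subset_self_classes[of "map (self_at B b0 k n X) (rev [1..<Suc n])" k]
    by (auto simp: self_at_def)
next
  fix c assume c: "c \<in> self_classes B b0 k PX"
  then obtain f where f: "fw_map B PX PX f" "c = fw_class B PX PX f" using b0 by (rule self_classesE) blast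
  note fi = fw_map_at[OF f(1)]
  define v where "v i z = (\<lambda>l\<in>{1..n}. (if l = i then (\<lambda>z. f z l) else (\<lambda>z. z l)) z)" for i z
  define w where "w j z = (\<lambda>l\<in>{1..n}. (if l \<le> j then (\<lambda>z. f z l) else (\<lambda>z. z l)) z)" for j z
  text \<open>By \<open>step\<close> below, \<open>w j\<close> is homotopic to \<open>v j \<circ> \<dots> \<circ> v 1\<close>.\<close>
  have v: "fw_map B PX PX (v i)" for i
    unfolding v_def[abs_def] by (rule fw_map_tuple) (auto intro: fi fw_map_coord)
  have w: "fw_map B PX PX (w j)" for j
    unfolding w_def[abs_def] by (rule fw_map_tuple) (auto intro: fi fw_map_coord)
  have v_at: "fw_class B PX PX (v i) \<in> self_at B b0 k n X i" if i: "i \<in> {1..n}" for i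
  proof -
    have "fw_tuple B n X ((pr B n X)(i := comp_at B n X i c)) = fw_class B PX PX (v i)"
      unfolding v_def[abs_def]
    proof (rule fw_tuple_class)
      fix l assume l: "l \<in> {1..n}"
      show "fw_map B PX (X l) (if l = i then (\<lambda>z. f z l) else (\<lambda>z. z l))"
        using fi[OF l] fw_map_coord[OF l] by (cases "l = i") simp_all
      show "((pr B n X)(i := comp_at B n X i c)) l
          = fw_class B PX (X l) (if l = i then (\<lambda>z. f z l) else (\<lambda>z. z l))"
        using comp_at_class[OF f(1) i] by (simp add: f(2) pr_def)
    qed
    then have "fw_class B PX PX (v i) \<in> self_classes B b0 k PX"
      using red[OF c] i unfolding k_reducibles_def by metis
    moreover have "comp_at B n X j (fw_class B PX PX (v i)) = pr B n X j" if "j \<in> {1..n} - {i}" for j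
      using that fw_homotopic_refl[OF fw_map_coord[of j]]
      by (subst comp_at_eq_pr_iff[OF v]) (simp_all add: v_def)
    ultimately show ?thesis by (simp add: self_at_def)
  qed
  have step: "fw_homotopic B PX PX (w (Suc j)) (v (Suc j) \<circ> w j)" if j: "Suc j \<le> n" for j
  proof -
    let ?i = "Suc j"
    have i: "?i \<in> {1..n}" using j by simp
    \<comment> \<open>After the first \<open>j\<close> coordinates have been replaced, coordinate
      \<open>Suc j\<close> of \<open>f\<close> must still be what it would have been on the original
      point, up to homotopy.\<close>
    have key: "fw_homotopic B PX (X ?i) (\<lambda>z. f z ?i) (\<lambda>z. f (w j z) ?i)"
    proof (cases "j = 0")
      case True
      show ?thesis
      proof (rule fw_homotopic_eq[OF pointed_PX fi[OF i]])
        fix z assume "z \<in> topspace (total PX)"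
        then have "w j z = z" using True by (auto simp: w_def fun_eq_iff topspace_fprods extensional_def)
        then show "f z ?i = f (w j z) ?i" by simp
      qed
    next
      case False
      interpret fw_product B b0 "X ?i" "rest ?i" PX "\<lambda>z. z ?i" "fill ?i" "\<lambda>x r. r(?i := x)"
        by (rule fw_product_rest[OF i])
      have "\<iota> = (\<lambda>x. \<lambda>j\<in>{1..n}. if j = ?i then x else sect (X j) (proj (X ?i) x))"
        using i by (auto simp: \<iota>_def fun_eq_iff sect_PX)
      then have incl: "incl B n X ?i = fw_class B (X ?i) PX \<iota>" by (simp only: incl_def)
      note fi\<iota> = fw_map_comp[OF fw_map_\<iota> fi[OF i]]
      have "?i \<in> {2..n}" using i False by simp
      from fac[OF c this]
      have "fw_class B PX (X ?i) (\<lambda>z. f z ?i) = fw_class B PX (X ?i) ((\<lambda>z. f z ?i) \<circ> \<iota> \<circ> (\<lambda>z. z ?i))"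
        unfolding f(2) comp_at_class[OF f(1) i] incl pr_def
        by (simp only: fw_comp_class[OF fw_map_\<iota> fi[OF i]] fw_comp_class[OF a fi\<iota>])
      then have fac': "fw_homotopic B PX (X ?i) (\<lambda>z. f z ?i) ((\<lambda>z. f z ?i) \<circ> \<iota> \<circ> (\<lambda>z. z ?i))"
        using fw_class_eq_iff[OF fi[OF i] fw_map_comp[OF a fi\<iota>]] by simp
      from fw_homotopic_compose_right[OF fac' w[of j]]
      have "fw_homotopic B PX (X ?i) (\<lambda>z. f (w j z) ?i) ((\<lambda>z. f z ?i) \<circ> \<iota> \<circ> (\<lambda>z. z ?i) \<circ> w j)"
        by (simp add: o_def)
      \<comment> \<open>\<open>w j\<close> changes coordinates up to \<open>j\<close> only, so it is
        absorbed by the projection to coordinate \<open>Suc j\<close>.\<close>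
      moreover have "(\<lambda>z. f z ?i) \<circ> \<iota> \<circ> (\<lambda>z. z ?i) \<circ> w j = (\<lambda>z. f z ?i) \<circ> \<iota> \<circ> (\<lambda>z. z ?i)"
        using i by (simp add: fun_eq_iff w_def)
      ultimately show ?thesis
        using fw_homotopic_trans[OF fac' fw_homotopic_sym] by simp
    qed
    have "fw_homotopic B PX PX (w ?i)
        (\<lambda>z. \<lambda>l\<in>{1..n}. (if l = ?i then (\<lambda>z. f (w j z) l) else (\<lambda>z. w j z l)) z)"
      unfolding w_def[of ?i, abs_def]
    proof (rule fw_homotopic_tuple[OF pointed_PX])
      fix l assume l: "l \<in> {1..n}"
      show "fw_homotopic B PX (X l) (if l \<le> ?i then (\<lambda>z. f z l) else (\<lambda>z. z l))
          (if l = ?i then (\<lambda>z. f (w j z) l) else (\<lambda>z. w j z l))"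
        using key l fw_homotopic_refl[OF fi[OF l]] fw_homotopic_refl[OF fw_map_coord[OF l]]
        by (auto simp: w_def le_Suc_eq)
    qed
    moreover have "(\<lambda>z. \<lambda>l\<in>{1..n}. (if l = ?i then (\<lambda>z. f (w j z) l) else (\<lambda>z. w j z l)) z) = v ?i \<circ> w j"
      by (auto simp: fun_eq_iff v_def)
    ultimately show ?thesis by simp
  qed
  have "fw_class B PX PX (w j) \<in>
      set_product (self_monoid B b0 k PX) (map (self_at B b0 k n X) (rev [1..<Suc j]))" if "j \<le> n" for j
    using that
  proof (induction j)
    case 0
    have "fw_homotopic B PX PX (w 0) id"
      by (rule fw_homotopic_eq[OF pointed_PX w])
        (auto simp: w_def fun_eq_iff topspace_fprods extensional_def)
    then show ?case by (simp add: set_product_def self_monoid_def fw_class_eqI)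
  next
    case (Suc j)
    have "fw_class B PX PX (w (Suc j)) = fw_comp B PX PX (fw_class B PX PX (v (Suc j))) (fw_class B PX PX (w j))"
      unfolding fw_comp_class[OF w v] by (rule fw_class_eqI[OF step[OF Suc.prems]])
    moreover have "fw_class B PX PX (v (Suc j)) \<in> self_at B b0 k n X (Suc j)"
      using Suc.prems by (intro v_at) simp
    \<comment> \<open>The new factor stands at the head of the list, hence is the outermost map of
      the composite.\<close>
    moreover have "rev [1..<Suc (Suc j)] = Suc j # rev [1..<Suc j]" by simp
    ultimately show ?case
      using Suc by (auto simp: set_product_def set_mult_def self_monoid_def simp del: upt_Suc)
  qed
  then have "fw_class B PX PX (w n) \<in>
      set_product (self_monoid B b0 k PX) (map (self_at B b0 k n X) (rev [1..<Suc n]))" by simp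
  moreover have "fw_homotopic B PX PX (w n) f"
  proof (rule fw_homotopic_eq[OF pointed_PX w])
    fix z assume z: "z \<in> topspace (total PX)"
    then have "f z \<in> extensional {1..n}" using fw_map_in_topspace[OF f(1) z] by (simp add: topspace_fprods)
    then show "w n z = f z" by (auto simp: w_def fun_eq_iff extensional_def)
  qed
  ultimately show "c \<in> set_product (self_monoid B b0 k PX) (map (self_at B b0 k n X) (rev [1..<Suc n]))"
    by (simp add: f(2) fw_class_eqI)
qed

end

text \<open>That each \<open>phi_at\<close> is a monoid homomorphism is part of
  \<open>split_exact\<close>. The homotopy conditions on the components appear as equalities of
  classes, and \<open>rev [1..<Suc n]\<close> runs from n down to 1.\<close>

theorem theoremA:
  fixes B :: "'b topology" and b0 :: 'b and k :: nat
  assumes "CW_complex B" and "connected_space B" and "b0 \<in> topspace B"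
  shows
    "(\<forall>(X :: ('b, 'x) fw_space) (Y :: ('b, 'y) fw_space).
        CW_fw_space TYPE('k) B b0 X \<and> CW_fw_space TYPE('k) B b0 Y \<longrightarrow>
        split_exact
          ((self_monoid B b0 k (fprod X Y))\<lparr>carrier := self_over_Y_under_X B b0 k X Y\<rparr>) (\<lambda>f. f)
          ((self_monoid B b0 k (fprod X Y))\<lparr>carrier := self_over_Y B b0 k X Y\<rparr>) (phiX B X Y)
          (self_monoid B b0 k X) \<and>
        split_exact
          ((self_monoid B b0 k (fprod X Y))\<lparr>carrier := self_over_X_under_Y B b0 k X Y\<rparr>) (\<lambda>f. f)
          ((self_monoid B b0 k (fprod X Y))\<lparr>carrier := self_over_X B b0 k X Y\<rparr>) (phiY B X Y)
          (self_monoid B b0 k Y) \<and>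
        ((\<forall>f \<in> self_classes B b0 k (fprod X Y).
            k_reducible B b0 k X Y f \<and>
            compY B X Y f =
              fw_comp B (fprod X Y) Y (fw_comp B Y Y (compY B X Y f) (inY B X Y)) (prY B X Y)) \<longrightarrow>
         self_classes B b0 k (fprod X Y) =
           self_over_X B b0 k X Y <#>\<^bsub>self_monoid B b0 k (fprod X Y)\<^esub> self_over_Y B b0 k X Y)) \<and>
     (\<forall>(n :: nat) (X :: nat \<Rightarrow> ('b, 'z) fw_space).
        n \<ge> 1 \<and> (\<forall>i \<in> {1..n}. CW_fw_space TYPE('k) B b0 (X i)) \<longrightarrow>
        (\<forall>i \<in> {1..n}.
           split_exact
             ((self_monoid B b0 k (fprods n X))\<lparr>carrier := self_at_under B b0 k n X i\<rparr>) (\<lambda>f. f)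
             ((self_monoid B b0 k (fprods n X))\<lparr>carrier := self_at B b0 k n X i\<rparr>) (phi_at B n X i)
             (self_monoid B b0 k (X i))) \<and>
        ((\<forall>f \<in> self_classes B b0 k (fprods n X).
            k_reducibles B b0 k n X f \<and>
            (\<forall>i \<in> {2..n}. comp_at B n X i f =
               fw_comp B (fprods n X) (X i)
                 (fw_comp B (X i) (X i) (comp_at B n X i f) (incl B n X i)) (pr B n X i))) \<longrightarrow>
         self_classes B b0 k (fprods n X) =
           set_product (self_monoid B b0 k (fprods n X))
             (map (self_at B b0 k n X) (rev [1..<Suc n]))))"
proof (intro conjI allI impI ballI; (elim conjE)?)
  note b0 = assms(3)
  fix X :: "('b, 'x) fw_space" and Y :: "('b, 'y) fw_space"
  assume X: "CW_fw_space TYPE('k) B b0 X" and Y: "CW_fw_space TYPE('k) B b0 Y"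
  note split_exact_fprod[OF b0 X Y]
  then show "split_exact
      ((self_monoid B b0 k (fprod X Y))\<lparr>carrier := self_over_Y_under_X B b0 k X Y\<rparr>) (\<lambda>f. f)
      ((self_monoid B b0 k (fprod X Y))\<lparr>carrier := self_over_Y B b0 k X Y\<rparr>) (phiX B X Y)
      (self_monoid B b0 k X)"
    and "split_exact
      ((self_monoid B b0 k (fprod X Y))\<lparr>carrier := self_over_X_under_Y B b0 k X Y\<rparr>) (\<lambda>f. f)
      ((self_monoid B b0 k (fprod X Y))\<lparr>carrier := self_over_X B b0 k X Y\<rparr>) (phiY B X Y)
      (self_monoid B b0 k Y)" .
  assume "\<forall>f \<in> self_classes B b0 k (fprod X Y).
    k_reducible B b0 k X Y f \<and>
    compY B X Y f = fw_comp B (fprod X Y) Y (fw_comp B Y Y (compY B X Y f) (inY B X Y)) (prY B X Y)"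
  then show "self_classes B b0 k (fprod X Y) =
      self_over_X B b0 k X Y <#>\<^bsub>self_monoid B b0 k (fprod X Y)\<^esub> self_over_Y B b0 k X Y"
    by (intro self_classes_fprod_eq b0 CW_fw_spaceD(1)[OF X] CW_fw_spaceD(1)[OF Y]) blast+
next
  fix n :: nat and X :: "nat \<Rightarrow> ('b, 'z) fw_space"
  assume n: "n \<ge> 1" and "\<forall>i \<in> {1..n}. CW_fw_space TYPE('k) B b0 (X i)"
  then have CW: "\<And>i. i \<in> {1..n} \<Longrightarrow> CW_fw_space TYPE('k) B b0 (X i)" by blast
  interpret fw_family B b0 n X
    using assms(3) n CW_fw_spaceD(1)[OF CW] by unfold_locales
  show "split_exact
      ((self_monoid B b0 k (fprods n X))\<lparr>carrier := self_at_under B b0 k n X i\<rparr>) (\<lambda>f. f)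
      ((self_monoid B b0 k (fprods n X))\<lparr>carrier := self_at B b0 k n X i\<rparr>) (phi_at B n X i)
      (self_monoid B b0 k (X i))" if i: "i \<in> {1..n}" for i
    by (rule split_exact_fprods[OF i CW_fw_spaceD(2)[OF CW] CW_fw_spaceD(3)[OF CW[OF i]] CW_fw_spaceD(4)[OF CW]])
  assume "\<forall>f \<in> self_classes B b0 k (fprods n X).
    k_reducibles B b0 k n X f \<and>
    (\<forall>i \<in> {2..n}. comp_at B n X i f =
      fw_comp B (fprods n X) (X i)
        (fw_comp B (X i) (X i) (comp_at B n X i f) (incl B n X i)) (pr B n X i))"
  then show "self_classes B b0 k (fprods n X) =
      set_product (self_monoid B b0 k (fprods n X)) (map (self_at B b0 k n X) (rev [1..<Suc n]))"
    by (intro self_classes_fprods_eq) blast+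
qed

end
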